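(* Let $m$ be a positive integer, $\lambda=(\lambda_1,\dots,\lambda_m)\in(\mathbb{C}^* )^m$ and let $W$ be a $\mathfrak{gl}(m)$-module. Then $M_{\mathfrak p}(\widetilde W)\cong F(\Omega(\lambda),W)^{\sigma_\lambda}$ as $\mathfrak{sl}(m+1)$-modules.
   Context: All algebras and vector spaces are over $\mathbb{C}$; $E_{i,j}$ denotes the matrix unit. Generalized Verma module: in $\mathfrak{s}=\mathfrak{sl}(m+1)$ let $\mathfrak{l}=\mathrm{span}\{E_{i,j},\ E_{i,i}-E_{m+1,m+1}\mid 1\le i\ne j\le m\}$, $\mathfrak{u}=\sum_{s=1}^m\mathbb{C}E_{s,m+1}$, $\mathfrak{p}=\mathfrak{l}\oplus\mathfrak{u}$. For an $\mathfrak{l}$-module $V$, extended to $\mathfrak{p}$ by $\mathfrak{u}V=0$, put $M_{\mathfrak p}(V)=U(\mathfrak{s})\otimes_{U(\mathfrak p)}V$. The module $\widetilde W$: it equals $W$ as a vector space, with $\mathfrak{l}$-action (written $\ast$) $E_{i,j}\ast v=\lambda_i^{-1}\lambda_jE_{i,j}v$ for $1\le i\neq j\le m$ and $(E_{i,i}-E_{m+1,m+1})\ast v=\big(\sum_{s=1}^mE_{s,s}+E_{i,i}-m-1\big)v$ for $1\le i\le m$, where the right-hand sides use the $\mathfrak{gl}(m)$-action on $W$ (and $-m-1$ acts as a scalar). Tensor modules: the Witt algebra $W_m$ is the derivation Lie algebra of $\mathbb{C}[t_1^{\pm1},\dots,t_m^{\pm1}]$, with basis $t^\alpha\frac{\partial}{\partial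 t_i}$ ($\alpha\in\mathbb{Z}^m$, $1\le i\le m$), $t^\alpha=t_1^{\alpha_1}\cdots t_m^{\alpha_m}$. The Weyl algebra is $K_m=\mathbb{C}[t_1^{\pm1},\dots,t_m^{\pm1},\frac{\partial}{\partial t_1},\dots,\frac{\partial}{\partial t_m}]$ (differential operators on the Laurent polynomial algebra). There is a Lie algebra homomorphism $\pi:W_m\to K_m\otimes U(\mathfrak{gl}(m))$, $\pi(t^\alpha\frac{\partial}{\partial t_i})=t^\alpha\frac{\partial}{\partial t_i}\otimes1+\sum_{s=1}^m\frac{\partial}{\partial t_s}(t^\alpha)\otimes E_{s,i}$. For a $K_m$-module $P$ and a $\mathfrak{gl}(m)$-module $W$, $F(P,W)$ is the $W_m$-module $P\otimes W$ with $W_m$ acting through $\pi$. The module $\Omega(\lambda)$ is the $K_m$-module $\mathbb{C}[x_1,\dots,x_m]$ with $t_i^{\pm1}\cdot f(x_1,\dots,x_m)=\lambda_i^{\pm1}f(x_1,\dots,x_i\mp1,\dots,x_m)$ and $t_i\frac{\partial}{\partial t_i}\cdot f=x_if$. The map $\sigma_\lambda$: let $d=\sum_{s=1}^mt_s\frac{\partial}{\partial t_s}$ and let $\mathfrak{s}'=\mathrm{span}\{t_i\frac{\partial}{\partial t_j},\ t_id,\ \frac{\partial}{\partial t_i}\mid1\le i,j\le m\}$, a Lie subalgebra of $W_m$. The Lie algebra isomorphism $\sigma_\lambda:\mathfrak{s}\to\mathfrak{s}'$ is given, for $1\le i\ne j\le m$, by $\sigma_\lambda(E_{i,j})=\lambda_i^{-1}\lambda_jt_i\frac{\partial}{\partial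 t_j}-\lambda_j\frac{\partial}{\partial t_j}$, and for $1\le i\le m$ by $\sigma_\lambda(E_{m+1,i})=-\lambda_i\frac{\partial}{\partial t_i}$, $\sigma_\lambda(E_{i,m+1})=\lambda_i^{-1}t_id-d-\sum_{s=1}^m\big(\lambda_s\lambda_i^{-1}t_i\frac{\partial}{\partial t_s}-\lambda_s\frac{\partial}{\partial t_s}\big)$, $\sigma_\lambda(E_{i,i}-E_{m+1,m+1})=\sum_{s=1}^m\big(t_s\frac{\partial}{\partial t_s}-\lambda_s\frac{\partial}{\partial t_s}\big)+\big(t_i\frac{\partial}{\partial t_i}-\lambda_i\frac{\partial}{\partial t_i}\big)$. $F(\Omega(\lambda),W)^{\sigma_\lambda}$ is the $\mathfrak{s}$-module with underlying space $F(\Omega(\lambda),W)$ (restricted to $\mathfrak{s}'$) and action $a\cdot v=\sigma_\lambda(a)v$ for $a\in\mathfrak{s}$. *)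

theory Defs
  imports
    "HOL-Analysis.Determinants"
    "HOL-Library.Poly_Mapping"
    "HOL-Algebra.QuotRing"
    "HOL-Algebra.Module"
begin

section \<open>Complex vector spaces\<close>

text \<open>
  Complex vector spaces are HOL-Algebra modules over the field below. The record type of modules
  extends that of rings; where there is no multiplication, the fields \<open>mult\<close> and \<open>one\<close> are
  left unspecified, and the locale \<open>module\<close> does not constrain them.
\<close>

definition complex_field :: "complex ring" where
  "complex_field = \<lparr>carrier = UNIV, mult = (*), one = 1, zero = 0, add = (+)\<rparr>"

definition free_space :: "'a set \<Rightarrow> (complex, 'a \<Rightarrow>\<^sub>0 complex) module" where
  "free_space X =
    \<lparr>carrier = {f. Poly_Mapping.keys f \<subseteq> X}, mult = undefined, one = undefined,
     zero = 0, add = (+), smult = (\<lambda>c. Poly_Mapping.map ((*) c))\<rparr>"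

definition lin_span :: "(complex, 'a, 'x) module_scheme \<Rightarrow> 'a set \<Rightarrow> 'a set" where
  "lin_span M S = (\<lambda>H. submodule H complex_field M) hull S"

definition quot_space :: "(complex, 'a, 'x) module_scheme \<Rightarrow> 'a set \<Rightarrow> (complex, 'a set) module" where
  "quot_space M N =
    \<lparr>carrier = a_rcosets\<^bsub>M\<^esub> N, mult = undefined, one = undefined,
     zero = N, add = set_add M, smult = (\<lambda>c X. \<Union>x\<in>X. N +>\<^bsub>M\<^esub> (c \<odot>\<^bsub>M\<^esub> x))\<rparr>"


section \<open>Tensor products\<close>

text \<open>
  \<open>M \<otimes>\<^sub>R N\<close> for a set \<open>R\<close> of scalars acting on \<open>M\<close> from the right by \<open>ra\<close> and on \<open>N\<close> from the
  left by \<open>la\<close>: the free vector space on pairs modulo the subspace spanned by the bilinearity and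
  balancing relations.
\<close>

abbreviation pure :: "'a \<Rightarrow> 'b \<Rightarrow> ('a \<times> 'b) \<Rightarrow>\<^sub>0 complex" where
  "pure m n \<equiv> Poly_Mapping.single (m, n) 1"

definition tensor_free ::
  "(complex, 'a, 'x) module_scheme \<Rightarrow> (complex, 'b, 'y) module_scheme
    \<Rightarrow> (complex, ('a \<times> 'b) \<Rightarrow>\<^sub>0 complex) module" where
  "tensor_free M N = free_space (carrier M \<times> carrier N)"

definition tensor_rels ::
  "'r set \<Rightarrow> ('a \<Rightarrow> 'r \<Rightarrow> 'a) \<Rightarrow> ('r \<Rightarrow> 'b \<Rightarrow> 'b) \<Rightarrow> (complex, 'a, 'x) module_scheme
    \<Rightarrow> (complex, 'b, 'y) module_scheme \<Rightarrow> (('a \<times> 'b) \<Rightarrow>\<^sub>0 complex) set" where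
  "tensor_rels R ra la M N =
     {pure (m \<oplus>\<^bsub>M\<^esub> m') n - pure m n - pure m' n | m m' n.
        m \<in> carrier M \<and> m' \<in> carrier M \<and> n \<in> carrier N}
   \<union> {pure m (n \<oplus>\<^bsub>N\<^esub> n') - pure m n - pure m n' | m n n'.
        m \<in> carrier M \<and> n \<in> carrier N \<and> n' \<in> carrier N}
   \<union> {pure (c \<odot>\<^bsub>M\<^esub> m) n - Poly_Mapping.single (m, n) c | c m n.
        m \<in> carrier M \<and> n \<in> carrier N}
   \<union> {pure m (c \<odot>\<^bsub>N\<^esub> n) - Poly_Mapping.single (m, n) c | c m n.
        m \<in> carrier M \<and> n \<in> carrier N}
   \<union> {pure (ra m r) n - pure m (la r n) | r m n.
        r \<in> R \<and> m \<in> carrier M \<and> n \<in> carrier N}"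

definition tensor_kernel ::
  "'r set \<Rightarrow> ('a \<Rightarrow> 'r \<Rightarrow> 'a) \<Rightarrow> ('r \<Rightarrow> 'b \<Rightarrow> 'b) \<Rightarrow> (complex, 'a, 'x) module_scheme
    \<Rightarrow> (complex, 'b, 'y) module_scheme \<Rightarrow> (('a \<times> 'b) \<Rightarrow>\<^sub>0 complex) set" where
  "tensor_kernel R ra la M N = lin_span (tensor_free M N) (tensor_rels R ra la M N)"

definition tensor ::
  "'r set \<Rightarrow> ('a \<Rightarrow> 'r \<Rightarrow> 'a) \<Rightarrow> ('r \<Rightarrow> 'b \<Rightarrow> 'b) \<Rightarrow> (complex, 'a, 'x) module_scheme
    \<Rightarrow> (complex, 'b, 'y) module_scheme \<Rightarrow> (complex, (('a \<times> 'b) \<Rightarrow>\<^sub>0 complex) set) module" where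
  "tensor R ra la M N = quot_space (tensor_free M N) (tensor_kernel R ra la M N)"

definition free_map :: "('a \<Rightarrow> 'b) \<Rightarrow> ('a \<Rightarrow>\<^sub>0 complex) \<Rightarrow> ('b \<Rightarrow>\<^sub>0 complex)" where
  "free_map h f = (\<Sum>k\<in>Poly_Mapping.keys f. Poly_Mapping.single (h k) (Poly_Mapping.lookup f k))"

text \<open>The endomorphism \<open>f \<otimes> g\<close> of \<open>M \<otimes>\<^sub>R N\<close>.\<close>

definition tensor_op ::
  "'r set \<Rightarrow> ('a \<Rightarrow> 'r \<Rightarrow> 'a) \<Rightarrow> ('r \<Rightarrow> 'b \<Rightarrow> 'b) \<Rightarrow> (complex, 'a, 'x) module_scheme
    \<Rightarrow> (complex, 'b, 'y) module_scheme \<Rightarrow> ('a \<Rightarrow> 'a) \<Rightarrow> ('b \<Rightarrow> 'b)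
    \<Rightarrow> (('a \<times> 'b) \<Rightarrow>\<^sub>0 complex) set \<Rightarrow> (('a \<times> 'b) \<Rightarrow>\<^sub>0 complex) set" where
  "tensor_op R ra la M N f g X =
     (\<Union>z\<in>X. tensor_kernel R ra la M N +>\<^bsub>tensor_free M N\<^esub> free_map (map_prod f g) z)"

definition ctensor ::
  "(complex, 'a, 'x) module_scheme \<Rightarrow> (complex, 'b, 'y) module_scheme
    \<Rightarrow> (complex, (('a \<times> 'b) \<Rightarrow>\<^sub>0 complex) set) module" where
  "ctensor M N = tensor (UNIV :: complex set) (\<lambda>m c. c \<odot>\<^bsub>M\<^esub> m) (\<lambda>c n. c \<odot>\<^bsub>N\<^esub> n) M N"

definition ctensor_op ::
  "(complex, 'a, 'x) module_scheme \<Rightarrow> (complex, 'b, 'y) module_scheme \<Rightarrow> ('a \<Rightarrow> 'a) \<Rightarrow> ('b \<Rightarrow> 'b)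
    \<Rightarrow> (('a \<times> 'b) \<Rightarrow>\<^sub>0 complex) set \<Rightarrow> (('a \<times> 'b) \<Rightarrow>\<^sub>0 complex) set" where
  "ctensor_op M N =
     tensor_op (UNIV :: complex set) (\<lambda>m c. c \<odot>\<^bsub>M\<^esub> m) (\<lambda>c n. c \<odot>\<^bsub>N\<^esub> n) M N"


section \<open>Lie algebras and their modules\<close>

record 'g lie_algebra = "(complex, 'g) module" +
  bracket :: "'g \<Rightarrow> 'g \<Rightarrow> 'g"

text \<open>A vector space together with operators indexed by a Lie or associative algebra.\<close>

record ('a, 'v) rep = "(complex, 'v) module" +
  act :: "'a \<Rightarrow> 'v \<Rightarrow> 'v"

definition make_rep :: "(complex, 'v, 'x) module_scheme \<Rightarrow> ('a \<Rightarrow> 'v \<Rightarrow> 'v) \<Rightarrow> ('a, 'v) rep" where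
  "make_rep M f =
    \<lparr>carrier = carrier M, mult = mult M, one = one M, zero = zero M, add = add M,
     smult = smult M, act = f\<rparr>"

definition linear_op :: "(complex, 'v, 'x) module_scheme \<Rightarrow> ('v \<Rightarrow> 'v) \<Rightarrow> bool" where
  "linear_op V f \<longleftrightarrow>
     f \<in> carrier V \<rightarrow> carrier V \<and>
     (\<forall>v\<in>carrier V. \<forall>w\<in>carrier V. f (v \<oplus>\<^bsub>V\<^esub> w) = f v \<oplus>\<^bsub>V\<^esub> f w) \<and>
     (\<forall>c. \<forall>v\<in>carrier V. f (c \<odot>\<^bsub>V\<^esub> v) = c \<odot>\<^bsub>V\<^esub> f v)"

definition lie_module :: "('g, 'x) lie_algebra_scheme \<Rightarrow> ('g, 'v) rep \<Rightarrow> bool" where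
  "lie_module L V \<longleftrightarrow>
     Module.module complex_field V \<and>
     (\<forall>x\<in>carrier L. linear_op V (act V x)) \<and>
     (\<forall>x\<in>carrier L. \<forall>y\<in>carrier L. \<forall>v\<in>carrier V.
        act V (x \<oplus>\<^bsub>L\<^esub> y) v = act V x v \<oplus>\<^bsub>V\<^esub> act V y v) \<and>
     (\<forall>c. \<forall>x\<in>carrier L. \<forall>v\<in>carrier V. act V (c \<odot>\<^bsub>L\<^esub> x) v = c \<odot>\<^bsub>V\<^esub> act V x v) \<and>
     (\<forall>x\<in>carrier L. \<forall>y\<in>carrier L. \<forall>v\<in>carrier V.
        act V (bracket L x y) v = act V x (act V y v) \<ominus>\<^bsub>V\<^esub> act V y (act V x v))"

definition lie_module_iso ::
  "('g, 'x) lie_algebra_scheme \<Rightarrow> ('g, 'v) rep \<Rightarrow> ('g, 'w) rep \<Rightarrow> bool" where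
  "lie_module_iso L V W \<longleftrightarrow>
     lie_module L V \<and> lie_module L W \<and>
     (\<exists>\<phi>. bij_betw \<phi> (carrier V) (carrier W) \<and>
        (\<forall>v\<in>carrier V. \<forall>v'\<in>carrier V. \<phi> (v \<oplus>\<^bsub>V\<^esub> v') = \<phi> v \<oplus>\<^bsub>W\<^esub> \<phi> v') \<and>
        (\<forall>c. \<forall>v\<in>carrier V. \<phi> (c \<odot>\<^bsub>V\<^esub> v) = c \<odot>\<^bsub>W\<^esub> \<phi> v) \<and>
        (\<forall>x\<in>carrier L. \<forall>v\<in>carrier V. \<phi> (act V x v) = act W x (\<phi> v)))"

definition twist :: "('h \<Rightarrow> 'g) \<Rightarrow> ('g, 'v) rep \<Rightarrow> ('h, 'v) rep" where
  "twist \<sigma> V = make_rep V (\<lambda>a. act V (\<sigma> a))"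


section \<open>Universal enveloping algebras\<close>

text \<open>Words under concatenation, written additively: polynomial mappings on words then form the
  free associative algebra, with the convolution product.\<close>

datatype 'a fword = FWord (letters: "'a list")

instantiation fword :: (type) monoid_add
begin

definition zero_fword :: "'a fword" where
  "zero_fword = FWord []"

definition plus_fword :: "'a fword \<Rightarrow> 'a fword \<Rightarrow> 'a fword" where
  "plus_fword v w = FWord (letters v @ letters w)"

instance
  by standard (simp_all add: zero_fword_def plus_fword_def)

end

abbreviation scalar :: "complex \<Rightarrow> ('a :: zero) \<Rightarrow>\<^sub>0 complex" where
  "scalar c \<equiv> Poly_Mapping.single 0 c"

definition free_alg :: "'a set \<Rightarrow> ('a fword \<Rightarrow>\<^sub>0 complex) ring" where
  "free_alg S =
    \<lparr>carrier = {p. \<forall>w\<in>Poly_Mapping.keys p. set (letters w) \<subseteq> S},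
     mult = (*), one = 1, zero = 0, add = (+)\<rparr>"

abbreviation gen :: "'a \<Rightarrow> 'a fword \<Rightarrow>\<^sub>0 complex" where
  "gen x \<equiv> Poly_Mapping.single (FWord [x]) 1"

definition uea_rels :: "('g, 'x) lie_algebra_scheme \<Rightarrow> ('g fword \<Rightarrow>\<^sub>0 complex) set" where
  "uea_rels L =
     {gen (x \<oplus>\<^bsub>L\<^esub> y) - gen x - gen y | x y. x \<in> carrier L \<and> y \<in> carrier L}
   \<union> {gen (c \<odot>\<^bsub>L\<^esub> x) - scalar c * gen x | c x. x \<in> carrier L}
   \<union> {gen x * gen y - gen y * gen x - gen (bracket L x y) | x y. x \<in> carrier L \<and> y \<in> carrier L}"

definition uea_ideal :: "('g, 'x) lie_algebra_scheme \<Rightarrow> ('g fword \<Rightarrow>\<^sub>0 complex) set" where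
  "uea_ideal L = Idl\<^bsub>free_alg (carrier L)\<^esub> (uea_rels L)"

definition uea_class ::
  "('g, 'x) lie_algebra_scheme \<Rightarrow> ('g fword \<Rightarrow>\<^sub>0 complex) \<Rightarrow> ('g fword \<Rightarrow>\<^sub>0 complex) set" where
  "uea_class L p = uea_ideal L +>\<^bsub>free_alg (carrier L)\<^esub> p"

definition uea ::
  "('g, 'x) lie_algebra_scheme \<Rightarrow> (complex, ('g fword \<Rightarrow>\<^sub>0 complex) set) module" where
  "uea L =
    (let Q = free_alg (carrier L) Quot uea_ideal L
     in \<lparr>carrier = carrier Q, mult = mult Q, one = one Q, zero = zero Q, add = add Q,
         smult = (\<lambda>c u. uea_class L (scalar c) \<otimes>\<^bsub>Q\<^esub> u)\<rparr>)"

text \<open>The algebra homomorphism \<open>U(P) \<rightarrow> U(L)\<close> induced by the inclusion of a subalgebra \<open>P\<close> of \<open>L\<close>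
  (both have the same underlying type).\<close>

definition uea_incl ::
  "('g, 'x) lie_algebra_scheme \<Rightarrow> ('g, 'y) lie_algebra_scheme
    \<Rightarrow> ('g fword \<Rightarrow>\<^sub>0 complex) set \<Rightarrow> ('g fword \<Rightarrow>\<^sub>0 complex) set" where
  "uea_incl P L u = the_elem (uea_class L ` u)"

text \<open>The action of \<open>U(L)\<close> on an \<open>L\<close>-module, computed on representatives.\<close>

definition free_alg_act :: "('g, 'v) rep \<Rightarrow> ('g fword \<Rightarrow>\<^sub>0 complex) \<Rightarrow> 'v \<Rightarrow> 'v" where
  "free_alg_act V p v =
     (\<Oplus>\<^bsub>V\<^esub>w\<in>Poly_Mapping.keys p. Poly_Mapping.lookup p w \<odot>\<^bsub>V\<^esub> foldr (act V) (letters w) v)"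

definition uea_act :: "('g, 'v) rep \<Rightarrow> ('g fword \<Rightarrow>\<^sub>0 complex) set \<Rightarrow> 'v \<Rightarrow> 'v" where
  "uea_act V u v = the_elem ((\<lambda>p. free_alg_act V p v) ` u)"

text \<open>\<open>U(L) \<otimes>\<^bsub>U(P)\<^esub> V\<close> with \<open>L\<close> acting by left multiplication on \<open>U(L)\<close>.\<close>

definition induced_module ::
  "('g, 'x) lie_algebra_scheme \<Rightarrow> ('g, 'y) lie_algebra_scheme \<Rightarrow> ('g, 'v) rep
    \<Rightarrow> ('g, (('g fword \<Rightarrow>\<^sub>0 complex) set \<times> 'v \<Rightarrow>\<^sub>0 complex) set) rep" where
  "induced_module L P V =
    (let U = uea L; R = carrier (uea P); ra = (\<lambda>u r. u \<otimes>\<^bsub>U\<^esub> uea_incl P L r); la = uea_act V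
     in make_rep (tensor R ra la U V)
          (\<lambda>x. tensor_op R ra la U V (\<lambda>u. uea_class L (gen x) \<otimes>\<^bsub>U\<^esub> u) id))"


section \<open>\<open>gl(m)\<close>, \<open>sl(m+1)\<close> and generalized Verma modules\<close>

text \<open>
  The number \<open>m\<close> is the cardinality of the index type \<open>'m\<close>; the index type of \<open>sl(m+1)\<close> is
  \<open>'m option\<close>, where \<open>None\<close> is the last index \<open>m+1\<close>.
\<close>

definition munit :: "'k::finite \<Rightarrow> 'k \<Rightarrow> complex ^ 'k ^ 'k" where
  "munit i j = (\<chi> a b. if a = i \<and> b = j then 1 else 0)"

definition gl :: "(complex ^ 'k::finite ^ 'k) lie_algebra" where
  "gl = \<lparr>carrier = UNIV, mult = undefined, one = undefined, zero = 0, add = (+),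
         smult = (\<lambda>c. map_matrix ((*) c)), bracket = (\<lambda>A B. A ** B - B ** A)\<rparr>"

definition sl :: "(complex ^ 'k::finite ^ 'k) lie_algebra" where
  "sl = gl\<lparr>carrier := {A. trace A = 0}\<rparr>"

definition levi :: "(complex ^ 'm::finite option ^ 'm option) set" where
  "levi = lin_span sl
     ({munit (Some i) (Some j) | i j. i \<noteq> j} \<union> {munit (Some i) (Some i) - munit None None | i. True})"

definition nilradical :: "(complex ^ 'm::finite option ^ 'm option) set" where
  "nilradical = lin_span sl {munit (Some s) None | s. True}"

definition parabolic :: "(complex ^ 'm::finite option ^ 'm option) lie_algebra" where
  "parabolic = sl\<lparr>carrier := levi <+>\<^bsub>sl\<^esub> nilradical\<rparr>"

definition inflate ::
  "(complex ^ 'm::finite option ^ 'm option, 'v) rep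
    \<Rightarrow> (complex ^ 'm option ^ 'm option, 'v) rep" where
  "inflate V = make_rep V (\<lambda>A. act V (THE a. a \<in> levi \<and> A - a \<in> nilradical))"

definition gen_verma ::
  "(complex ^ 'm::finite option ^ 'm option, 'v) rep
    \<Rightarrow> (complex ^ 'm option ^ 'm option,
        (((complex ^ 'm option ^ 'm option) fword \<Rightarrow>\<^sub>0 complex) set \<times> 'v \<Rightarrow>\<^sub>0 complex) set) rep" where
  "gen_verma V = induced_module sl parabolic (inflate V)"

text \<open>Action of the basis of the Levi part, consisting of the \<open>E(i,j)\<close> for \<open>i \<noteq> j\<close> and of
  the \<open>E(i,i) - E(m+1,m+1)\<close>. The coefficient of an element \<open>A\<close> at the basis vector indexed by
  \<open>(i, j)\<close> is its entry there in both cases.\<close>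

definition W_tilde_basis ::
  "('m::finite \<Rightarrow> complex) \<Rightarrow> (complex ^ 'm ^ 'm, 'w) rep \<Rightarrow> 'm \<Rightarrow> 'm \<Rightarrow> 'w \<Rightarrow> 'w" where
  "W_tilde_basis lam W i j v =
    (if i \<noteq> j then (inverse (lam i) * lam j) \<odot>\<^bsub>W\<^esub> act W (munit i j) v
     else (\<Oplus>\<^bsub>W\<^esub>s\<in>UNIV. act W (munit s s) v) \<oplus>\<^bsub>W\<^esub> act W (munit i i) v
            \<ominus>\<^bsub>W\<^esub> (of_nat CARD('m) + 1) \<odot>\<^bsub>W\<^esub> v)"

definition W_tilde ::
  "('m::finite \<Rightarrow> complex) \<Rightarrow> (complex ^ 'm ^ 'm, 'w) rep
    \<Rightarrow> (complex ^ 'm option ^ 'm option, 'w) rep" where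
  "W_tilde lam W = make_rep W
     (\<lambda>A v. \<Oplus>\<^bsub>W\<^esub>i\<in>UNIV. \<Oplus>\<^bsub>W\<^esub>j\<in>UNIV. A $ Some i $ Some j \<odot>\<^bsub>W\<^esub> W_tilde_basis lam W i j v)"


section \<open>Laurent polynomials, Weyl algebra and tensor modules\<close>

type_synonym 'm laurent = "('m \<Rightarrow>\<^sub>0 int) \<Rightarrow>\<^sub>0 complex"
type_synonym 'm mpoly = "('m \<Rightarrow>\<^sub>0 nat) \<Rightarrow>\<^sub>0 complex"

definition tpow :: "('m \<Rightarrow>\<^sub>0 int) \<Rightarrow> 'm laurent" where
  "tpow \<alpha> = Poly_Mapping.single \<alpha> 1"

definition tvar :: "'m \<Rightarrow> 'm laurent" where
  "tvar i = tpow (Poly_Mapping.single i 1)"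

definition tvar_inv :: "'m \<Rightarrow> 'm laurent" where
  "tvar_inv i = tpow (Poly_Mapping.single i (-1))"

definition pd :: "'m \<Rightarrow> 'm laurent \<Rightarrow> 'm laurent" where
  "pd i p = (\<Sum>\<alpha>\<in>Poly_Mapping.keys p.
     Poly_Mapping.single (\<alpha> - Poly_Mapping.single i 1)
       (of_int (Poly_Mapping.lookup \<alpha> i) * Poly_Mapping.lookup p \<alpha>))"

text \<open>\<open>K\<^sub>m\<close> as an algebra of operators, multiplied by composition.\<close>

inductive_set weyl_algebra :: "('m laurent \<Rightarrow> 'm laurent) set" where
  mult: "(\<lambda>p. q * p) \<in> weyl_algebra"
| pd: "pd i \<in> weyl_algebra"
| add: "X \<in> weyl_algebra \<Longrightarrow> Y \<in> weyl_algebra \<Longrightarrow> (\<lambda>p. X p + Y p) \<in> weyl_algebra"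
| comp: "X \<in> weyl_algebra \<Longrightarrow> Y \<in> weyl_algebra \<Longrightarrow> X \<circ> Y \<in> weyl_algebra"

definition weyl_module :: "('m laurent \<Rightarrow> 'm laurent, 'v) rep \<Rightarrow> bool" where
  "weyl_module P \<longleftrightarrow>
     Module.module complex_field P \<and>
     (\<forall>X\<in>weyl_algebra. linear_op P (act P X)) \<and>
     (\<forall>X\<in>weyl_algebra. \<forall>Y\<in>weyl_algebra. \<forall>v\<in>carrier P.
        act P (\<lambda>p. X p + Y p) v = act P X v \<oplus>\<^bsub>P\<^esub> act P Y v) \<and>
     (\<forall>X\<in>weyl_algebra. \<forall>Y\<in>weyl_algebra. \<forall>v\<in>carrier P.
        act P (X \<circ> Y) v = act P X (act P Y v)) \<and>
     (\<forall>c. \<forall>v\<in>carrier P. act P (\<lambda>p. scalar c * p) v = c \<odot>\<^bsub>P\<^esub> v)"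

definition xvar :: "'m \<Rightarrow> 'm mpoly" where
  "xvar i = Poly_Mapping.single (Poly_Mapping.single i 1) 1"

definition subst :: "('m::finite \<Rightarrow> 'm mpoly) \<Rightarrow> 'm mpoly \<Rightarrow> 'm mpoly" where
  "subst q f = (\<Sum>\<alpha>\<in>Poly_Mapping.keys f.
     scalar (Poly_Mapping.lookup f \<alpha>) * (\<Prod>i\<in>UNIV. q i ^ Poly_Mapping.lookup \<alpha> i))"

text \<open>\<open>f(x\<^sub>1, \<dots>, x\<^sub>i + c, \<dots>, x\<^sub>m)\<close>\<close>

definition shift :: "'m::finite \<Rightarrow> complex \<Rightarrow> 'm mpoly \<Rightarrow> 'm mpoly" where
  "shift i c = subst (\<lambda>j. if j = i then xvar j + scalar c else xvar j)"

text \<open>The formulas on \<open>t\<^sub>i\<close>, \<open>t\<^sub>i\<^sup>-\<^sup>1\<close> and \<open>t\<^sub>i \<partial>\<^sub>i\<close> determine the whole module structure, because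
  these operators generate \<open>K\<^sub>m\<close>; extensionality makes the action unique as a function.\<close>

definition Omega_act ::
  "('m::finite \<Rightarrow> complex) \<Rightarrow> ('m laurent \<Rightarrow> 'm laurent) \<Rightarrow> 'm mpoly \<Rightarrow> 'm mpoly" where
  "Omega_act lam = (THE \<rho>. \<rho> \<in> extensional weyl_algebra \<and>
     weyl_module (make_rep (free_space UNIV) \<rho>) \<and>
     (\<forall>i f. \<rho> (\<lambda>p. tvar i * p) f = scalar (lam i) * shift i (-1) f) \<and>
     (\<forall>i f. \<rho> (\<lambda>p. tvar_inv i * p) f = scalar (inverse (lam i)) * shift i 1 f) \<and>
     (\<forall>i f. \<rho> (\<lambda>p. tvar i * pd i p) f = xvar i * f))"

definition Omega :: "('m::finite \<Rightarrow> complex) \<Rightarrow> ('m laurent \<Rightarrow> 'm laurent, 'm mpoly) rep" where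
  "Omega lam = make_rep (free_space UNIV) (Omega_act lam)"

text \<open>
  \<open>F(P, W)\<close>. An element of the Witt algebra is a derivation \<open>D = \<Sum>\<^sub>i D(t\<^sub>i) \<partial>\<^sub>i\<close>, so its coefficient
  at the basis vector \<open>t\<^sup>\<alpha> \<partial>\<^sub>i\<close> is the coefficient of \<open>t\<^sup>\<alpha>\<close> in \<open>D(t\<^sub>i)\<close>. The action is that of
  \<open>\<pi>(D)\<close>, where an elementary tensor \<open>X \<otimes> u\<close> acts on \<open>P \<otimes> W\<close> by the operator \<open>X \<otimes> u\<close>.
\<close>

definition tensor_module_basis ::
  "('m::finite laurent \<Rightarrow> 'm laurent, 'p) rep \<Rightarrow> (complex ^ 'm ^ 'm, 'w) rep
    \<Rightarrow> ('m \<Rightarrow>\<^sub>0 int) \<Rightarrow> 'm \<Rightarrow> ('p \<times> 'w \<Rightarrow>\<^sub>0 complex) set \<Rightarrow> ('p \<times> 'w \<Rightarrow>\<^sub>0 complex) set" where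
  "tensor_module_basis P W \<alpha> i z =
     ctensor_op P W (act P (\<lambda>p. tpow \<alpha> * pd i p)) id z
     \<oplus>\<^bsub>ctensor P W\<^esub>
     (\<Oplus>\<^bsub>ctensor P W\<^esub>s\<in>UNIV.
        ctensor_op P W (act P (\<lambda>p. pd s (tpow \<alpha>) * p)) (act W (munit s i)) z)"

definition tensor_module ::
  "('m::finite laurent \<Rightarrow> 'm laurent, 'p) rep \<Rightarrow> (complex ^ 'm ^ 'm, 'w) rep
    \<Rightarrow> ('m laurent \<Rightarrow> 'm laurent, ('p \<times> 'w \<Rightarrow>\<^sub>0 complex) set) rep" where
  "tensor_module P W = make_rep (ctensor P W)
     (\<lambda>D z. \<Oplus>\<^bsub>ctensor P W\<^esub>i\<in>UNIV. \<Oplus>\<^bsub>ctensor P W\<^esub>\<alpha>\<in>Poly_Mapping.keys (D (tvar i)).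
        Poly_Mapping.lookup (D (tvar i)) \<alpha> \<odot>\<^bsub>ctensor P W\<^esub> tensor_module_basis P W \<alpha> i z)"


section \<open>The isomorphism \<open>\<sigma>\<^sub>\<lambda>\<close>\<close>

definition euler :: "'m::finite laurent \<Rightarrow> 'm laurent" where
  "euler p = (\<Sum>s\<in>UNIV. tvar s * pd s p)"

definition sigma_levi ::
  "('m::finite \<Rightarrow> complex) \<Rightarrow> 'm \<Rightarrow> 'm \<Rightarrow> 'm laurent \<Rightarrow> 'm laurent" where
  "sigma_levi lam i j p =
    (if i \<noteq> j
     then scalar (inverse (lam i) * lam j) * (tvar i * pd j p) - scalar (lam j) * pd j p
     else (\<Sum>s\<in>UNIV. tvar s * pd s p - scalar (lam s) * pd s p)
            + (tvar i * pd i p - scalar (lam i) * pd i p))"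

definition sigma_lower :: "('m::finite \<Rightarrow> complex) \<Rightarrow> 'm \<Rightarrow> 'm laurent \<Rightarrow> 'm laurent" where
  "sigma_lower lam i p = - (scalar (lam i) * pd i p)"

definition sigma_upper :: "('m::finite \<Rightarrow> complex) \<Rightarrow> 'm \<Rightarrow> 'm laurent \<Rightarrow> 'm laurent" where
  "sigma_upper lam i p =
     scalar (inverse (lam i)) * (tvar i * euler p) - euler p
     - (\<Sum>s\<in>UNIV. scalar (lam s * inverse (lam i)) * (tvar i * pd s p) - scalar (lam s) * pd s p)"

definition sigma ::
  "('m::finite \<Rightarrow> complex) \<Rightarrow> complex ^ 'm option ^ 'm option \<Rightarrow> 'm laurent \<Rightarrow> 'm laurent" where
  "sigma lam A p =
     (\<Sum>i\<in>UNIV. \<Sum>j\<in>UNIV. scalar (A $ Some i $ Some j) * sigma_levi lam i j p)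
   + (\<Sum>i\<in>UNIV. scalar (A $ None $ Some i) * sigma_lower lam i p)
   + (\<Sum>i\<in>UNIV. scalar (A $ Some i $ None) * sigma_upper lam i p)"

end

theory Submission
  imports Defs "HOL-Computational_Algebra.Primes"
begin

text \<open>
  In the coordinates \<open>y\<^sub>i = \<lambda>\<^sub>i\<^sup>-\<^sup>1 t\<^sub>i - 1\<close> the map \<open>\<sigma>\<^sub>\<lambda>\<close> becomes the realisation of \<open>sl(m+1)\<close> by projective vector
  fields, and every \<open>y\<^sub>i\<close> kills the vector \<open>1\<close> of \<open>\<Omega>(\<lambda>)\<close>. Hence \<open>1 \<otimes> W\<close> is stable under the parabolic
  subalgebra and isomorphic to the inflation of \<open>W\<close> twisted as in the statement, so Frobenius reciprocity
  gives a homomorphism from the generalized Verma module to \<open>F(\<Omega>(\<lambda>), W)\<close>.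
  The commuting elements \<open>E\<^sub>i = E\<^sub>m\<^sub>+\<^sub>1\<^sub>,\<^sub>i\<close> act by \<open>f \<otimes> w \<mapsto> -(x\<^sub>i + 1) f(x + e\<^sub>i) \<otimes> w\<close> and generate all polynomials
  from \<open>1\<close>, which gives surjectivity. The Verma module is spanned by the vectors \<open>E\<^sup>\<alpha> (1 \<otimes> w)\<close>; the image of
  such a vector evaluated at \<open>x = -1 - \<beta>\<close> vanishes unless \<open>\<alpha> \<le> \<beta>\<close> and is \<open>\<alpha>! w\<close> for \<open>\<beta> = \<alpha>\<close>, and this
  triangularity gives injectivity.
\<close>

section \<open>Complex vector spaces\<close>

text \<open>The conclusion asserts both module structures, so they have to be built. The parabolic
  relations on the twist of \<open>W\<close> are inherited: \<open>w \<mapsto> pt 1 w\<close> is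
  injective and intertwining, and its target is already a module. The scalar -m-1 in the twist is a
  divergence. For \<open>A\<close> in the parabolic every component of \<open>sigma lam A\<close>
  kills 1, so by the Leibniz rule the field acts on 1 as minus the sum of the derivatives of its
  components, and that sum is m+1 times the trace of the upper left block. The description defining
  \<open>Omega_act\<close> must be shown to have exactly one solution; formal series supply the
  operators, because on them composition is a product of infinite matrices with finitely many
  diagonals. The Witt action uses a derivation only through its values on the variables
  \<open>tvar i\<close>, so the bracket relation for \<open>sigma\<close> is checked only there. The
  points -1-\<beta> are dictated by the factor x_i+1, which vanishes where x_i = -1 and so stops the
  chain of shifts.\<close>

abbreviation "keys \<equiv> Poly_Mapping.keys"
abbreviation "lookup \<equiv> Poly_Mapping.lookup"
abbreviation "single \<equiv> Poly_Mapping.single"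

abbreviation cscale :: "complex \<Rightarrow> ('a \<Rightarrow>\<^sub>0 complex) \<Rightarrow> ('a \<Rightarrow>\<^sub>0 complex)" where
  "cscale c \<equiv> Poly_Mapping.map ((*) c)"

lemma lookup_cscale [simp]: "lookup (cscale c f) k = c * lookup f k"
  by (simp add: Poly_Mapping.map.rep_eq when_def)

global_interpretation cvs: vector_space "cscale :: complex \<Rightarrow> ('a \<Rightarrow>\<^sub>0 complex) \<Rightarrow> _"
  by unfold_locales (auto intro!: poly_mapping_eqI simp: lookup_add algebra_simps)

global_interpretation cvs_pair: vector_space_pair
  "cscale :: complex \<Rightarrow> ('a \<Rightarrow>\<^sub>0 complex) \<Rightarrow> _" "cscale :: complex \<Rightarrow> ('b \<Rightarrow>\<^sub>0 complex) \<Rightarrow> _"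
  by unfold_locales

lemma scalar_times: "scalar c * (f :: 'a::monoid_add \<Rightarrow>\<^sub>0 complex) = cscale c f"
  by (simp add: mult_map_scale_conv_mult)

lemma cscale_times_left: "cscale c f * g = cscale c (f * (g :: 'a::monoid_add \<Rightarrow>\<^sub>0 complex))"
  by (simp add: mult_map_scale_conv_mult mult.assoc)

text \<open>Words do not commute, so centrality of the constants is read off from coefficients: a
  constant is supported on the neutral element, and the convolution keeps one summand.\<close>

lemma cscale_times_right: "f * cscale c g = cscale c (f * (g :: 'a::monoid_add \<Rightarrow>\<^sub>0 complex))"
proof -
  have "scalar c * f = f * scalar c"
  proof (rule poly_mapping_eqI)
    fix k :: 'a
    have *: "Sum_any (\<lambda>q. lookup (scalar c) q when k = l + q) = (c when k = l)" for l :: 'a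
    proof -
      have "(\<lambda>q. lookup (scalar c) q when k = l + q) = (\<lambda>q. (c when k = l) when q = 0)"
        by (auto simp: lookup_single when_def fun_eq_iff)
      then show ?thesis by (simp only: Sum_any_when_equal)
    qed
    have "lookup (scalar c * f) k = c * lookup f k"
      by (simp add: scalar_times)
    moreover have "lookup (f * scalar c) k = lookup f k * c"
      unfolding lookup_mult * by (simp add: mult_when)
    ultimately show "lookup (scalar c * f) k = lookup (f * scalar c) k"
      by simp
  qed
  then have "f * (scalar c * g) = scalar c * (f * g)"
    by (metis mult.assoc)
  then show ?thesis by (simp add: scalar_times)
qed

lemma keys_cscale: "keys (cscale c f) \<subseteq> keys f"
  by (auto simp: in_keys_iff)

lemma subspace_keys: "cvs.subspace {p. keys p \<subseteq> X}"
proof (rule cvs.subspaceI)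
  fix p q :: "'a \<Rightarrow>\<^sub>0 complex"
  assume "p \<in> {p. keys p \<subseteq> X}" "q \<in> {p. keys p \<subseteq> X}"
  then show "p + q \<in> {p. keys p \<subseteq> X}"
    using Poly_Mapping.keys_add[of p q] by blast
next
  fix p :: "'a \<Rightarrow>\<^sub>0 complex" and c assume "p \<in> {p. keys p \<subseteq> X}"
  then show "cscale c p \<in> {p. keys p \<subseteq> X}"
    using keys_cscale[of c p] by blast
qed simp

lemma poly_mapping_sum_single:
  fixes p :: "'a \<Rightarrow>\<^sub>0 'b::comm_monoid_add"
  shows "(\<Sum>k\<in>keys p. single k (lookup p k)) = p"
  by (rule poly_mapping_eqI)
    (auto simp: lookup_sum lookup_single when_def in_keys_iff sum.delta')

lemma cscale_single [simp]: "cscale c (single k d) = single k (c * d)"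
  by (rule poly_mapping_eqI) (simp add: lookup_single when_def)

lemma poly_mapping_keys_induct [consumes 1, case_names zero single add]:
  fixes p :: "'a \<Rightarrow>\<^sub>0 'b::comm_monoid_add"
  assumes "keys p \<subseteq> X" and "P 0" and "\<And>k c. k \<in> X \<Longrightarrow> P (single k c)"
    and "\<And>p q. keys p \<subseteq> X \<Longrightarrow> keys q \<subseteq> X \<Longrightarrow> P p \<Longrightarrow> P q \<Longrightarrow> P (p + q)"
  shows "P p"
proof -
  have *: "P (\<Sum>k\<in>A. single k (lookup p k)) \<and>
      keys (\<Sum>k\<in>A. single k (lookup p k)) \<subseteq> X"
    if "finite A" "A \<subseteq> X" for A
    using that
  proof (induction A)
    case (insert a A)
    let ?a = "single a (lookup p a)"
      and ?A = "\<Sum>k\<in>A. single k (lookup p k)"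
    have a: "keys ?a \<subseteq> X" and A: "P ?A" "keys ?A \<subseteq> X"
      using insert by auto
    have "P (?a + ?A)"
      using insert.prems by (intro assms(4) assms(3) a A) auto
    moreover have "keys (?a + ?A) \<subseteq> X"
      using a A(2) Poly_Mapping.keys_add[of ?a ?A] by blast
    ultimately show ?case using insert.hyps by simp
  qed (simp add: assms)
  show ?thesis using *[of "keys p"] assms(1) by (simp add: poly_mapping_sum_single)
qed

text \<open>The linear map with prescribed values on the basis \<open>single k 1\<close>. Free maps,
  substitution, partial derivatives and, in coordinates, the action of the free algebra have this
  form and share its linearity.\<close>

definition lext :: "('a \<Rightarrow> ('b \<Rightarrow>\<^sub>0 complex)) \<Rightarrow> ('a \<Rightarrow>\<^sub>0 complex) \<Rightarrow> ('b \<Rightarrow>\<^sub>0 complex)" where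
  "lext B p = (\<Sum>k\<in>keys p. cscale (lookup p k) (B k))"

lemma lext_superset:
  assumes "finite A" "keys p \<subseteq> A"
  shows "lext B p = (\<Sum>k\<in>A. cscale (lookup p k) (B k))"
  unfolding lext_def by (rule sum.mono_neutral_left) (use assms in \<open>auto simp: in_keys_iff\<close>)

lemma lext_add: "lext B (p + q) = lext B p + lext B q"
proof -
  let ?A = "keys p \<union> keys q"
  have "lext B (p + q) = (\<Sum>k\<in>?A. cscale (lookup (p + q) k) (B k))"
    by (rule lext_superset) (auto simp: Poly_Mapping.keys_add)
  then show ?thesis
    by (simp add: lext_superset[of ?A] lookup_add cvs.scale_left_distrib sum.distrib)
qed

lemma lext_cscale: "lext B (cscale c p) = cscale c (lext B p)"
  by (subst lext_superset[of "keys p"])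
    (simp_all add: keys_cscale lext_def cvs.scale_sum_right)

lemma linear_lext: "Vector_Spaces.linear cscale cscale (lext B)"
  by (simp add: Vector_Spaces.linear_iff lext_add lext_cscale cvs.vector_space_axioms)

lemma lext_single [simp]: "lext B (single k c) = cscale c (B k)"
  by (simp add: lext_def)

lemmas lext_0 [simp] = cvs_pair.linear_0[OF linear_lext]
lemmas lext_diff = cvs_pair.linear_diff[OF linear_lext]

lemma linear_eq_lext:
  assumes "Vector_Spaces.linear cscale cscale f"
  shows "f p = lext (\<lambda>k. f (single k 1)) p"
proof -
  have "f (\<Sum>k\<in>keys p. cscale (lookup p k) (single k 1)) =
      (\<Sum>k\<in>keys p. cscale (lookup p k) (f (single k 1)))"
    unfolding cvs_pair.linear_sum[OF assms]
    by (intro sum.cong refl cvs_pair.linear_scale[OF assms])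
  then show ?thesis by (simp add: lext_def poly_mapping_sum_single)
qed

lemma lext_closed:
  assumes "keys p \<subseteq> X" "\<And>k. k \<in> X \<Longrightarrow> B k \<in> S" "cvs.subspace S"
  shows "lext B p \<in> S"
  unfolding lext_def
  by (intro cvs.subspace_sum cvs.subspace_scale assms) (use assms(1) in blast)

lemma lext_cong:
  assumes "keys p \<subseteq> X" "\<And>k. k \<in> X \<Longrightarrow> B k = B' k"
  shows "lext B p = lext B' p"
  unfolding lext_def by (rule sum.cong) (use assms in auto)

text \<open>A basis of \<open>K\<close> is extended to a basis of the whole space, and
  \<open>\<pi>\<close> kills exactly the part coming from \<open>K\<close>. Through
  \<open>\<pi>\<close> a quotient by \<open>K\<close> is realised inside a space of
  functions.\<close>

lemma subspace_kernel_exists: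
  assumes "cvs.subspace (K :: ('k \<Rightarrow>\<^sub>0 complex) set)"
  shows "\<exists>\<pi> :: ('k \<Rightarrow>\<^sub>0 complex) \<Rightarrow> ('k \<Rightarrow>\<^sub>0 complex).
    Vector_Spaces.linear cscale cscale \<pi> \<and> (\<forall>p. \<pi> p = 0 \<longleftrightarrow> p \<in> K)"
proof -
  obtain BK where BK: "BK \<subseteq> K" "cvs.independent BK" "K \<subseteq> cvs.span BK"
    by (rule cvs.maximal_independent_subset)
  obtain B where B: "BK \<subseteq> B" "B \<subseteq> UNIV" "cvs.independent B" "UNIV \<subseteq> cvs.span B"
    by (rule cvs.maximal_independent_subset_extend[OF subset_UNIV BK(2)])
  obtain \<pi> :: "('k \<Rightarrow>\<^sub>0 complex) \<Rightarrow> ('k \<Rightarrow>\<^sub>0 complex)" where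
    \<pi>: "Vector_Spaces.linear cscale cscale \<pi>" "\<And>b. b \<in> B \<Longrightarrow> \<pi> b = (if b \<in> BK then 0 else b)"
    using cvs_pair.linear_independent_extend[OF B(3), of "\<lambda>b. if b \<in> BK then 0 else b"] by blast
  note lin = cvs_pair.linear_0[OF \<pi>(1)] cvs_pair.linear_add[OF \<pi>(1)] cvs_pair.linear_scale[OF \<pi>(1)]
  have span: "cvs.span BK = K" using BK assms by (simp add: cvs.span_subspace)
  \<comment> \<open>On basis vectors the difference is the vector itself or 0. This is what confines
    the kernel of \<open>\<pi>\<close> to \<open>K\<close>.\<close>
  have diff: "p - \<pi> p \<in> K" for p
  proof -
    have "p \<in> cvs.span B" using B by auto
    then show ?thesis
    proof (induction rule: cvs.span_induct_alt)
      case base then show ?case using lin cvs.subspace_0[OF assms] by simp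
    next
      case (step c x y)
      have "x - \<pi> x \<in> K" using step(1) \<pi>(2) BK cvs.subspace_0[OF assms] by auto
      then have "cscale c (x - \<pi> x) + (y - \<pi> y) \<in> K"
        using step(2) assms by (intro cvs.subspace_add cvs.subspace_scale)
      moreover have "cscale c x + y - \<pi> (cscale c x + y) = cscale c (x - \<pi> x) + (y - \<pi> y)"
        by (simp add: lin cvs.scale_right_diff_distrib)
      ultimately show ?case by (simp only:)
    qed
  qed
  have "\<pi> p = 0" if "p \<in> K" for p
    using that unfolding span[symmetric]
  proof (induction rule: cvs.span_induct_alt)
    case (step c x y)
    then show ?case using \<pi>(2)[of x] B lin by auto
  qed (use lin in simp)
  moreover have "p \<in> K" if "\<pi> p = 0" for p
    using diff[of p] that by simp
  ultimately show ?thesis using \<pi>(1) by blast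
qed

lemma cring_complex_field: "cring complex_field"
  by (intro cringI abelian_groupI comm_monoidI)
    (auto simp: complex_field_def algebra_simps intro: exI[of _ "- _"])

text \<open>Identities in a vector space given as a record are proved after applying a linear embedding
  into a space of finitely supported functions, where the arithmetic is that of a type class.\<close>

locale cspace =
  fixes M :: "(complex, 'v, 'x) module_scheme" (structure)
    and j :: "'v \<Rightarrow> ('k \<Rightarrow>\<^sub>0 complex)"
  assumes zero_closed [simp, intro]: "\<zero> \<in> carrier M"
    and add_closed [simp, intro]: "\<lbrakk>x \<in> carrier M; y \<in> carrier M\<rbrakk> \<Longrightarrow> x \<oplus> y \<in> carrier M"
    and smult_closed [simp, intro]: "x \<in> carrier M \<Longrightarrow> c \<odot>\<^bsub>M\<^esub> x \<in> carrier M"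
    and j_zero [simp]: "j \<zero> = 0"
    and j_add [simp]: "\<lbrakk>x \<in> carrier M; y \<in> carrier M\<rbrakk> \<Longrightarrow> j (x \<oplus> y) = j x + j y"
    and j_smult [simp]: "x \<in> carrier M \<Longrightarrow> j (c \<odot>\<^bsub>M\<^esub> x) = cscale c (j x)"
    and j_inj: "\<lbrakk>x \<in> carrier M; y \<in> carrier M; j x = j y\<rbrakk> \<Longrightarrow> x = y"
begin

lemma module: "Module.module complex_field M"
proof (rule Module.moduleI)
  show "abelian_group M"
  proof (rule abelian_groupI)
    fix x assume x: "x \<in> carrier M"
    show "\<exists>y\<in>carrier M. y \<oplus> x = \<zero>"
      by (rule bexI[of _ "(-1) \<odot>\<^bsub>M\<^esub> x"]) (use x in \<open>auto intro!: j_inj\<close>)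
  qed (auto intro!: j_inj simp: algebra_simps)
qed (auto intro!: j_inj simp: cring_complex_field complex_field_def algebra_simps cring_complex_field[unfolded complex_field_def])

lemma abelian_group: "abelian_group M"
  using module by (simp add: Module.module_def)

lemma uminus_closed [simp, intro]: "x \<in> carrier M \<Longrightarrow> \<ominus> x \<in> carrier M"
  using abelian_group by (simp add: abelian_group.a_inv_closed)

lemma j_uminus [simp]: assumes "x \<in> carrier M" shows "j (\<ominus> x) = - j x"
proof -
  have "j (\<ominus> x \<oplus> x) = j \<zero>" using abelian_group.l_neg[OF abelian_group assms] by simp
  then show ?thesis using assms by (simp add: eq_neg_iff_add_eq_0 del: j_zero) (simp)
qed

lemma minus_closed [simp, intro]: "\<lbrakk>x \<in> carrier M; y \<in> carrier M\<rbrakk> \<Longrightarrow> x \<ominus> y \<in> carrier M"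
  by (simp add: a_minus_def)

lemma j_minus [simp]: "\<lbrakk>x \<in> carrier M; y \<in> carrier M\<rbrakk> \<Longrightarrow> j (x \<ominus> y) = j x - j y"
  by (simp add: a_minus_def)

lemma finsum_closed [simp, intro]: "(\<And>a. a \<in> A \<Longrightarrow> f a \<in> carrier M) \<Longrightarrow> finsum M f A \<in> carrier M"
  using abelian_group by (simp add: abelian_group_def abelian_monoid.finsum_closed Pi_def)

lemma j_finsum [simp]:
  assumes "\<And>a. a \<in> A \<Longrightarrow> f a \<in> carrier M" shows "j (finsum M f A) = (\<Sum>a\<in>A. j (f a))"
proof -
  interpret abelian_group M by (rule abelian_group)
  show ?thesis
  proof (cases "finite A")
    case True then show ?thesis using assms
      by (induction A) (auto simp: Pi_def finsum_insert)
  qed (simp add: finsum_infinite)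
qed

lemma subspace_image: 
  assumes "H \<subseteq> carrier M" "\<zero> \<in> H" "\<And>x y. x \<in> H \<Longrightarrow> y \<in> H \<Longrightarrow> x \<oplus> y \<in> H"
    "\<And>c x. x \<in> H \<Longrightarrow> c \<odot>\<^bsub>M\<^esub> x \<in> H"
  shows "cvs.subspace (j ` H)"
proof (rule cvs.subspaceI)
  show "0 \<in> j ` H" using assms(2) j_zero by force
next
  fix x y assume "x \<in> j ` H" "y \<in> j ` H"
  then obtain a b where "a \<in> H" "b \<in> H" "x = j a" "y = j b" by auto
  then show "x + y \<in> j ` H" using assms by (intro image_eqI[of _ _ "a \<oplus> b"]) (auto simp: subset_iff)
next
  fix x c assume "x \<in> j ` H"
  then obtain a where "a \<in> H" "x = j a" by auto
  then show "cscale c x \<in> j ` H" using assms by (intro image_eqI[of _ _ "c \<odot>\<^bsub>M\<^esub> a"]) (auto simp: subset_iff)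
qed

lemma subspace_range: "cvs.subspace (j ` carrier M)"
  by (rule subspace_image) auto

end

text \<open>A space is the quotient of the free space on its own carrier by the formal combinations
  that evaluate to zero. Projecting along these turns \<open>single v 1\<close> into coordinates of
  \<open>v\<close>.\<close>

lemma cspace_exists:
  fixes M :: "(complex, 'v, 'x) module_scheme"
  assumes "Module.module complex_field M"
  shows "\<exists>j :: 'v \<Rightarrow> ('v \<Rightarrow>\<^sub>0 complex). cspace M j"
proof -
  interpret Module.module complex_field M by fact
  have in_field [simp]: "c \<in> carrier complex_field" for c by (simp add: complex_field_def)
  have distr: "(a + b) \<odot>\<^bsub>M\<^esub> v = a \<odot>\<^bsub>M\<^esub> v \<oplus>\<^bsub>M\<^esub> b \<odot>\<^bsub>M\<^esub> v" if "v \<in> carrier M" for a b v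
    using smult_l_distr[of a b v] that by (simp add: complex_field_def)
  have assoc: "(a * b) \<odot>\<^bsub>M\<^esub> v = a \<odot>\<^bsub>M\<^esub> (b \<odot>\<^bsub>M\<^esub> v)" if "v \<in> carrier M" for a b v
    using smult_assoc1[of a b v] that by (simp add: complex_field_def)
  have null: "0 \<odot>\<^bsub>M\<^esub> v = \<zero>\<^bsub>M\<^esub>" if "v \<in> carrier M" for v
    using smult_l_null[of v] that by (simp add: complex_field_def)
  define ev :: "('v \<Rightarrow>\<^sub>0 complex) \<Rightarrow> 'v" where
    "ev p = (\<Oplus>\<^bsub>M\<^esub>v\<in>keys p. lookup p v \<odot>\<^bsub>M\<^esub> v)" for p
  define X :: "('v \<Rightarrow>\<^sub>0 complex) set" where "X = {p. keys p \<subseteq> carrier M}"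
  have fin: "(\<lambda>v. g v \<odot>\<^bsub>M\<^esub> v) \<in> A \<rightarrow> carrier M" if "A \<subseteq> carrier M" for g A
    using that by (intro Pi_I smult_closed in_field) blast
  have ev_sup: "ev p = (\<Oplus>\<^bsub>M\<^esub>v\<in>A. lookup p v \<odot>\<^bsub>M\<^esub> v)"
    if "finite A" "keys p \<subseteq> A" "A \<subseteq> carrier M" for p A
    unfolding ev_def
  proof (rule add.finprod_mono_neutral_cong_left[OF that(1,2)])
    fix v assume "v \<in> A - keys p"
    then have "lookup p v = 0" "v \<in> carrier M" using that by (auto simp: in_keys_iff)
    then show "lookup p v \<odot>\<^bsub>M\<^esub> v = \<zero>\<^bsub>M\<^esub>" by (simp add: null)
  qed (use fin[OF that(3)] in auto)
  have ev_cl: "ev p \<in> carrier M" if "p \<in> X" for p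
    unfolding ev_def by (rule M.finsum_closed, rule fin) (use that in \<open>simp add: X_def\<close>)
  have ev_add: "ev (p + q) = ev p \<oplus>\<^bsub>M\<^esub> ev q" if "p \<in> X" "q \<in> X" for p q
  proof -
    let ?A = "keys p \<union> keys q"
    have A: "finite ?A" "?A \<subseteq> carrier M" using that by (auto simp: X_def)
    have "ev (p + q) = (\<Oplus>\<^bsub>M\<^esub>v\<in>?A. lookup (p + q) v \<odot>\<^bsub>M\<^esub> v)"
      by (rule ev_sup[OF A(1) Poly_Mapping.keys_add A(2)])
    also have "\<dots> = (\<Oplus>\<^bsub>M\<^esub>v\<in>?A. lookup p v \<odot>\<^bsub>M\<^esub> v \<oplus>\<^bsub>M\<^esub> lookup q v \<odot>\<^bsub>M\<^esub> v)"
      by (rule M.finsum_cong') (use A in \<open>auto simp: lookup_add distr\<close>)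
    also have "\<dots> = (\<Oplus>\<^bsub>M\<^esub>v\<in>?A. lookup p v \<odot>\<^bsub>M\<^esub> v) \<oplus>\<^bsub>M\<^esub> (\<Oplus>\<^bsub>M\<^esub>v\<in>?A. lookup q v \<odot>\<^bsub>M\<^esub> v)"
      by (rule M.finsum_addf[OF fin fin]) (use A in auto)
    also have "\<dots> = ev p \<oplus>\<^bsub>M\<^esub> ev q"
      using ev_sup[OF A(1) _ A(2), of p] ev_sup[OF A(1) _ A(2), of q] by simp
    finally show ?thesis .
  qed
  have ev_smult: "ev (cscale c p) = c \<odot>\<^bsub>M\<^esub> ev p" if "p \<in> X" for p c
  proof -
    have A: "keys p \<subseteq> carrier M" using that by (auto simp: X_def)
    have "ev (cscale c p) = (\<Oplus>\<^bsub>M\<^esub>v\<in>keys p. lookup (cscale c p) v \<odot>\<^bsub>M\<^esub> v)"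
      by (rule ev_sup[OF finite_keys keys_cscale A])
    also have "\<dots> = (\<Oplus>\<^bsub>M\<^esub>v\<in>keys p. c \<odot>\<^bsub>M\<^esub> (lookup p v \<odot>\<^bsub>M\<^esub> v))"
      by (rule M.finsum_cong') (use A in \<open>auto simp: assoc\<close>)
    also have "\<dots> = c \<odot>\<^bsub>M\<^esub> ev p"
      unfolding ev_def by (rule finsum_smult_ldistr[symmetric, OF finite_keys in_field fin[OF A]])
    finally show ?thesis .
  qed
  define K where "K = {p\<in>X. ev p = \<zero>\<^bsub>M\<^esub>}"
  have X: "cvs.subspace X"
    unfolding X_def by (rule subspace_keys)
  have K: "cvs.subspace K"
  proof (rule cvs.subspaceI)
    show "0 \<in> K" by (simp add: K_def X_def ev_def)
  qed (use cvs.subspace_add[OF X] cvs.subspace_scale[OF X] in \<open>simp_all add: K_def ev_add ev_smult\<close>)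
  obtain \<pi> :: "('v \<Rightarrow>\<^sub>0 complex) \<Rightarrow> ('v \<Rightarrow>\<^sub>0 complex)" where
    \<pi>: "Vector_Spaces.linear cscale cscale \<pi>" "\<And>p. \<pi> p = 0 \<longleftrightarrow> p \<in> K"
    using subspace_kernel_exists[OF K] by blast
  note lin = cvs_pair.linear_0[OF \<pi>(1)] cvs_pair.linear_add[OF \<pi>(1)] cvs_pair.linear_scale[OF \<pi>(1)]
      cvs_pair.linear_diff[OF \<pi>(1)]
  let ?s = "\<lambda>v. single v (1::complex)"
  have sX: "?s v \<in> X" if "v \<in> carrier M" for v using that by (simp add: X_def)
  have evs: "ev (?s v) = v" if "v \<in> carrier M" for v
    using that smult_one[of v] by (simp add: ev_def complex_field_def)
  have eq: "\<pi> p = \<pi> q \<longleftrightarrow> ev p = ev q" if "p \<in> X" "q \<in> X" for p q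
  proof -
    have d: "p - q \<in> X" using X that by (simp add: cvs.subspace_diff)
    have "\<pi> p = \<pi> q \<longleftrightarrow> ev (p - q) = \<zero>\<^bsub>M\<^esub>"
      using \<pi>(2)[of "p - q"] d by (simp add: lin K_def)
    also have "\<dots> \<longleftrightarrow> ev q \<oplus>\<^bsub>M\<^esub> ev (p - q) = ev q"
      using M.add.r_cancel_one[of "ev q" "ev (p - q)"] that d ev_cl M.add.l_cancel_one[of "ev q" "ev (p - q)"]
      by auto
    also have "\<dots> \<longleftrightarrow> ev p = ev q"
      using ev_add[OF that(2) d] by simp
    finally show ?thesis .
  qed
  have "cspace M (\<lambda>v. \<pi> (?s v))"
  proof
    fix x y c assume xy: "x \<in> carrier M" "y \<in> carrier M"
    then show "\<pi> (?s (x \<oplus>\<^bsub>M\<^esub> y)) = \<pi> (?s x) + \<pi> (?s y)"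
      using X by (simp add: lin[symmetric] eq sX cvs.subspace_add ev_add evs)
    show "\<pi> (?s (c \<odot>\<^bsub>M\<^esub> x)) = cscale c (\<pi> (?s x))"
      using cvs.subspace_scale[OF X sX[OF xy(1)], of c] xy ev_smult[OF sX[OF xy(1)], of c]
      unfolding lin(3)[symmetric] by (subst eq) (simp_all add: sX evs)
    assume "\<pi> (?s x) = \<pi> (?s y)"
    then show "x = y" using xy by (simp add: eq sX evs)
  next
    have "\<pi> (?s \<zero>\<^bsub>M\<^esub>) = \<pi> 0"
      using X by (subst eq) (auto simp: sX evs cvs.subspace_0 ev_def)
    then show "\<pi> (?s \<zero>\<^bsub>M\<^esub>) = 0" by (simp add: lin)
  qed auto
  then show ?thesis by blast
qed

context cspace
begin

lemma uminus_eq: "x \<in> carrier M \<Longrightarrow> \<ominus> x = (-1) \<odot>\<^bsub>M\<^esub> x"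
  by (rule j_inj) auto

lemma submodule_iff:
  "submodule H complex_field M \<longleftrightarrow> H \<subseteq> carrier M \<and> \<zero> \<in> H \<and>
    (\<forall>x\<in>H. \<forall>y\<in>H. x \<oplus> y \<in> H) \<and> (\<forall>c. \<forall>x\<in>H. c \<odot>\<^bsub>M\<^esub> x \<in> H)" (is "?l \<longleftrightarrow> ?r")
proof
  assume l: ?l
  then have "H \<subseteq> carrier M" "\<forall>x\<in>H. \<forall>y\<in>H. x \<oplus> y \<in> H" "\<forall>c. \<forall>x\<in>H. c \<odot>\<^bsub>M\<^esub> x \<in> H" "\<zero> \<in> H"
    using subgroup.one_closed[OF submodule.axioms(1)[OF l]] Module.module.submoduleE[OF module l]
    by (simp_all add: complex_field_def)
  then show ?r by blast
next
  assume r: ?r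
  show ?l
  proof (rule Module.module.submoduleI[OF module])
    fix a assume "a \<in> H"
    then show "\<ominus> a \<in> H" using r uminus_eq[of a] by (metis subsetD)
  qed (use r in auto)
qed

end

section \<open>Tensor products\<close>

lemma cspace_free_space: "cspace (free_space X) (\<lambda>p. p)"
proof
  fix p q :: "'a \<Rightarrow>\<^sub>0 complex" and c
  show "p \<in> carrier (free_space X) \<Longrightarrow> q \<in> carrier (free_space X) \<Longrightarrow>
      p \<oplus>\<^bsub>free_space X\<^esub> q \<in> carrier (free_space X)"
    using cvs.subspace_add[OF subspace_keys] by (simp add: free_space_def)
  show "p \<in> carrier (free_space X) \<Longrightarrow> c \<odot>\<^bsub>free_space X\<^esub> p \<in> carrier (free_space X)"
    using cvs.subspace_scale[OF subspace_keys] by (simp add: free_space_def)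
qed (auto simp: free_space_def)

lemma submodule_free_space:
  "submodule H complex_field (free_space X) \<longleftrightarrow> H \<subseteq> {p. keys p \<subseteq> X} \<and> cvs.subspace H"
  unfolding cspace.submodule_iff[OF cspace_free_space] by (auto simp: cvs.subspace_def free_space_def)

lemma lin_span_free_space:
  assumes "S \<subseteq> {p. keys p \<subseteq> X}"
  shows "lin_span (free_space X) S = cvs.span S"
proof -
  have "cvs.span S \<subseteq> {p. keys p \<subseteq> X}"
    by (rule cvs.span_minimal[OF assms subspace_keys])
  then have "submodule (cvs.span S) complex_field (free_space X)"
    by (simp add: submodule_free_space)
  then have "lin_span (free_space X) S \<subseteq> cvs.span S"
    unfolding lin_span_def by (intro hull_minimal cvs.span_superset)
  moreover have "cvs.span S \<subseteq> lin_span (free_space X) S"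
    unfolding lin_span_def hull_def by (auto simp: submodule_free_space intro: cvs.span_minimal[THEN subsetD])
  ultimately show ?thesis by blast
qed

section \<open>Quotients of spaces of finitely supported functions\<close>

definition coset :: "('k \<Rightarrow>\<^sub>0 complex) set \<Rightarrow> ('k \<Rightarrow>\<^sub>0 complex) \<Rightarrow> ('k \<Rightarrow>\<^sub>0 complex) set" where
  "coset K p = {h + p | h. h \<in> K}"

lemma coset_self: "cvs.subspace K \<Longrightarrow> p \<in> coset K p"
  using cvs.subspace_0[of K] by (force simp: coset_def)

lemma coset_iff: "q \<in> coset K p \<longleftrightarrow> q - p \<in> K"
  unfolding coset_def by (auto intro: exI[of _ "q - p"])

lemma coset_eq_iff:
  assumes "cvs.subspace K" shows "coset K p = coset K q \<longleftrightarrow> p - q \<in> K"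
proof
  assume "coset K p = coset K q" then show "p - q \<in> K"
    using coset_self[OF assms, of p] by (simp add: coset_iff)
next
  assume pq: "p - q \<in> K"
  have "x - p \<in> K \<longleftrightarrow> x - q \<in> K" for x
  proof
    assume "x - p \<in> K" from cvs.subspace_add[OF assms this pq] show "x - q \<in> K" by simp
  next
    assume "x - q \<in> K" from cvs.subspace_diff[OF assms this pq] show "x - p \<in> K" by simp
  qed
  then show "coset K p = coset K q" by (auto simp: coset_iff)
qed

lemma a_r_coset_free_space: "K +>\<^bsub>free_space X\<^esub> p = coset K p"
  by (auto simp: a_r_coset_def' coset_def free_space_def)

lemma set_add_coset:
  assumes "cvs.subspace K"
  shows "{a + b | a b. a \<in> coset K p \<and> b \<in> coset K q} = coset K (p + q)"
proof (rule subset_antisym; rule subsetI)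
  fix x assume "x \<in> {a + b | a b. a \<in> coset K p \<and> b \<in> coset K q}"
  then obtain a b where "x = a + b" "a - p \<in> K" "b - q \<in> K" by (auto simp: coset_iff)
  then show "x \<in> coset K (p + q)"
    using cvs.subspace_add[OF assms, of "a - p" "b - q"] by (simp add: coset_iff add_diff_add)
next
  fix x assume x: "x \<in> coset K (p + q)"
  then have "x = (x - q) + q" "x - q \<in> coset K p" "q \<in> coset K q"
    using coset_self[OF assms] by (simp_all add: coset_iff algebra_simps)
  then show "x \<in> {a + b | a b. a \<in> coset K p \<and> b \<in> coset K q}" by blast
qed

text \<open>A linear map that vanishes on \<open>K\<close> is constant on each coset, so any
  representative computes the induced map.\<close>

definition coset_lift :: "(('k \<Rightarrow>\<^sub>0 complex) \<Rightarrow> 'z) \<Rightarrow> ('k \<Rightarrow>\<^sub>0 complex) set \<Rightarrow> 'z" where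
  "coset_lift f X = f (SOME p. p \<in> X)"

lemma coset_lift:
  assumes "cvs.subspace K" "Vector_Spaces.linear cscale cscale f" "\<And>p. p \<in> K \<Longrightarrow> f p = 0"
  shows "coset_lift f (coset K p) = f p"
proof -
  have "(SOME q. q \<in> coset K p) \<in> coset K p" by (rule someI[of _ p]) (rule coset_self[OF assms(1)])
  then have "f ((SOME q. q \<in> coset K p) - p) = 0" by (simp add: coset_iff assms(3))
  then show ?thesis by (simp add: coset_lift_def cvs_pair.linear_diff[OF assms(2)])
qed

text \<open>Operations on quotients are defined as unions over representatives; such a union
  collapses to one term when that term does not depend on the representative.\<close>

lemma UN_coset_const:
  assumes "cvs.subspace K" "\<And>h. h \<in> K \<Longrightarrow> f (h + p) = f p"
  shows "(\<Union>x\<in>coset K p. f x) = f p"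
  using assms(2) coset_self[OF assms(1)] by (fastforce simp: coset_def)

text \<open>The operations enter as hypotheses because two different records have this shape: the
  quotients behind tensor products and the enveloping algebra.\<close>

lemma cspace_quotient:
  fixes Q :: "(complex, ('k \<Rightarrow>\<^sub>0 complex) set, 'x) module_scheme"
  assumes K: "cvs.subspace K" and X: "cvs.subspace X"
    and carrier: "carrier Q = coset K ` X" and zero: "\<zero>\<^bsub>Q\<^esub> = K"
    and add: "\<And>p q. p \<in> X \<Longrightarrow> q \<in> X \<Longrightarrow> coset K p \<oplus>\<^bsub>Q\<^esub> coset K q = coset K (p + q)"
    and smult: "\<And>c p. p \<in> X \<Longrightarrow> c \<odot>\<^bsub>Q\<^esub> coset K p = coset K (cscale c p)"
    and \<pi>: "Vector_Spaces.linear cscale cscale \<pi>" "\<And>p. \<pi> p = 0 \<longleftrightarrow> p \<in> K"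
  shows "cspace Q (coset_lift \<pi>)"
proof -
  note lin = cvs_pair.linear_0[OF \<pi>(1)] cvs_pair.linear_add[OF \<pi>(1)] cvs_pair.linear_scale[OF \<pi>(1)]
      cvs_pair.linear_diff[OF \<pi>(1)]
  have [simp]: "coset_lift \<pi> (coset K p) = \<pi> p" for p
    by (rule coset_lift[OF K]) (simp_all add: \<pi>)
  have K0: "K = coset K 0" by (auto simp: coset_def)
  show ?thesis
  proof
    show "\<zero>\<^bsub>Q\<^esub> \<in> carrier Q"
      unfolding zero carrier using K0 cvs.subspace_0[OF X] by (metis imageI)
    show "coset_lift \<pi> \<zero>\<^bsub>Q\<^esub> = 0" unfolding zero by (subst K0) (simp add: lin)
  next
    fix x y c assume "x \<in> carrier Q" "y \<in> carrier Q"
    then obtain p q where p: "p \<in> X" "q \<in> X" "x = coset K p" "y = coset K q" by (auto simp: carrier)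
    then show "x \<oplus>\<^bsub>Q\<^esub> y \<in> carrier Q" "c \<odot>\<^bsub>Q\<^esub> x \<in> carrier Q"
      "coset_lift \<pi> (x \<oplus>\<^bsub>Q\<^esub> y) = coset_lift \<pi> x + coset_lift \<pi> y"
      "coset_lift \<pi> (c \<odot>\<^bsub>Q\<^esub> x) = cscale c (coset_lift \<pi> x)"
      using cvs.subspace_add[OF X p(1,2)] cvs.subspace_scale[OF X p(1)]
      by (simp_all add: carrier add smult lin)
    assume "coset_lift \<pi> x = coset_lift \<pi> y"
    then have "\<pi> (p - q) = 0" using p by (simp add: lin)
    then show "x = y" using p coset_eq_iff[OF K] \<pi>(2) by simp
  qed
qed

definition proj_along :: "('k \<Rightarrow>\<^sub>0 complex) set \<Rightarrow> ('k \<Rightarrow>\<^sub>0 complex) \<Rightarrow> ('k \<Rightarrow>\<^sub>0 complex)" where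
  "proj_along K = (SOME \<pi>. Vector_Spaces.linear cscale cscale \<pi> \<and> (\<forall>p. \<pi> p = 0 \<longleftrightarrow> p \<in> K))"

lemma
  assumes "cvs.subspace K"
  shows linear_proj_along: "Vector_Spaces.linear cscale cscale (proj_along K)"
    and proj_along_eq_0: "proj_along K p = 0 \<longleftrightarrow> p \<in> K"
  using someI_ex[OF subspace_kernel_exists[OF assms]] unfolding proj_along_def by auto

abbreviation coset_emb :: "('k \<Rightarrow>\<^sub>0 complex) set \<Rightarrow> ('k \<Rightarrow>\<^sub>0 complex) set \<Rightarrow> ('k \<Rightarrow>\<^sub>0 complex)" where
  "coset_emb K \<equiv> coset_lift (proj_along K)"

lemma coset_emb_coset: "cvs.subspace K \<Longrightarrow> coset_emb K (coset K p) = proj_along K p"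
  by (rule coset_lift) (simp_all add: linear_proj_along proj_along_eq_0)

lemma quot_space_free_space:
  assumes K: "cvs.subspace K" and KX: "K \<subseteq> {p. keys p \<subseteq> X}"
  defines "Q \<equiv> quot_space (free_space X) K"
  shows quot_carrier: "carrier Q = coset K ` {p. keys p \<subseteq> X}"
    and quot_add: "coset K p \<oplus>\<^bsub>Q\<^esub> coset K q = coset K (p + q)"
    and quot_smult: "c \<odot>\<^bsub>Q\<^esub> coset K p = coset K (cscale c p)"
    and quot_zero: "\<zero>\<^bsub>Q\<^esub> = K"
    and cspace_quot: "cspace Q (coset_emb K)"
proof -
  show 1: "carrier Q = coset K ` {p. keys p \<subseteq> X}"
    by (auto simp: Q_def quot_space_def A_RCOSETS_def' a_r_coset_free_space free_space_def[of X])
      (auto simp: a_r_coset_def' coset_def free_space_def)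
  have "coset K p \<oplus>\<^bsub>Q\<^esub> coset K q = {a + b | a b. a \<in> coset K p \<and> b \<in> coset K q}" for p q
    by (auto simp: Q_def quot_space_def set_add_def' free_space_def)
  then show 2: "coset K p \<oplus>\<^bsub>Q\<^esub> coset K q = coset K (p + q)" for p q
    by (simp add: set_add_coset[OF K])
  show 3: "c \<odot>\<^bsub>Q\<^esub> coset K p = coset K (cscale c p)" for c p
  proof -
    have "(\<Union>x\<in>coset K p. coset K (cscale c x)) = coset K (cscale c p)"
      by (rule UN_coset_const[OF K])
        (simp add: coset_eq_iff[OF K] cvs.scale_right_distrib cvs.subspace_scale[OF K])
    then show ?thesis
      by (simp add: Q_def quot_space_def a_r_coset_free_space) (simp add: free_space_def)
  qed
  show 4: "\<zero>\<^bsub>Q\<^esub> = K" by (simp add: Q_def quot_space_def)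
  show "cspace Q (coset_emb K)"
    by (rule cspace_quotient[OF K subspace_keys 1 4 2 3 linear_proj_along[OF K] proj_along_eq_0[OF K]])
qed

lemma free_map_eq_lext: "free_map h = lext (\<lambda>k. single (h k) 1)"
  by (simp add: free_map_def lext_def fun_eq_iff)

section \<open>Balanced tensor products and their universal property\<close>

locale tensor_product = M: cspace M jM + N: cspace N jN
  for R :: "'r set" and ra :: "'a \<Rightarrow> 'r \<Rightarrow> 'a" and la :: "'r \<Rightarrow> 'b \<Rightarrow> 'b"
    and M :: "(complex, 'a, 'x) module_scheme" and N :: "(complex, 'b, 'y) module_scheme"
    and jM :: "'a \<Rightarrow> ('c \<Rightarrow>\<^sub>0 complex)" and jN :: "'b \<Rightarrow> ('d \<Rightarrow>\<^sub>0 complex)" +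
  assumes ra_closed: "\<lbrakk>r \<in> R; m \<in> carrier M\<rbrakk> \<Longrightarrow> ra m r \<in> carrier M"
    and la_closed: "\<lbrakk>r \<in> R; n \<in> carrier N\<rbrakk> \<Longrightarrow> la r n \<in> carrier N"
begin

abbreviation T where "T \<equiv> tensor R ra la M N"
abbreviation X where "X \<equiv> {p :: 'a \<times> 'b \<Rightarrow>\<^sub>0 complex. keys p \<subseteq> carrier M \<times> carrier N}"
abbreviation K where "K \<equiv> tensor_kernel R ra la M N"

definition pt :: "'a \<Rightarrow> 'b \<Rightarrow> ('a \<times> 'b \<Rightarrow>\<^sub>0 complex) set" where
  "pt m n = coset K (pure m n)"

lemma single_mem: "\<lbrakk>m \<in> carrier M; n \<in> carrier N\<rbrakk> \<Longrightarrow> single (m, n) c \<in> X"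
  by auto

lemma rels_subset: "tensor_rels R ra la M N \<subseteq> X"
proof -
  note d = cvs.subspace_diff[OF subspace_keys[of "carrier M \<times> carrier N"]]
  show ?thesis unfolding tensor_rels_def Un_subset_iff
    by (intro conjI subsetI; elim CollectE exE conjE; hypsubst; intro d single_mem)
      (auto simp: ra_closed la_closed)
qed

lemma K_eq: "K = cvs.span (tensor_rels R ra la M N)"
  unfolding tensor_kernel_def tensor_free_def by (rule lin_span_free_space[OF rels_subset])

lemma K_subspace: "cvs.subspace K" and K_subset: "K \<subseteq> X"
  unfolding K_eq using cvs.span_minimal[OF rels_subset subspace_keys] by auto

lemmas quot = quot_space_free_space[OF K_subspace K_subset, folded tensor_free_def, folded tensor_def]
lemmas T_carrier = quot(1) and T_add = quot(2) and T_smult = quot(3) and T_zero = quot(4)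

sublocale T: cspace T "coset_emb K" by (rule quot(5))

lemma pt_closed [simp, intro]: "\<lbrakk>m \<in> carrier M; n \<in> carrier N\<rbrakk> \<Longrightarrow> pt m n \<in> carrier T"
  unfolding T_carrier pt_def by (intro imageI single_mem)

lemma coset_single: "coset K (single (m, n) c) = c \<odot>\<^bsub>T\<^esub> pt m n"
  by (simp add: pt_def T_smult)

lemma pt_induct [consumes 1, case_names zero pt add smult]:
  assumes "z \<in> carrier T" "P \<zero>\<^bsub>T\<^esub>" "\<And>m n. \<lbrakk>m \<in> carrier M; n \<in> carrier N\<rbrakk> \<Longrightarrow> P (pt m n)"
    and "\<And>x y. \<lbrakk>x \<in> carrier T; y \<in> carrier T; P x; P y\<rbrakk> \<Longrightarrow> P (x \<oplus>\<^bsub>T\<^esub> y)"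
    and "\<And>c x. \<lbrakk>x \<in> carrier T; P x\<rbrakk> \<Longrightarrow> P (c \<odot>\<^bsub>T\<^esub> x)"
  shows "P z"
proof -
  have "P (coset K p)" if "keys p \<subseteq> carrier M \<times> carrier N" for p
    using that
  proof (induction rule: poly_mapping_keys_induct)
    case zero
    have "coset K 0 = K" by (auto simp: coset_def)
    then show ?case using assms(2) by (simp add: T_zero)
  next
    case (single k c)
    then show ?case by (cases k) (auto simp: coset_single intro!: assms(3,5))
  next
    case (add p q)
    then show ?case using assms(4)[of "coset K p" "coset K q"] by (simp add: T_add T_carrier)
  qed
  then show ?thesis using assms(1) by (auto simp: T_carrier)
qed

lemma rel_in_K: "p \<in> tensor_rels R ra la M N \<Longrightarrow> p \<in> K"
  unfolding K_eq by (rule cvs.span_base)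

lemma pt_add_left:
  assumes "m \<in> carrier M" "m' \<in> carrier M" "n \<in> carrier N"
  shows "pt (m \<oplus>\<^bsub>M\<^esub> m') n = pt m n \<oplus>\<^bsub>T\<^esub> pt m' n"
proof -
  have "pure (m \<oplus>\<^bsub>M\<^esub> m') n - pure m n - pure m' n \<in> K"
    by (rule rel_in_K) (unfold tensor_rels_def, use assms in blast)
  then show ?thesis by (simp add: pt_def T_add coset_eq_iff[OF K_subspace] diff_diff_add)
qed

lemma pt_add_right:
  assumes "m \<in> carrier M" "n \<in> carrier N" "n' \<in> carrier N"
  shows "pt m (n \<oplus>\<^bsub>N\<^esub> n') = pt m n \<oplus>\<^bsub>T\<^esub> pt m n'"
proof -
  have "pure m (n \<oplus>\<^bsub>N\<^esub> n') - pure m n - pure m n' \<in> K"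
    by (rule rel_in_K) (unfold tensor_rels_def, use assms in blast)
  then show ?thesis by (simp add: pt_def T_add coset_eq_iff[OF K_subspace] diff_diff_add)
qed

lemma pt_smult_left:
  assumes "m \<in> carrier M" "n \<in> carrier N"
  shows "pt (c \<odot>\<^bsub>M\<^esub> m) n = c \<odot>\<^bsub>T\<^esub> pt m n"
proof -
  have "pure (c \<odot>\<^bsub>M\<^esub> m) n - single (m, n) c \<in> K"
    by (rule rel_in_K) (unfold tensor_rels_def, use assms in blast)
  then show ?thesis by (simp add: coset_single[symmetric]) (simp add: pt_def coset_eq_iff[OF K_subspace])
qed

lemma pt_smult_right:
  assumes "m \<in> carrier M" "n \<in> carrier N"
  shows "pt m (c \<odot>\<^bsub>N\<^esub> n) = c \<odot>\<^bsub>T\<^esub> pt m n"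
proof -
  have "pure m (c \<odot>\<^bsub>N\<^esub> n) - single (m, n) c \<in> K"
    by (rule rel_in_K) (unfold tensor_rels_def, use assms in blast)
  then show ?thesis by (simp add: coset_single[symmetric]) (simp add: pt_def coset_eq_iff[OF K_subspace])
qed

lemma pt_balanced:
  assumes "r \<in> R" "m \<in> carrier M" "n \<in> carrier N"
  shows "pt (ra m r) n = pt m (la r n)"
proof -
  have "pure (ra m r) n - pure m (la r n) \<in> K"
    by (rule rel_in_K) (unfold tensor_rels_def, use assms in blast)
  then show ?thesis by (simp add: pt_def coset_eq_iff[OF K_subspace])
qed

definition balanced_bilinear :: "('a \<Rightarrow> 'b \<Rightarrow> ('z \<Rightarrow>\<^sub>0 complex)) \<Rightarrow> bool" where
  "balanced_bilinear B \<longleftrightarrow>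
    (\<forall>m\<in>carrier M. \<forall>m'\<in>carrier M. \<forall>n\<in>carrier N. B (m \<oplus>\<^bsub>M\<^esub> m') n = B m n + B m' n) \<and>
    (\<forall>m\<in>carrier M. \<forall>n\<in>carrier N. \<forall>n'\<in>carrier N. B m (n \<oplus>\<^bsub>N\<^esub> n') = B m n + B m n') \<and>
    (\<forall>c. \<forall>m\<in>carrier M. \<forall>n\<in>carrier N. B (c \<odot>\<^bsub>M\<^esub> m) n = cscale c (B m n)) \<and>
    (\<forall>c. \<forall>m\<in>carrier M. \<forall>n\<in>carrier N. B m (c \<odot>\<^bsub>N\<^esub> n) = cscale c (B m n)) \<and>
    (\<forall>r\<in>R. \<forall>m\<in>carrier M. \<forall>n\<in>carrier N. B (ra m r) n = B m (la r n))"

text \<open>The zero set of a linear extension is a subspace, so it suffices that balanced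
  bilinearity kills the five families of generating relations.\<close>

lemma lext_kernel:
  assumes "balanced_bilinear B" "p \<in> K"
  shows "lext (case_prod B) p = 0"
proof -
  have "K \<subseteq> {p. lext (case_prod B) p = 0}"
    unfolding K_eq
  proof (rule cvs.span_minimal)
    show "cvs.subspace {p. lext (case_prod B) p = 0}"
      by (auto intro!: cvs.subspaceI simp: lext_add lext_cscale)
    show "tensor_rels R ra la M N \<subseteq> {p. lext (case_prod B) p = 0}"
      using assms(1) unfolding tensor_rels_def Un_subset_iff balanced_bilinear_def
      by (intro conjI subsetI; elim CollectE exE conjE; hypsubst) (simp_all add: lext_diff)
  qed
  then show ?thesis using assms(2) by blast
qed

definition tlift :: "('a \<Rightarrow> 'b \<Rightarrow> ('z \<Rightarrow>\<^sub>0 complex)) \<Rightarrow> ('a \<times> 'b \<Rightarrow>\<^sub>0 complex) set \<Rightarrow> ('z \<Rightarrow>\<^sub>0 complex)" where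
  "tlift B = coset_lift (lext (case_prod B))"

lemma tlift_coset: "balanced_bilinear B \<Longrightarrow> tlift B (coset K p) = lext (case_prod B) p"
  unfolding tlift_def by (rule coset_lift[OF K_subspace linear_lext lext_kernel])

lemma
  assumes "balanced_bilinear B"
  shows tlift_pt [simp]: "tlift B (pt m n) = B m n"
    and tlift_add [simp]: "\<lbrakk>x \<in> carrier T; y \<in> carrier T\<rbrakk> \<Longrightarrow> tlift B (x \<oplus>\<^bsub>T\<^esub> y) = tlift B x + tlift B y"
    and tlift_smult [simp]: "x \<in> carrier T \<Longrightarrow> tlift B (c \<odot>\<^bsub>T\<^esub> x) = cscale c (tlift B x)"
    and tlift_zero [simp]: "tlift B \<zero>\<^bsub>T\<^esub> = 0"
proof -
  show "tlift B (pt m n) = B m n" by (simp add: pt_def tlift_coset[OF assms])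
  show "tlift B (x \<oplus>\<^bsub>T\<^esub> y) = tlift B x + tlift B y" if "x \<in> carrier T" "y \<in> carrier T"
    using that by (auto simp: T_carrier T_add tlift_coset[OF assms] lext_add)
  show "tlift B (c \<odot>\<^bsub>T\<^esub> x) = cscale c (tlift B x)" if "x \<in> carrier T"
    using that by (auto simp: T_carrier T_smult tlift_coset[OF assms] lext_cscale)
  have "\<zero>\<^bsub>T\<^esub> = coset K 0" by (auto simp: coset_def T_zero)
  then show "tlift B \<zero>\<^bsub>T\<^esub> = 0" by (simp only: tlift_coset[OF assms] lext_0)
qed

definition balanced_pair :: "('a \<Rightarrow> 'a) \<Rightarrow> ('b \<Rightarrow> 'b) \<Rightarrow> bool" where
  "balanced_pair f g \<longleftrightarrow> linear_op M f \<and> linear_op N g \<and>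
     (\<forall>r\<in>R. \<forall>m\<in>carrier M. f (ra m r) = ra (f m) r) \<and> (\<forall>r\<in>R. \<forall>n\<in>carrier N. g (la r n) = la r (g n))"

abbreviation top where "top \<equiv> tensor_op R ra la M N"

text \<open>Independence of the representative: sending (m, n) to the class of f m \<otimes> g n is
  balanced bilinear, so its extension vanishes on \<open>K\<close>, which means that the free map of
  \<open>f\<close> and \<open>g\<close> sends \<open>K\<close> into itself.\<close>

lemma top_coset:
  assumes fg: "balanced_pair f g"
  shows "top f g (coset K p) = coset K (free_map (map_prod f g) p)"
proof -
  have cl: "m \<in> carrier M \<Longrightarrow> f m \<in> carrier M" "n \<in> carrier N \<Longrightarrow> g n \<in> carrier N" for m n
    using fg by (auto simp: balanced_pair_def linear_op_def)
  let ?\<pi> = "proj_along K" and ?fg = "free_map (map_prod f g)"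
  define B where "B m n = coset_emb K (pt (f m) (g n))" for m n
  have B: "balanced_bilinear B"
    unfolding balanced_bilinear_def B_def
    using fg by (auto simp: balanced_pair_def linear_op_def pt_add_left pt_add_right pt_smult_left
        pt_smult_right pt_balanced cl)
  have "?\<pi> (?fg q) = lext (\<lambda>k. ?\<pi> (?fg (single k 1))) q" for q
    using linear_eq_lext[OF Vector_Spaces.linear_compose[OF linear_lext linear_proj_along[OF K_subspace]]]
    by (simp add: free_map_eq_lext o_def)
  moreover have "?\<pi> (?fg (single k 1)) = case_prod B k" for k
    by (cases k) (simp add: B_def pt_def coset_emb_coset[OF K_subspace] free_map_eq_lext)
  ultimately have "?\<pi> (?fg q) = lext (case_prod B) q" for q :: "'a \<times> 'b \<Rightarrow>\<^sub>0 complex" by simp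
  then have "?fg q \<in> K" if "q \<in> K" for q
    using lext_kernel[OF B that] proj_along_eq_0[OF K_subspace, of "?fg q"] by simp
  then have "(\<Union>z\<in>coset K p. coset K (?fg z)) = coset K (?fg p)"
    by (intro UN_coset_const[OF K_subspace])
      (simp add: coset_eq_iff[OF K_subspace] free_map_eq_lext lext_add)
  then show ?thesis
    by (simp add: tensor_op_def tensor_free_def a_r_coset_free_space)
qed

lemma top_pt: "balanced_pair f g \<Longrightarrow> top f g (pt m n) = pt (f m) (g n)"
  by (simp add: pt_def top_coset free_map_eq_lext)

lemma linear_top:
  assumes fg: "balanced_pair f g"
  shows "linear_op T (top f g)"
proof -
  have cl: "m \<in> carrier M \<Longrightarrow> f m \<in> carrier M" "n \<in> carrier N \<Longrightarrow> g n \<in> carrier N" for m n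
    using fg by (auto simp: balanced_pair_def linear_op_def)
  have X: "free_map (map_prod f g) p \<in> X" if "p \<in> X" for p
    unfolding free_map_eq_lext by (rule lext_closed[OF _ _ subspace_keys]) (use that cl in auto)
  show ?thesis unfolding linear_op_def
  proof (intro conjI ballI allI Pi_I)
    fix x y c assume "x \<in> carrier T" "y \<in> carrier T"
    then obtain p q where pq: "x = coset K p" "y = coset K q" by (auto simp: T_carrier)
    then show "top f g (x \<oplus>\<^bsub>T\<^esub> y) = top f g x \<oplus>\<^bsub>T\<^esub> top f g y"
      by (simp add: T_add top_coset[OF fg] free_map_eq_lext lext_add)
  next
    fix x c assume "x \<in> carrier T"
    then obtain p where p: "x = coset K p" "p \<in> X" by (auto simp: T_carrier)
    then show "top f g (c \<odot>\<^bsub>T\<^esub> x) = c \<odot>\<^bsub>T\<^esub> top f g x"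
      by (simp add: T_smult top_coset[OF fg] free_map_eq_lext lext_cscale)
    show "top f g x \<in> carrier T" using X[OF p(2)] p(1) by (auto simp: top_coset[OF fg] T_carrier)
  qed
qed

lemma linear_eq_on_pt:
  assumes z: "z \<in> carrier T"
    and f0: "f \<zero>\<^bsub>T\<^esub> = 0" and g0: "g \<zero>\<^bsub>T\<^esub> = (0 :: 'z::ab_group_add)"
    and "\<And>x y. \<lbrakk>x \<in> carrier T; y \<in> carrier T\<rbrakk> \<Longrightarrow> f (x \<oplus>\<^bsub>T\<^esub> y) = f x + f y"
    and "\<And>x y. \<lbrakk>x \<in> carrier T; y \<in> carrier T\<rbrakk> \<Longrightarrow> g (x \<oplus>\<^bsub>T\<^esub> y) = g x + g y"
    and "\<And>c x. x \<in> carrier T \<Longrightarrow> f (c \<odot>\<^bsub>T\<^esub> x) = s c (f x)"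
    and "\<And>c x. x \<in> carrier T \<Longrightarrow> g (c \<odot>\<^bsub>T\<^esub> x) = s c (g x)"
    and "\<And>m n. \<lbrakk>m \<in> carrier M; n \<in> carrier N\<rbrakk> \<Longrightarrow> f (pt m n) = g (pt m n)"
  shows "f z = g z"
  using z by (induction rule: pt_induct) (simp_all add: assms)

end

context cspace
begin

lemma zero_smult [simp]: "x \<in> carrier M \<Longrightarrow> 0 \<odot>\<^bsub>M\<^esub> x = \<zero>"
  by (rule j_inj) auto

lemma linear_op_zero:
  assumes "linear_op M f" shows "f \<zero> = \<zero>"
proof -
  have "f (0 \<odot>\<^bsub>M\<^esub> \<zero>) = 0 \<odot>\<^bsub>M\<^esub> f \<zero>" "f \<zero> \<in> carrier M"
    using assms zero_closed unfolding linear_op_def by blast+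
  then show ?thesis by simp
qed

lemma add_minus_cancel: "\<lbrakk>x \<in> carrier M; y \<in> carrier M\<rbrakk> \<Longrightarrow> (x \<oplus> y) \<ominus> x = y"
  by (rule j_inj) auto

end

lemma (in cspace) make_rep: "cspace (make_rep M f) j"
  by unfold_locales (auto simp: make_rep_def intro: j_inj)

lemma make_rep_simps [simp]:
  "carrier (make_rep M f) = carrier M" "zero (make_rep M f) = zero M" "add (make_rep M f) = add M"
  "smult (make_rep M f) = smult M" "act (make_rep M f) = f"
  by (simp_all add: make_rep_def)

lemma a_minus_make_rep:
  assumes "cspace M j" "x \<in> carrier M" "y \<in> carrier M"
  shows "x \<ominus>\<^bsub>make_rep M f\<^esub> y = x \<ominus>\<^bsub>M\<^esub> y"
proof -
  interpret M: cspace M j by fact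
  interpret M': cspace "make_rep M f" j by (rule M.make_rep)
  show ?thesis
    by (rule M.j_inj) (use assms M'.minus_closed[of x y] M'.j_minus[of x y] in simp_all)
qed

lemma linear_op_make_rep [simp]: "linear_op (make_rep M f) g = linear_op M g"
  by (simp add: linear_op_def)

text \<open>The operators are linear and pure tensors span, so the identities need a check on pure
  tensors only. Both the induced module and the tensor module obtain their structure this
  way.\<close>

lemma (in tensor_product) lie_moduleI:
  assumes lin: "\<And>x. x \<in> carrier L \<Longrightarrow> linear_op T (f x)"
    and closed: "\<And>x y. \<lbrakk>x \<in> carrier L; y \<in> carrier L\<rbrakk> \<Longrightarrow> x \<oplus>\<^bsub>L\<^esub> y \<in> carrier L"
      "\<And>c x. x \<in> carrier L \<Longrightarrow> c \<odot>\<^bsub>L\<^esub> x \<in> carrier L"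
      "\<And>x y. \<lbrakk>x \<in> carrier L; y \<in> carrier L\<rbrakk> \<Longrightarrow> bracket L x y \<in> carrier L"
    and add: "\<And>x y m n. \<lbrakk>x \<in> carrier L; y \<in> carrier L; m \<in> carrier M; n \<in> carrier N\<rbrakk> \<Longrightarrow>
      f (x \<oplus>\<^bsub>L\<^esub> y) (pt m n) = f x (pt m n) \<oplus>\<^bsub>T\<^esub> f y (pt m n)"
    and smult: "\<And>c x m n. \<lbrakk>x \<in> carrier L; m \<in> carrier M; n \<in> carrier N\<rbrakk> \<Longrightarrow>
      f (c \<odot>\<^bsub>L\<^esub> x) (pt m n) = c \<odot>\<^bsub>T\<^esub> f x (pt m n)"
    and bracket: "\<And>x y m n. \<lbrakk>x \<in> carrier L; y \<in> carrier L; m \<in> carrier M; n \<in> carrier N\<rbrakk> \<Longrightarrow>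
      f (bracket L x y) (pt m n) = f x (f y (pt m n)) \<ominus>\<^bsub>T\<^esub> f y (f x (pt m n))"
  shows "lie_module L (make_rep T f)"
proof -
  have cl [simp, intro]: "f x z \<in> carrier T" if "x \<in> carrier L" "z \<in> carrier T" for x z
    using lin[OF that(1)] that(2) by (auto simp: linear_op_def)
  have fadd [simp]: "f x (z \<oplus>\<^bsub>T\<^esub> z') = f x z \<oplus>\<^bsub>T\<^esub> f x z'"
    if "x \<in> carrier L" "z \<in> carrier T" "z' \<in> carrier T" for x z z'
    using lin[OF that(1)] that(2,3) by (auto simp: linear_op_def)
  have fsmult [simp]: "f x (c \<odot>\<^bsub>T\<^esub> z) = c \<odot>\<^bsub>T\<^esub> f x z" if "x \<in> carrier L" "z \<in> carrier T" for x z c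
    using lin[OF that(1)] that(2) by (auto simp: linear_op_def)
  have fzero [simp]: "f x \<zero>\<^bsub>T\<^esub> = \<zero>\<^bsub>T\<^esub>" if "x \<in> carrier L" for x
    by (rule T.linear_op_zero[OF lin[OF that]])
  show ?thesis
    unfolding lie_module_def make_rep_simps linear_op_make_rep
  proof (intro conjI ballI allI)
    show "Module.module complex_field (make_rep T f)"
      by (rule cspace.module[OF T.make_rep])
  next
    fix x y z assume x: "x \<in> carrier L" and y: "y \<in> carrier L" and z: "z \<in> carrier T"
    have "coset_emb K (f (x \<oplus>\<^bsub>L\<^esub> y) z) = coset_emb K (f x z \<oplus>\<^bsub>T\<^esub> f y z)"
      using z by (rule linear_eq_on_pt[where s=cscale])
        (simp_all add: x y closed add cvs.scale_right_distrib)
    then show "f (x \<oplus>\<^bsub>L\<^esub> y) z = f x z \<oplus>\<^bsub>T\<^esub> f y z"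
      by (rule T.j_inj[rotated 2]) (simp_all add: x y z closed)
    have "coset_emb K (f (bracket L x y) z) = coset_emb K (f x (f y z) \<ominus>\<^bsub>T\<^esub> f y (f x z))"
      using z by (rule linear_eq_on_pt[where s=cscale])
        (simp_all add: x y closed bracket cvs.scale_right_diff_distrib)
    then have "f (bracket L x y) z = f x (f y z) \<ominus>\<^bsub>T\<^esub> f y (f x z)"
      by (rule T.j_inj[rotated 2]) (simp_all add: x y z closed)
    then show "f (bracket L x y) z = f x (f y z) \<ominus>\<^bsub>make_rep T f\<^esub> f y (f x z)"
      by (simp add: a_minus_make_rep[OF T.cspace_axioms] x y z)
  next
    fix x z c assume x: "x \<in> carrier L" and z: "z \<in> carrier T"
    have "coset_emb K (f (c \<odot>\<^bsub>L\<^esub> x) z) = coset_emb K (c \<odot>\<^bsub>T\<^esub> f x z)"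
      using z by (rule linear_eq_on_pt[where s=cscale])
        (simp_all add: x closed smult cvs.scale_right_distrib mult.commute)
    then show "f (c \<odot>\<^bsub>L\<^esub> x) z = c \<odot>\<^bsub>T\<^esub> f x z"
      by (rule T.j_inj[rotated 2]) (simp_all add: x z closed)
  qed (rule lin)
qed

section \<open>Enveloping algebras and induced modules\<close>

abbreviation words :: "'a set \<Rightarrow> 'a fword set" where
  "words S \<equiv> {w. set (letters w) \<subseteq> S}"

lemma free_alg_carrier: "carrier (free_alg S) = {p. keys p \<subseteq> words S}"
  by (auto simp: free_alg_def)

lemma letters_plus [simp]: "letters (v + w) = letters v @ letters w"
  and letters_zero [simp]: "letters 0 = []"
  by (simp_all add: plus_fword_def zero_fword_def)

lemma free_alg_simps [simp]:
  "mult (free_alg S) = (*)" "one (free_alg S) = 1" "zero (free_alg S) = 0" "add (free_alg S) = (+)"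
  by (simp_all add: free_alg_def)

lemma free_alg_subspace: "cvs.subspace (carrier (free_alg S))"
  unfolding free_alg_carrier by (rule subspace_keys)

lemma free_alg_mult_closed:
  "\<lbrakk>p \<in> carrier (free_alg S); q \<in> carrier (free_alg S)\<rbrakk> \<Longrightarrow> p * q \<in> carrier (free_alg S)"
  using Poly_Mapping.keys_mult[of p q] unfolding free_alg_carrier by fastforce

lemma free_alg_single: "set (letters w) \<subseteq> S \<Longrightarrow> single w c \<in> carrier (free_alg S)"
  by (simp add: free_alg_carrier)

lemma free_alg_one: "1 \<in> carrier (free_alg S)"
  using free_alg_single[of 0 S 1] by simp

lemma free_alg_induct [consumes 1, case_names zero single add]:
  assumes "p \<in> carrier (free_alg S)" and "P 0"
    and "\<And>w c. set (letters w) \<subseteq> S \<Longrightarrow> P (single w c)"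
    and "\<And>p q. \<lbrakk>p \<in> carrier (free_alg S); q \<in> carrier (free_alg S); P p; P q\<rbrakk> \<Longrightarrow> P (p + q)"
  shows "P p"
  using assms unfolding free_alg_carrier mem_Collect_eq by (rule poly_mapping_keys_induct) auto

lemma ring_free_alg: "ring (free_alg S)"
proof (intro ringI abelian_groupI monoidI)
  note add = cvs.subspace_add[OF free_alg_subspace]
  fix x y assume "x \<in> carrier (free_alg S)"
  then show "\<exists>y\<in>carrier (free_alg S). y \<oplus>\<^bsub>free_alg S\<^esub> x = \<zero>\<^bsub>free_alg S\<^esub>"
    by (intro bexI[of _ "- x"]) (simp_all add: cvs.subspace_neg[OF free_alg_subspace])
qed (simp_all add: cvs.subspace_add[OF free_alg_subspace] cvs.subspace_0[OF free_alg_subspace]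
    free_alg_mult_closed free_alg_one algebra_simps)

lemma ideal_free_algI:
  assumes J: "cvs.subspace J" "J \<subseteq> carrier (free_alg S)"
    and mult: "\<And>a x. \<lbrakk>a \<in> J; x \<in> carrier (free_alg S)\<rbrakk> \<Longrightarrow> x * a \<in> J \<and> a * x \<in> J"
  shows "ideal J (free_alg S)"
proof (rule idealI[OF ring_free_alg])
  have minus: "\<ominus>\<^bsub>free_alg S\<^esub> p = - p" if "p \<in> carrier (free_alg S)" for p
    by (rule abelian_group.minus_equality[OF ring.is_abelian_group[OF ring_free_alg]])
      (use that in \<open>simp_all add: cvs.subspace_neg[OF free_alg_subspace]\<close>)
  show "subgroup J (add_monoid (free_alg S))"
  proof (rule group.subgroupI[OF abelian_group.a_group[OF ring.is_abelian_group[OF ring_free_alg]]])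
    show "J \<noteq> {}" using cvs.subspace_0[OF J(1)] by blast
    fix p assume "p \<in> J"
    then show "inv\<^bsub>add_monoid (free_alg S)\<^esub> p \<in> J"
      unfolding a_inv_def[symmetric] using J(2) cvs.subspace_neg[OF J(1)] by (simp add: minus subset_iff)
  qed (use J cvs.subspace_add[OF J(1)] in auto)
qed (use mult in auto)

section \<open>Enveloping algebras as quotients of free algebras\<close>

locale lie_ops =
  fixes L :: "('g, 'x) lie_algebra_scheme"
  assumes lie_add_closed: "\<lbrakk>x \<in> carrier L; y \<in> carrier L\<rbrakk> \<Longrightarrow> x \<oplus>\<^bsub>L\<^esub> y \<in> carrier L"
    and lie_smult_closed: "x \<in> carrier L \<Longrightarrow> c \<odot>\<^bsub>L\<^esub> x \<in> carrier L"
    and bracket_closed: "\<lbrakk>x \<in> carrier L; y \<in> carrier L\<rbrakk> \<Longrightarrow> bracket L x y \<in> carrier L"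
begin

abbreviation A where "A \<equiv> carrier (free_alg (carrier L))"
abbreviation I where "I \<equiv> uea_ideal L"

lemma gen_closed: "x \<in> carrier L \<Longrightarrow> gen x \<in> A"
  by (rule free_alg_single) simp

lemma rels_closed: "uea_rels L \<subseteq> A"
proof -
  note closed = cvs.subspace_diff[OF free_alg_subspace] free_alg_mult_closed gen_closed free_alg_single
    lie_add_closed lie_smult_closed bracket_closed
  show ?thesis unfolding uea_rels_def Un_subset_iff
    by (intro conjI subsetI; elim CollectE exE conjE; hypsubst; intro closed)
      (auto intro: closed)
qed

lemma ideal_I: "ideal I (free_alg (carrier L))"
  unfolding uea_ideal_def by (rule ring.genideal_ideal[OF ring_free_alg rels_closed])

sublocale I: ideal I "free_alg (carrier L)" by (rule ideal_I)

lemma I_closed: "I \<subseteq> A" using I.a_subset .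

lemma rels_in_I: "uea_rels L \<subseteq> I"
  unfolding uea_ideal_def by (rule ring.genideal_self[OF ring_free_alg rels_closed])

lemma I_subspace: "cvs.subspace I"
proof (rule cvs.subspaceI)
  show "0 \<in> I" using additive_subgroup.zero_closed[OF I.additive_subgroup_axioms] by simp
  show "x + y \<in> I" if "x \<in> I" "y \<in> I" for x y using additive_subgroup.a_closed[OF I.additive_subgroup_axioms that] by simp
  show "cscale c x \<in> I" if "x \<in> I" for c x
    using I.I_l_closed[OF that free_alg_single[of 0 "carrier L" c]] by (simp add: scalar_times)
qed

lemma uea_class_eq: "uea_class L p = coset I p"
  by (auto simp: uea_class_def a_r_coset_def' coset_def)

abbreviation U where "U \<equiv> uea L"

lemma U_carrier: "carrier U = coset I ` A"
  by (auto simp: uea_def FactRing_def A_RCOSETS_def' a_r_coset_def' coset_def)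

lemma U_mult: "\<lbrakk>p \<in> A; q \<in> A\<rbrakk> \<Longrightarrow> coset I p \<otimes>\<^bsub>U\<^esub> coset I q = coset I (p * q)"
  using I.rcoset_mult_add[of p q] by (simp add: uea_def FactRing_def uea_class_eq[symmetric] uea_class_def)

lemma U_add: "coset I p \<oplus>\<^bsub>U\<^esub> coset I q = coset I (p + q)"
proof -
  have "coset I p \<oplus>\<^bsub>U\<^esub> coset I q = {a + b | a b. a \<in> coset I p \<and> b \<in> coset I q}"
    by (auto simp: uea_def FactRing_def set_add_def')
  then show ?thesis by (simp add: set_add_coset[OF I_subspace])
qed

lemma U_smult: "p \<in> A \<Longrightarrow> c \<odot>\<^bsub>U\<^esub> coset I p = coset I (cscale c p)"
  using U_mult[OF free_alg_single[of 0 "carrier L" c], of p]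
  by (simp add: uea_def Let_def uea_class_eq scalar_times)

lemma U_zero: "\<zero>\<^bsub>U\<^esub> = I"
  by (simp add: uea_def FactRing_def)

lemma cspace_U: "cspace U (coset_emb I)"
  by (rule cspace_quotient[OF I_subspace free_alg_subspace[of "carrier L"] U_carrier U_zero U_add U_smult
        linear_proj_along[OF I_subspace] proj_along_eq_0[OF I_subspace]])

end

section \<open>The action of the enveloping algebra on a Lie module\<close>

locale lie_rep = lie_ops L + V: cspace V j
  for L :: "('g, 'x) lie_algebra_scheme" and V :: "('g, 'v) rep" and j :: "'v \<Rightarrow> ('k \<Rightarrow>\<^sub>0 complex)" +
  assumes lie_module: "lie_module L V"
begin

lemma act_closed [simp, intro]: "\<lbrakk>x \<in> carrier L; v \<in> carrier V\<rbrakk> \<Longrightarrow> act V x v \<in> carrier V"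
  and act_add [simp]: "\<lbrakk>x \<in> carrier L; v \<in> carrier V; w \<in> carrier V\<rbrakk> \<Longrightarrow>
    act V x (v \<oplus>\<^bsub>V\<^esub> w) = act V x v \<oplus>\<^bsub>V\<^esub> act V x w"
  and act_smult [simp]: "\<lbrakk>x \<in> carrier L; v \<in> carrier V\<rbrakk> \<Longrightarrow>
    act V x (c \<odot>\<^bsub>V\<^esub> v) = c \<odot>\<^bsub>V\<^esub> act V x v"
  and act_add_left: "\<lbrakk>x \<in> carrier L; y \<in> carrier L; v \<in> carrier V\<rbrakk> \<Longrightarrow>
    act V (x \<oplus>\<^bsub>L\<^esub> y) v = act V x v \<oplus>\<^bsub>V\<^esub> act V y v"
  and act_smult_left: "\<lbrakk>x \<in> carrier L; v \<in> carrier V\<rbrakk> \<Longrightarrow> act V (c \<odot>\<^bsub>L\<^esub> x) v = c \<odot>\<^bsub>V\<^esub> act V x v"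
  and act_bracket: "\<lbrakk>x \<in> carrier L; y \<in> carrier L; v \<in> carrier V\<rbrakk> \<Longrightarrow>
    act V (bracket L x y) v = act V x (act V y v) \<ominus>\<^bsub>V\<^esub> act V y (act V x v)"
  using lie_module unfolding lie_module_def linear_op_def by auto

abbreviation wact :: "'g fword \<Rightarrow> 'v \<Rightarrow> 'v" where
  "wact w v \<equiv> foldr (act V) (letters w) v"

lemma wact_closed [simp, intro]:
  assumes "set (letters w) \<subseteq> carrier L" "v \<in> carrier V" shows "wact w v \<in> carrier V"
proof -
  have "set xs \<subseteq> carrier L \<Longrightarrow> foldr (act V) xs v \<in> carrier V" for xs
    by (induction xs) (auto simp: assms(2))
  then show ?thesis using assms(1) by blast
qed

lemma
  assumes "set (letters w) \<subseteq> carrier L" "v \<in> carrier V"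
  shows wact_add: "u \<in> carrier V \<Longrightarrow> wact w (v \<oplus>\<^bsub>V\<^esub> u) = wact w v \<oplus>\<^bsub>V\<^esub> wact w u"
    and wact_smult: "wact w (c \<odot>\<^bsub>V\<^esub> v) = c \<odot>\<^bsub>V\<^esub> wact w v"
proof -
  have cl: "set xs \<subseteq> carrier L \<Longrightarrow> v \<in> carrier V \<Longrightarrow> foldr (act V) xs v \<in> carrier V" for xs v
    using wact_closed[of "FWord xs" v] by simp
  show "wact w (v \<oplus>\<^bsub>V\<^esub> u) = wact w v \<oplus>\<^bsub>V\<^esub> wact w u" if "u \<in> carrier V"
  proof -
    have "set xs \<subseteq> carrier L \<Longrightarrow>
        foldr (act V) xs (v \<oplus>\<^bsub>V\<^esub> u) = foldr (act V) xs v \<oplus>\<^bsub>V\<^esub> foldr (act V) xs u" for xs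
      by (induction xs) (auto simp: assms(2) that cl)
    then show ?thesis using assms(1) by blast
  qed
  have "set xs \<subseteq> carrier L \<Longrightarrow> foldr (act V) xs (c \<odot>\<^bsub>V\<^esub> v) = c \<odot>\<^bsub>V\<^esub> foldr (act V) xs v" for xs
    by (induction xs) (auto simp: assms(2) cl)
  then show "wact w (c \<odot>\<^bsub>V\<^esub> v) = c \<odot>\<^bsub>V\<^esub> wact w v" using assms(1) by blast
qed

abbreviation alg_act where "alg_act \<equiv> free_alg_act V"

lemma alg_act_summand_closed:
  "\<lbrakk>p \<in> A; v \<in> carrier V; w \<in> keys p\<rbrakk> \<Longrightarrow> c \<odot>\<^bsub>V\<^esub> wact w v \<in> carrier V"
  by (rule V.smult_closed, rule wact_closed) (auto simp: free_alg_carrier)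

lemma alg_act_closed [simp, intro]: "\<lbrakk>p \<in> A; v \<in> carrier V\<rbrakk> \<Longrightarrow> alg_act p v \<in> carrier V"
  unfolding free_alg_act_def by (rule V.finsum_closed, rule alg_act_summand_closed)

lemma wact_keys_closed: "\<lbrakk>p \<in> A; v \<in> carrier V; w \<in> keys p\<rbrakk> \<Longrightarrow> wact w v \<in> carrier V"
  by (rule wact_closed) (auto simp: free_alg_carrier)

lemma j_alg_act: "\<lbrakk>p \<in> A; v \<in> carrier V\<rbrakk> \<Longrightarrow> j (alg_act p v) = lext (\<lambda>w. j (wact w v)) p"
  unfolding free_alg_act_def lext_def
  by (subst V.j_finsum) (auto simp: alg_act_summand_closed wact_keys_closed intro!: sum.cong)

lemma alg_act_single:
  "\<lbrakk>set (letters w) \<subseteq> carrier L; v \<in> carrier V\<rbrakk> \<Longrightarrow> alg_act (single w c) v = c \<odot>\<^bsub>V\<^esub> wact w v"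
  by (rule V.j_inj) (auto simp: j_alg_act free_alg_single)

lemma alg_act_gen: "\<lbrakk>x \<in> carrier L; v \<in> carrier V\<rbrakk> \<Longrightarrow> alg_act (gen x) v = act V x v"
  by (rule V.j_inj) (auto simp: alg_act_single)

lemma alg_act_one: "v \<in> carrier V \<Longrightarrow> alg_act 1 v = v"
  using alg_act_single[of 0 v 1] by (auto intro: V.j_inj)

lemma alg_act_zero: "v \<in> carrier V \<Longrightarrow> alg_act 0 v = \<zero>\<^bsub>V\<^esub>"
  by (rule V.j_inj) (auto simp: j_alg_act cvs.subspace_0[OF free_alg_subspace])

lemma alg_act_add: "\<lbrakk>p \<in> A; q \<in> A; v \<in> carrier V\<rbrakk> \<Longrightarrow> alg_act (p + q) v = alg_act p v \<oplus>\<^bsub>V\<^esub> alg_act q v"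
  by (rule V.j_inj) (auto simp: j_alg_act cvs.subspace_add[OF free_alg_subspace] lext_add)

lemma alg_act_diff: "\<lbrakk>p \<in> A; q \<in> A; v \<in> carrier V\<rbrakk> \<Longrightarrow> alg_act (p - q) v = alg_act p v \<ominus>\<^bsub>V\<^esub> alg_act q v"
  by (rule V.j_inj) (auto simp: j_alg_act cvs.subspace_diff[OF free_alg_subspace] lext_diff)

lemma alg_act_cscale: "\<lbrakk>p \<in> A; v \<in> carrier V\<rbrakk> \<Longrightarrow> alg_act (cscale c p) v = c \<odot>\<^bsub>V\<^esub> alg_act p v"
  by (rule V.j_inj) (auto simp: j_alg_act cvs.subspace_scale[OF free_alg_subspace] lext_cscale)

lemma alg_act_add_right:
  assumes "p \<in> A" "v \<in> carrier V" "u \<in> carrier V"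
  shows "alg_act p (v \<oplus>\<^bsub>V\<^esub> u) = alg_act p v \<oplus>\<^bsub>V\<^esub> alg_act p u"
proof (rule V.j_inj)
  have "lext (\<lambda>w. j (wact w (v \<oplus>\<^bsub>V\<^esub> u))) p = lext (\<lambda>w. j (wact w v) + j (wact w u)) p"
    by (rule lext_cong[of _ "words (carrier L)"])
      (use assms in \<open>auto simp: free_alg_carrier wact_add\<close>)
  then show "j (alg_act p (v \<oplus>\<^bsub>V\<^esub> u)) = j (alg_act p v \<oplus>\<^bsub>V\<^esub> alg_act p u)"
    using assms by (simp add: j_alg_act) (simp add: lext_def cvs.scale_right_distrib sum.distrib)
qed (use assms in auto)

lemma alg_act_smult_right:
  assumes "p \<in> A" "v \<in> carrier V"
  shows "alg_act p (c \<odot>\<^bsub>V\<^esub> v) = c \<odot>\<^bsub>V\<^esub> alg_act p v"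
proof (rule V.j_inj)
  have "lext (\<lambda>w. j (wact w (c \<odot>\<^bsub>V\<^esub> v))) p = lext (\<lambda>w. cscale c (j (wact w v))) p"
    by (rule lext_cong[of _ "words (carrier L)"])
      (use assms in \<open>auto simp: free_alg_carrier wact_smult\<close>)
  then show "j (alg_act p (c \<odot>\<^bsub>V\<^esub> v)) = j (c \<odot>\<^bsub>V\<^esub> alg_act p v)"
    using assms by (simp add: j_alg_act) (simp add: lext_def cvs.scale_sum_right mult.commute)
qed (use assms in auto)

lemma alg_act_zero_right: "p \<in> A \<Longrightarrow> alg_act p \<zero>\<^bsub>V\<^esub> = \<zero>\<^bsub>V\<^esub>"
  by (rule V.linear_op_zero) (auto simp: linear_op_def alg_act_add_right alg_act_smult_right)

text \<open>Words act letter by letter, so concatenation becomes composition; the general case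
  follows by bilinearity, splitting the right factor first.\<close>

lemma alg_act_mult:
  assumes p: "p \<in> A" and q: "q \<in> A" and v: "v \<in> carrier V"
  shows "alg_act (p * q) v = alg_act p (alg_act q v)"
  using q
proof (induction q rule: free_alg_induct)
  case zero
  then show ?case using p v by (simp add: alg_act_zero alg_act_zero_right)
next
  case (single b d)
  show ?case using p
  proof (induction p rule: free_alg_induct)
    case zero
    then show ?case using single v by (simp add: alg_act_zero alg_act_closed free_alg_single)
  next
    case (single a c)
    then show ?case using \<open>set (letters b) \<subseteq> carrier L\<close> v
      by (simp add: mult_single alg_act_single wact_smult) (auto intro!: V.j_inj)
  next
    case (add p p')
    then show ?case using single v
      by (simp add: distrib_right alg_act_add free_alg_mult_closed free_alg_single)
  qed
next
  case (add q q')
  then show ?case using p v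
    by (simp add: distrib_left alg_act_add alg_act_add_right free_alg_mult_closed)
qed

text \<open>The elements annihilating the module form a two-sided ideal, and the module axioms say
  that the defining relations belong to it; \<open>I\<close> is the least ideal with this
  property.\<close>

lemma alg_act_I: assumes "p \<in> I" "v \<in> carrier V" shows "alg_act p v = \<zero>\<^bsub>V\<^esub>"
proof -
  let ?J = "{p \<in> A. \<forall>v\<in>carrier V. alg_act p v = \<zero>\<^bsub>V\<^esub>}"
  have "cvs.subspace ?J"
    by (rule cvs.subspaceI)
      (auto simp: alg_act_zero alg_act_add alg_act_cscale cvs.subspace_0[OF free_alg_subspace]
        cvs.subspace_add[OF free_alg_subspace] cvs.subspace_scale[OF free_alg_subspace] intro!: V.j_inj)
  then have "ideal ?J (free_alg (carrier L))"
    by (rule ideal_free_algI) (auto simp: alg_act_mult free_alg_mult_closed alg_act_zero_right)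
  moreover have "uea_rels L \<subseteq> ?J"
  proof -
    note closed = cvs.subspace_diff[OF free_alg_subspace] free_alg_mult_closed gen_closed
      lie_add_closed lie_smult_closed bracket_closed
    have 1: "gen (x \<oplus>\<^bsub>L\<^esub> y) - gen x - gen y \<in> ?J" if "x \<in> carrier L" "y \<in> carrier L" for x y
      using that by (auto simp: closed alg_act_diff alg_act_gen act_add_left intro!: V.j_inj)
    have 2: "gen (c \<odot>\<^bsub>L\<^esub> x) - cscale c (gen x) \<in> ?J" if "x \<in> carrier L" for x c
      using that cvs.subspace_scale[OF free_alg_subspace gen_closed[OF that], of c]
      by (auto simp: closed alg_act_diff alg_act_gen alg_act_single act_smult_left intro!: V.j_inj)
    have 3: "gen x * gen y - gen y * gen x - gen (bracket L x y) \<in> ?J" if "x \<in> carrier L" "y \<in> carrier L" for x y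
      using that by (auto simp: closed alg_act_diff alg_act_gen alg_act_mult act_bracket simp del: mult_single intro!: V.j_inj)
    show ?thesis using 1 2 3 unfolding uea_rels_def scalar_times Un_subset_iff by blast
  qed
  ultimately have "I \<subseteq> ?J"
    unfolding uea_ideal_def by (rule ring.genideal_minimal[OF ring_free_alg])
  then show ?thesis using assms by blast
qed

text \<open>All representatives act alike, so the image from which \<open>the_elem\<close> selects
  is a singleton.\<close>

lemma uea_act_coset: assumes "p \<in> A" "v \<in> carrier V" shows "uea_act V (coset I p) v = alg_act p v"
proof -
  have "alg_act q v = alg_act p v" if "q \<in> coset I p" for q
  proof -
    from that obtain h where h: "h \<in> I" "q = h + p" by (auto simp: coset_def)
    then show ?thesis using assms I_closed alg_act_I[of h v]
      by (auto simp: alg_act_add intro!: V.j_inj)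
  qed
  then have "(\<lambda>p. alg_act p v) ` coset I p = {alg_act p v}"
    using imageI[OF coset_self[OF I_subspace, of p], of "\<lambda>p. alg_act p v"]
    by (intro subset_antisym image_subsetI) simp_all
  then show ?thesis by (simp add: uea_act_def)
qed

end

section \<open>Induced modules and Frobenius reciprocity\<close>

locale induced = L: lie_ops L + P: lie_rep P V jV
  for L :: "('g, 'x) lie_algebra_scheme" and P :: "('g, 'y) lie_algebra_scheme"
    and V :: "('g, 'v) rep" and jV :: "'v \<Rightarrow> ('k \<Rightarrow>\<^sub>0 complex)" +
  assumes P_subset: "carrier P \<subseteq> carrier L"
    and P_add: "\<lbrakk>x \<in> carrier P; y \<in> carrier P\<rbrakk> \<Longrightarrow> x \<oplus>\<^bsub>P\<^esub> y = x \<oplus>\<^bsub>L\<^esub> y"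
    and P_smult: "x \<in> carrier P \<Longrightarrow> c \<odot>\<^bsub>P\<^esub> x = c \<odot>\<^bsub>L\<^esub> x"
    and P_bracket: "\<lbrakk>x \<in> carrier P; y \<in> carrier P\<rbrakk> \<Longrightarrow> bracket P x y = bracket L x y"
begin

lemma A_subset: "P.A \<subseteq> L.A"
  using P_subset unfolding free_alg_carrier by blast

text \<open>\<open>L.I\<close> cut down to the smaller free algebra is an ideal there and contains
  the relations of \<open>P\<close>. Hence the map between the enveloping algebras is well defined
  on cosets.\<close>

lemma I_subset: "P.I \<subseteq> L.I"
proof -
  let ?J = "L.I \<inter> P.A"
  have "ideal ?J (free_alg (carrier P))"
  proof (rule ideal_free_algI)
    show "cvs.subspace ?J"
      by (rule cvs.subspace_inter[OF L.I_subspace free_alg_subspace])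
    fix a x assume "a \<in> ?J" "x \<in> P.A"
    then show "x * a \<in> ?J \<and> a * x \<in> ?J"
      using L.I.I_l_closed[of a x] L.I.I_r_closed[of a x] A_subset by (auto simp: free_alg_mult_closed)
  qed blast
  moreover have "uea_rels P \<subseteq> uea_rels L"
    unfolding uea_rels_def using P_subset P_add P_smult P_bracket
    by (intro Un_mono subsetI; elim CollectE exE conjE; hypsubst) force+
  then have "uea_rels P \<subseteq> ?J" using L.rels_in_I P.rels_closed by blast
  ultimately have "P.I \<subseteq> ?J"
    unfolding uea_ideal_def[of P] by (rule ring.genideal_minimal[OF ring_free_alg])
  then show ?thesis by blast
qed

lemma uea_incl_coset: "uea_incl P L (coset P.I p) = coset L.I p"
proof -
  have "coset L.I q = coset L.I p" if "q \<in> coset P.I p" for q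
    using that I_subset by (auto simp: coset_iff coset_eq_iff[OF L.I_subspace])
  then have "coset L.I ` coset P.I p = {coset L.I p}"
    using imageI[OF coset_self[OF P.I_subspace, of p], of "coset L.I"]
    by (intro subset_antisym image_subsetI) simp_all
  then show ?thesis by (simp add: uea_incl_def L.uea_class_eq[abs_def])
qed

abbreviation ra where "ra \<equiv> \<lambda>u r. u \<otimes>\<^bsub>L.U\<^esub> uea_incl P L r"

lemma tensor_product_induced:
  "tensor_product (carrier P.U) ra (uea_act V) L.U V (coset_emb L.I) jV"
proof (intro tensor_product.intro L.cspace_U P.V.cspace_axioms tensor_product_axioms.intro)
  fix r u assume "r \<in> carrier P.U" "u \<in> carrier L.U"
  then show "ra u r \<in> carrier L.U"
    using A_subset by (auto simp: P.U_carrier L.U_carrier uea_incl_coset L.U_mult free_alg_mult_closed)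
next
  fix r v assume "r \<in> carrier P.U" "v \<in> carrier V"
  then show "uea_act V r v \<in> carrier V"
    by (auto simp: P.U_carrier P.uea_act_coset)
qed

sublocale tensor_product "carrier P.U" ra "uea_act V" L.U V "coset_emb L.I" jV
  by (rule tensor_product_induced)

abbreviation mul :: "'g \<Rightarrow> ('g fword \<Rightarrow>\<^sub>0 complex) set \<Rightarrow> ('g fword \<Rightarrow>\<^sub>0 complex) set" where
  "mul x \<equiv> \<lambda>u. uea_class L (gen x) \<otimes>\<^bsub>L.U\<^esub> u"

lemma mul_coset: "\<lbrakk>x \<in> carrier L; p \<in> L.A\<rbrakk> \<Longrightarrow> mul x (coset L.I p) = coset L.I (gen x * p)"
  by (simp add: L.uea_class_eq L.U_mult L.gen_closed)

text \<open>Left multiplication commutes with the right action of \<open>P.U\<close> by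
  associativity.\<close>

lemma balanced_mul: assumes x: "x \<in> carrier L" shows "balanced_pair (mul x) id"
proof -
  note [simp] = mul_coset[OF x] L.U_add L.U_smult L.U_mult L.gen_closed[OF x] free_alg_mult_closed
    cvs.subspace_add[OF free_alg_subspace] cvs.subspace_scale[OF free_alg_subspace] uea_incl_coset
    subsetD[OF A_subset]
  show ?thesis
    unfolding balanced_pair_def linear_op_def
    by (auto simp: L.U_carrier P.U_carrier distrib_left cscale_times_right mult.assoc)
qed

definition ind_act where "ind_act x = top (mul x) id"

lemma linear_ind_act: "x \<in> carrier L \<Longrightarrow> linear_op T (ind_act x)"
  unfolding ind_act_def by (rule linear_top[OF balanced_mul])

lemma induced_module_eq: "induced_module L P V = make_rep T ind_act"
  by (simp add: induced_module_def Let_def ind_act_def[abs_def])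

lemma ind_act_pt:
  "\<lbrakk>x \<in> carrier L; p \<in> L.A\<rbrakk> \<Longrightarrow> ind_act x (pt (coset L.I p) v) = pt (coset L.I (gen x * p)) v"
  by (simp add: ind_act_def top_pt balanced_mul mul_coset)

lemma coset_mem: "p \<in> L.A \<Longrightarrow> coset L.I p \<in> carrier L.U"
  by (simp add: L.U_carrier)

lemma coset_rel: assumes "r \<in> uea_rels L" "p \<in> L.A" shows "r * p \<in> L.I"
  using L.I.I_r_closed[of r p] L.rels_in_I assms by auto

text \<open>On a pure tensor each axiom is a defining relation of \<open>L.U\<close>, multiplied
  from the right by a representative of the first factor.\<close>

lemma lie_module_induced: "lie_module L (induced_module L P V)"
  unfolding induced_module_eq
proof (rule lie_moduleI)
  fix x y u v assume x: "x \<in> carrier L" and y: "y \<in> carrier L" and u: "u \<in> carrier L.U" and v: "v \<in> carrier V"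
  then obtain p where p: "p \<in> L.A" "u = coset L.I p" by (auto simp: L.U_carrier)
  note closed = free_alg_mult_closed L.gen_closed cvs.subspace_add[OF free_alg_subspace]
      L.bracket_closed L.lie_add_closed L.lie_smult_closed
  have "gen (x \<oplus>\<^bsub>L\<^esub> y) - gen x - gen y \<in> uea_rels L"
    unfolding uea_rels_def using x y by blast
  from coset_rel[OF this p(1)] have "coset L.I (gen (x \<oplus>\<^bsub>L\<^esub> y) * p) = coset L.I (gen x * p + gen y * p)"
    by (simp add: coset_eq_iff[OF L.I_subspace] algebra_simps)
  then show "ind_act (x \<oplus>\<^bsub>L\<^esub> y) (pt u v) = ind_act x (pt u v) \<oplus>\<^bsub>T\<^esub> ind_act y (pt u v)"
    using x y p v by (simp add: ind_act_pt closed pt_add_left[symmetric] coset_mem L.U_add)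
  have "gen x * gen y - gen y * gen x - gen (bracket L x y) \<in> uea_rels L"
    unfolding uea_rels_def using x y by blast
  from coset_rel[OF this p(1)]
  have "coset L.I (gen x * (gen y * p)) = coset L.I (gen y * (gen x * p) + gen (bracket L x y) * p)"
    by (simp add: coset_eq_iff[OF L.I_subspace] algebra_simps mult.assoc del: mult_single)
  then have "pt (coset L.I (gen x * (gen y * p))) v =
      pt (coset L.I (gen y * (gen x * p))) v \<oplus>\<^bsub>T\<^esub> pt (coset L.I (gen (bracket L x y) * p)) v"
    using x y p v by (simp add: closed pt_add_left[symmetric] coset_mem L.U_add)
  moreover have "pt (coset L.I (gen x * (gen y * p))) v \<in> carrier T"
    "pt (coset L.I (gen y * (gen x * p))) v \<in> carrier T" "pt (coset L.I (gen (bracket L x y) * p)) v \<in> carrier T"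
    using x y p v by (auto simp: closed coset_mem)
  ultimately show "ind_act (bracket L x y) (pt u v) =
      ind_act x (ind_act y (pt u v)) \<ominus>\<^bsub>T\<^esub> ind_act y (ind_act x (pt u v))"
    using x y p by (simp add: ind_act_pt closed T.add_minus_cancel)
next
  fix x c u v assume x: "x \<in> carrier L" and u: "u \<in> carrier L.U" and v: "v \<in> carrier V"
  then obtain p where p: "p \<in> L.A" "u = coset L.I p" by (auto simp: L.U_carrier)
  note closed = free_alg_mult_closed L.gen_closed cvs.subspace_scale[OF free_alg_subspace] L.lie_smult_closed
  have "gen (c \<odot>\<^bsub>L\<^esub> x) - scalar c * gen x \<in> uea_rels L"
    unfolding uea_rels_def using x by blast
  from coset_rel[OF this p(1)] have "coset L.I (gen (c \<odot>\<^bsub>L\<^esub> x) * p) = coset L.I (cscale c (gen x * p))"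
    unfolding scalar_times left_diff_distrib cscale_times_left coset_eq_iff[OF L.I_subspace] .
  then show "ind_act (c \<odot>\<^bsub>L\<^esub> x) (pt u v) = c \<odot>\<^bsub>T\<^esub> ind_act x (pt u v)"
    using x p v by (simp add: ind_act_pt closed pt_smult_left[symmetric] coset_mem L.U_smult)
qed (auto intro: linear_ind_act L.lie_add_closed L.lie_smult_closed L.bracket_closed)

definition unit_pt :: "'v \<Rightarrow> (('g fword \<Rightarrow>\<^sub>0 complex) set \<times> 'v \<Rightarrow>\<^sub>0 complex) set" where
  "unit_pt v = pt (coset L.I 1) v"

lemma unit_pt_closed [simp, intro]: "v \<in> carrier V \<Longrightarrow> unit_pt v \<in> carrier T"
  unfolding unit_pt_def by (intro pt_closed coset_mem free_alg_one)

lemma unit_pt_add: "\<lbrakk>v \<in> carrier V; w \<in> carrier V\<rbrakk> \<Longrightarrow> unit_pt (v \<oplus>\<^bsub>V\<^esub> w) = unit_pt v \<oplus>\<^bsub>T\<^esub> unit_pt w"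
  unfolding unit_pt_def by (intro pt_add_right coset_mem free_alg_one)

lemma unit_pt_smult: "v \<in> carrier V \<Longrightarrow> unit_pt (c \<odot>\<^bsub>V\<^esub> v) = c \<odot>\<^bsub>T\<^esub> unit_pt v"
  unfolding unit_pt_def by (intro pt_smult_right coset_mem free_alg_one)

text \<open>As x 1 = 1 x in \<open>L.U\<close> and \<open>x\<close> comes from \<open>P\<close>, it
  can be moved across the tensor sign, where it acts on \<open>v\<close>.\<close>

lemma ind_act_unit_pt:
  assumes "x \<in> carrier P" "v \<in> carrier V"
  shows "ind_act x (unit_pt v) = unit_pt (act V x v)"
proof -
  have x: "x \<in> carrier L" and g: "gen x \<in> P.A" using assms P_subset P.gen_closed by auto
  have "ind_act x (unit_pt v) = pt (coset L.I (gen x)) v"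
    by (simp add: unit_pt_def ind_act_pt x free_alg_one)
  also have "coset L.I (gen x) = ra (coset L.I 1) (coset P.I (gen x))"
    using L.gen_closed[OF x] by (simp add: uea_incl_coset L.U_mult free_alg_one)
  also have "pt \<dots> v = pt (coset L.I 1) (uea_act V (coset P.I (gen x)) v)"
    by (rule pt_balanced) (use assms g in \<open>auto simp: P.U_carrier coset_mem free_alg_one\<close>)
  also have "\<dots> = unit_pt (act V x v)"
    using assms g by (simp add: P.uea_act_coset P.alg_act_gen unit_pt_def)
  finally show ?thesis .
qed

text \<open>The unit tensors generate: a word in the first factor arises from the unit by letting
  its letters act one after another, and words span the free algebra.\<close>

lemma induced_induct [consumes 1, case_names zero unit add smult act]:
  assumes "z \<in> carrier T" "Q \<zero>\<^bsub>T\<^esub>" "\<And>v. v \<in> carrier V \<Longrightarrow> Q (unit_pt v)"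
    and "\<And>x y. \<lbrakk>x \<in> carrier T; y \<in> carrier T; Q x; Q y\<rbrakk> \<Longrightarrow> Q (x \<oplus>\<^bsub>T\<^esub> y)"
    and "\<And>c x. \<lbrakk>x \<in> carrier T; Q x\<rbrakk> \<Longrightarrow> Q (c \<odot>\<^bsub>T\<^esub> x)"
    and "\<And>x z. \<lbrakk>x \<in> carrier L; z \<in> carrier T; Q z\<rbrakk> \<Longrightarrow> Q (ind_act x z)"
  shows "Q z"
  using assms(1)
proof (induction rule: pt_induct)
  case (pt u v)
  then obtain p where p: "p \<in> L.A" "u = coset L.I p" by (auto simp: L.U_carrier)
  have "Q (pt (coset L.I p) v)" using p(1)
  proof (induction p rule: free_alg_induct)
    case zero
    have "pt (coset L.I 0) v = 0 \<odot>\<^bsub>T\<^esub> unit_pt v"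
      unfolding unit_pt_def using pt by (simp add: pt_smult_left[symmetric] coset_mem free_alg_one L.U_smult)
    then show ?case using assms(2) pt by simp
  next
    case (single w c)
    have *: "Q (pt (coset L.I (single (FWord xs) 1)) v)" if "set xs \<subseteq> carrier L" for xs
      using that
    proof (induction xs)
      case Nil
      then show ?case using assms(3)[OF pt(2)]
        by (simp add: unit_pt_def zero_fword_def[symmetric])
    next
      case (Cons x xs)
      have "Q (ind_act x (pt (coset L.I (single (FWord xs) 1)) v))"
        using Cons by (intro assms(6) pt_closed coset_mem free_alg_single pt) auto
      then show ?case using Cons.prems
        by (simp add: ind_act_pt free_alg_single mult_single) (simp add: plus_fword_def)
    qed
    have "pt (coset L.I (single w c)) v = c \<odot>\<^bsub>T\<^esub> pt (coset L.I (single w 1)) v"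
      using single pt by (simp add: pt_smult_left[symmetric] coset_mem free_alg_single L.U_smult)
    then show ?case using *[of "letters w"] single pt
      by (auto intro!: assms(5) pt_closed coset_mem free_alg_single)
  next
    case (add p q)
    then show ?case using pt
      by (simp add: L.U_add[symmetric] pt_add_left coset_mem assms(4))
  qed
  then show ?case using p by simp
qed (use assms in auto)

text \<open>The map is u \<otimes> v \<mapsto> u \<iota>(v). It is balanced because
  \<open>\<iota>\<close> commutes with the elements of \<open>P\<close>, hence with words in them
  and with all of \<open>P.U\<close>.\<close>

lemma frobenius_reciprocity:
  assumes F: "lie_rep L F jF"
    and \<iota>: "\<And>v. v \<in> carrier V \<Longrightarrow> \<iota> v \<in> carrier F"
      "\<And>v w. \<lbrakk>v \<in> carrier V; w \<in> carrier V\<rbrakk> \<Longrightarrow> \<iota> (v \<oplus>\<^bsub>V\<^esub> w) = \<iota> v \<oplus>\<^bsub>F\<^esub> \<iota> w"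
      "\<And>c v. v \<in> carrier V \<Longrightarrow> \<iota> (c \<odot>\<^bsub>V\<^esub> v) = c \<odot>\<^bsub>F\<^esub> \<iota> v"
      "\<And>x v. \<lbrakk>x \<in> carrier P; v \<in> carrier V\<rbrakk> \<Longrightarrow> \<iota> (act V x v) = act F x (\<iota> v)"
  obtains \<phi> where "\<And>z. z \<in> carrier T \<Longrightarrow> \<phi> z \<in> carrier F"
    "\<And>x y. \<lbrakk>x \<in> carrier T; y \<in> carrier T\<rbrakk> \<Longrightarrow> \<phi> (x \<oplus>\<^bsub>T\<^esub> y) = \<phi> x \<oplus>\<^bsub>F\<^esub> \<phi> y"
    "\<And>c x. x \<in> carrier T \<Longrightarrow> \<phi> (c \<odot>\<^bsub>T\<^esub> x) = c \<odot>\<^bsub>F\<^esub> \<phi> x"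
    "\<And>x z. \<lbrakk>x \<in> carrier L; z \<in> carrier T\<rbrakk> \<Longrightarrow> \<phi> (ind_act x z) = act F x (\<phi> z)"
    "\<And>v. v \<in> carrier V \<Longrightarrow> \<phi> (unit_pt v) = \<iota> v"
proof -
  interpret F: lie_rep L F jF by (rule F)
  define B where "B u v = jF (uea_act F u (\<iota> v))" for u v
  have B_coset: "B (coset L.I p) v = jF (F.alg_act p (\<iota> v))" if "p \<in> L.A" "v \<in> carrier V" for p v
    using that by (simp add: B_def F.uea_act_coset \<iota>)
  have \<iota>_alg_act: "\<iota> (P.alg_act q v) = F.alg_act q (\<iota> v)" if "q \<in> P.A" "v \<in> carrier V" for q v
    using that(1)
  proof (induction q rule: free_alg_induct)
    case zero
    have "\<iota> \<zero>\<^bsub>V\<^esub> = 0 \<odot>\<^bsub>F\<^esub> \<iota> \<zero>\<^bsub>V\<^esub>" using \<iota>(3)[of "\<zero>\<^bsub>V\<^esub>" 0] by simp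
    also have "\<dots> = \<zero>\<^bsub>F\<^esub>" by (simp add: \<iota>)
    finally show ?case using that by (simp add: P.alg_act_zero F.alg_act_zero \<iota>)
  next
    case (single w c)
    have "\<iota> (foldr (act V) xs v) = foldr (act F) xs (\<iota> v)" if "set xs \<subseteq> carrier P" for xs
      using that
    proof (induction xs)
      case (Cons x xs)
      have "foldr (act V) xs v \<in> carrier V"
        using P.wact_closed[of "FWord xs" v] Cons.prems \<open>v \<in> carrier V\<close> by simp
      then show ?case using Cons \<iota>(4) by simp
    qed simp
    then show ?case using single that P_subset
      by (simp add: P.alg_act_single F.alg_act_single \<iota> P.wact_closed subset_trans)
  next
    case (add p q)
    then show ?case using that A_subset
      by (simp add: P.alg_act_add F.alg_act_add \<iota> subset_iff)
  qed
  have B: "balanced_bilinear B"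
    unfolding balanced_bilinear_def
  proof (intro conjI ballI allI)
    fix r u v assume r: "r \<in> carrier P.U" and u: "u \<in> carrier L.U" and v: "v \<in> carrier V"
    then obtain p q where p: "p \<in> L.A" "u = coset L.I p" and q: "q \<in> P.A" "r = coset P.I q"
      by (auto simp: L.U_carrier P.U_carrier)
    have q': "q \<in> L.A" using q A_subset by blast
    show "B (ra u r) v = B u (uea_act V r v)"
      using p q q' v by (simp add: uea_incl_coset L.U_mult B_coset free_alg_mult_closed P.uea_act_coset
          F.alg_act_mult \<iota> \<iota>_alg_act)
  qed (auto simp: L.U_carrier L.U_add L.U_smult B_coset cvs.subspace_add[OF free_alg_subspace]
      cvs.subspace_scale[OF free_alg_subspace] \<iota> F.alg_act_add F.alg_act_cscale F.alg_act_add_right F.alg_act_smult_right)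
  \<comment> \<open>\<open>tlift\<close> takes values in the coordinate space; they stay within the
    image of the carrier of \<open>F\<close>, so that \<open>jF\<close> can be inverted
    there.\<close>
  have range: "tlift B z \<in> jF ` carrier F" if "z \<in> carrier T" for z
    using that
  proof (induction rule: pt_induct)
    case zero
    show ?case using B cvs.subspace_0[OF F.V.subspace_range] by simp
  next
    case (pt u v)
    then show ?case using B by (auto simp: L.U_carrier B_coset \<iota>)
  next
    case (add x y)
    then show ?case using B cvs.subspace_add[OF F.V.subspace_range] by simp
  next
    case (smult c x)
    then show ?case using B cvs.subspace_scale[OF F.V.subspace_range] by simp
  qed
  define \<phi> where "\<phi> z = inv_into (carrier F) jF (tlift B z)" for z
  have \<phi>: "\<phi> z \<in> carrier F" "jF (\<phi> z) = tlift B z" if "z \<in> carrier T" for z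
    using range[OF that] by (auto simp: \<phi>_def inv_into_into f_inv_into_f)
  have cl: "ind_act x z \<in> carrier T" if "x \<in> carrier L" "z \<in> carrier T" for x z
    using linear_ind_act[OF that(1)] that(2) by (auto simp: linear_op_def)
  have add: "\<phi> (x \<oplus>\<^bsub>T\<^esub> y) = \<phi> x \<oplus>\<^bsub>F\<^esub> \<phi> y" if "x \<in> carrier T" "y \<in> carrier T" for x y
    by (rule F.V.j_inj) (use that B in \<open>auto simp: \<phi>\<close>)
  have smult: "\<phi> (c \<odot>\<^bsub>T\<^esub> x) = c \<odot>\<^bsub>F\<^esub> \<phi> x" if "x \<in> carrier T" for x c
    by (rule F.V.j_inj) (use that B in \<open>auto simp: \<phi>\<close>)
  have \<phi>_pt: "\<phi> (pt (coset L.I p) v) = F.alg_act p (\<iota> v)" if "p \<in> L.A" "v \<in> carrier V" for p v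
    by (rule F.V.j_inj) (use that B in \<open>auto simp: \<phi> \<iota> coset_mem B_coset\<close>)
  show ?thesis
  proof (rule that[of \<phi>])
    fix x z assume x: "x \<in> carrier L" and z: "z \<in> carrier T"
    have lin: "ind_act x (a \<oplus>\<^bsub>T\<^esub> b) = ind_act x a \<oplus>\<^bsub>T\<^esub> ind_act x b"
        "ind_act x (c \<odot>\<^bsub>T\<^esub> a) = c \<odot>\<^bsub>T\<^esub> ind_act x a" if "a \<in> carrier T" "b \<in> carrier T" for a b c
      using linear_ind_act[OF x] that by (auto simp: linear_op_def)
    have \<phi>0: "\<phi> \<zero>\<^bsub>T\<^esub> = \<zero>\<^bsub>F\<^esub>"
      using smult[of "\<zero>\<^bsub>T\<^esub>" 0] by (simp add: \<phi>)
    have zero: "\<phi> (ind_act x \<zero>\<^bsub>T\<^esub>) = act F x (\<phi> \<zero>\<^bsub>T\<^esub>)"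
      using T.linear_op_zero[OF linear_ind_act[OF x]] F.V.linear_op_zero[of "act F x"] x
      by (simp add: \<phi>0 linear_op_def)
    show "\<phi> (ind_act x z) = act F x (\<phi> z)" using z
    proof (induction rule: pt_induct)
      case (pt u v)
      then obtain p where p: "p \<in> L.A" "u = coset L.I p" by (auto simp: L.U_carrier)
      show ?case using x p pt unfolding p(2) ind_act_pt[OF x p(1)] by (simp add: \<phi>_pt free_alg_mult_closed L.gen_closed F.alg_act_mult F.alg_act_gen \<iota>)
    qed (use x zero in \<open>simp_all add: lin cl add smult \<phi>\<close>)
  next
    fix v assume "v \<in> carrier V"
    then show "\<phi> (unit_pt v) = \<iota> v"
      unfolding unit_pt_def by (simp add: \<phi>_pt free_alg_one F.alg_act_one \<iota>)
  qed (use \<phi> add smult in auto)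
qed

end

section \<open>Evaluation of polynomials\<close>

definition mon :: "('m::finite \<Rightarrow>\<^sub>0 nat) \<Rightarrow> ('m \<Rightarrow> complex) \<Rightarrow> complex" where
  "mon \<alpha> x = (\<Prod>i\<in>UNIV. x i ^ lookup \<alpha> i)"

definition ev :: "'m::finite mpoly \<Rightarrow> ('m \<Rightarrow> complex) \<Rightarrow> complex" where
  "ev f x = (\<Sum>\<alpha>\<in>keys f. lookup f \<alpha> * mon \<alpha> x)"

lemma mon_0 [simp]: "mon 0 x = 1"
  by (simp add: mon_def)

lemma mon_add: "mon (\<alpha> + \<beta>) x = mon \<alpha> x * mon \<beta> x"
  by (simp add: mon_def lookup_add power_add prod.distrib)

lemma ev_superset:
  assumes "finite A" "keys f \<subseteq> A"
  shows "ev f x = (\<Sum>\<alpha>\<in>A. lookup f \<alpha> * mon \<alpha> x)"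
  unfolding ev_def by (rule sum.mono_neutral_left) (use assms in \<open>auto simp: in_keys_iff\<close>)

lemma ev_0 [simp]: "ev 0 x = 0"
  by (simp add: ev_def)

lemma ev_add [simp]: "ev (f + g) x = ev f x + ev g x"
proof -
  let ?A = "keys f \<union> keys g"
  have "ev (f + g) x = (\<Sum>\<alpha>\<in>?A. lookup (f + g) \<alpha> * mon \<alpha> x)"
    by (rule ev_superset) (auto simp: Poly_Mapping.keys_add)
  then show ?thesis
    by (simp add: ev_superset[of ?A] lookup_add distrib_right sum.distrib)
qed

lemma ev_cscale [simp]: "ev (cscale c f) x = c * ev f x"
  by (subst ev_superset[of "keys f"])
    (simp_all add: keys_cscale ev_def sum_distrib_left mult.assoc)

lemma ev_single: "ev (single \<alpha> c) x = c * mon \<alpha> x"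
  by (simp add: ev_def)

lemma ev_scalar [simp]: "ev (scalar c) x = c"
  by (simp add: ev_single)

lemma ev_1 [simp]: "ev 1 x = 1"
  using ev_scalar[of 1 x] by simp

lemma ev_diff [simp]: "ev (f - g) x = ev f x - ev g x"
  using ev_add[of "f - g" g x] by simp

lemma mpoly_induct [case_names zero single add]:
  fixes p :: "'a \<Rightarrow>\<^sub>0 'b::comm_monoid_add"
  assumes "P 0" "\<And>k c. P (single k c)" "\<And>p q. P p \<Longrightarrow> P q \<Longrightarrow> P (p + q)"
  shows "P p"
  by (rule poly_mapping_keys_induct[of p UNIV]) (use assms in auto)

lemma ev_mult [simp]: "ev (f * g) x = ev f x * ev g x"
proof (induction f rule: mpoly_induct)
  case (single a c)
  show ?case
    by (induction g rule: mpoly_induct) (simp_all add: mult_single ev_single mon_add algebra_simps)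
qed (simp_all add: algebra_simps)

lemma ev_power [simp]: "ev (f ^ n) x = ev f x ^ n"
  by (induction n) simp_all

lemma ev_prod [simp]: "ev (prod f A) x = (\<Prod>a\<in>A. ev (f a) x)"
  by (induction A rule: infinite_finite_induct) simp_all

lemma ev_xvar [simp]: "ev (xvar i) x = x i"
proof -
  have "(\<Prod>j\<in>UNIV. x j ^ lookup (single i 1) j) = (\<Prod>j\<in>UNIV. if j = i then x j else 1)"
    by (intro prod.cong) (auto simp: lookup_single when_def)
  then show ?thesis by (simp add: xvar_def ev_single mon_def)
qed

lemma subst_eq_lext: "subst q = lext (\<lambda>\<alpha>. \<Prod>i\<in>UNIV. q i ^ lookup \<alpha> i)"
  by (simp add: subst_def lext_def scalar_times fun_eq_iff)

lemma ev_subst: "ev (subst q f) x = ev f (\<lambda>i. ev (q i) x)"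
  unfolding subst_eq_lext
  by (induction f rule: mpoly_induct) (simp_all add: lext_add ev_single mon_def)

lemma ev_shift [simp]: "ev (shift i c f) x = ev f (x(i := x i + c))"
proof -
  have "(\<lambda>j. ev (if j = i then xvar j + scalar c else xvar j) x) = x(i := x i + c)"
    by (auto simp: fun_eq_iff)
  then show ?thesis by (simp add: shift_def ev_subst)
qed

text \<open>Weighting each coefficient with \<open>N a - N b\<close> removes the point
  \<open>b\<close> and keeps all power sums zero; the weights are nonzero at the remaining
  points.\<close>

lemma vandermonde:
  fixes N :: "'a \<Rightarrow> complex"
  assumes "finite S" "inj_on N S" "\<And>k. (\<Sum>a\<in>S. c a * N a ^ k) = 0"
  shows "\<forall>a\<in>S. c a = 0"
  using assms
proof (induction S arbitrary: c)
  case (insert b S)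
  have "(\<Sum>a\<in>S. (c a * (N a - N b)) * N a ^ k) = 0" for k
  proof -
    have "(\<Sum>a\<in>S. (c a * (N a - N b)) * N a ^ k) = (\<Sum>a\<in>insert b S. (c a * (N a - N b)) * N a ^ k)"
      using insert by simp
    also have "\<dots> = (\<Sum>a\<in>insert b S. c a * N a ^ Suc k) - N b * (\<Sum>a\<in>insert b S. c a * N a ^ k)"
      unfolding sum_distrib_left sum_subtractf[symmetric] by (intro sum.cong) (auto simp: algebra_simps)
    also have "\<dots> = 0" unfolding insert.prems(2) by simp
    finally show ?thesis .
  qed
  then have "\<forall>a\<in>S. c a * (N a - N b) = 0"
    by (rule insert.IH[rotated]) (use insert in auto)
  then have S: "\<forall>a\<in>S. c a = 0" using insert by (auto simp: inj_on_def)
  then have "c b = 0" using insert.prems(2)[of 0] insert.hyps by simp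
  then show ?case using S by simp
qed simp

text \<open>Unique factorisation: for distinct primes the exponents are the multiplicities in the
  product.\<close>

lemma exponents_separated:
  obtains p :: "'m::finite \<Rightarrow> nat" where "inj (\<lambda>\<alpha> :: 'm \<Rightarrow>\<^sub>0 nat. \<Prod>i\<in>UNIV. p i ^ lookup \<alpha> i)"
proof -
  obtain P :: "nat set" where P: "P \<subseteq> {p. prime p}" "finite P" "card P = CARD('m)"
    using infinite_arbitrarily_large[OF primes_infinite] by blast
  then obtain p :: "'m \<Rightarrow> nat" where p: "bij_betw p UNIV P"
    using finite_same_card_bij[of "UNIV :: 'm set" P] by auto
  have prime: "prime (p i)" for i using p P by (auto simp: bij_betw_def)
  have primeP: "q \<in> P \<Longrightarrow> prime q" for q using P(1) by blast
  have inj: "inj p" and range: "range p = P" using p by (auto simp: bij_betw_def)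
  have mult: "multiplicity (p i) (\<Prod>j\<in>UNIV. p j ^ lookup \<alpha> j) = lookup \<alpha> i"
    for i and \<alpha> :: "'m \<Rightarrow>\<^sub>0 nat"
  proof -
    have "(\<Prod>j\<in>UNIV. p j ^ lookup \<alpha> j) = (\<Prod>q\<in>P. q ^ lookup \<alpha> (inv_into UNIV p q))"
      unfolding range[symmetric] by (simp add: prod.reindex inj)
    then show ?thesis
      using multiplicity_prod_prime_powers[OF P(2) primeP prime[of i], of "\<lambda>q. lookup \<alpha> (inv_into UNIV p q)"]
        range inj by auto
  qed
  have "inj (\<lambda>\<alpha> :: 'm \<Rightarrow>\<^sub>0 nat. \<Prod>i\<in>UNIV. p i ^ lookup \<alpha> i)"
  proof (rule injI)
    fix \<alpha> \<beta> :: "'m \<Rightarrow>\<^sub>0 nat"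
    assume "(\<Prod>i\<in>UNIV. p i ^ lookup \<alpha> i) = (\<Prod>i\<in>UNIV. p i ^ lookup \<beta> i)"
    then show "\<alpha> = \<beta>" by (intro poly_mapping_eqI) (metis mult)
  qed
  then show ?thesis by (rule that)
qed

abbreviation zpt :: "('m \<Rightarrow>\<^sub>0 int) \<Rightarrow> 'm \<Rightarrow> complex" where
  "zpt \<beta> \<equiv> \<lambda>i. of_int (lookup \<beta> i)"

lemma zpt_exists: "\<exists>\<beta>. zpt \<beta> = (\<lambda>i :: 'm::finite. of_int (z i))"
  by (rule exI[of _ "Abs_poly_mapping z"]) simp

text \<open>Evaluation at the powers \<open>(p\<^sub>1\<^sup>k, \<dots>, p\<^sub>m\<^sup>k)\<close> of distinct primes separates the monomials.\<close>

lemma ev_eq_zero: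
  fixes f :: "'m::finite mpoly"
  assumes "\<And>\<beta>. ev f (zpt \<beta>) = 0"
  shows "f = 0"
proof -
  obtain p :: "'m \<Rightarrow> nat" where p: "inj (\<lambda>\<alpha> :: 'm \<Rightarrow>\<^sub>0 nat. \<Prod>i\<in>UNIV. p i ^ lookup \<alpha> i)"
    by (rule exponents_separated)
  define N :: "('m \<Rightarrow>\<^sub>0 nat) \<Rightarrow> complex" where "N \<alpha> = of_nat (\<Prod>i\<in>UNIV. p i ^ lookup \<alpha> i)" for \<alpha>
  have "inj N" using p unfolding N_def inj_def of_nat_eq_iff by blast
  moreover have "(\<Sum>\<alpha>\<in>keys f. lookup f \<alpha> * N \<alpha> ^ k) = 0" for k
  proof -
    obtain \<beta> :: "'m \<Rightarrow>\<^sub>0 int" where \<beta>: "zpt \<beta> = (\<lambda>i. of_int (int (p i ^ k)))"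
      using zpt_exists by metis
    have "mon \<alpha> (zpt \<beta>) = N \<alpha> ^ k" for \<alpha>
      unfolding mon_def \<beta> N_def by (simp add: prod_power_distrib power_mult[symmetric] mult.commute)
    then show ?thesis using assms[of \<beta>] by (simp add: ev_def)
  qed
  ultimately have "\<forall>\<alpha>\<in>keys f. lookup f \<alpha> = 0"
    by (intro vandermonde[of _ N]) (auto intro: inj_on_subset)
  then show ?thesis by (intro poly_mapping_eqI) (auto simp: in_keys_iff)
qed

lemma mpoly_eqI:
  fixes f g :: "'m::finite mpoly"
  assumes "\<And>\<beta>. ev f (zpt \<beta>) = ev g (zpt \<beta>)"
  shows "f = g"
  using ev_eq_zero[of "f - g"] assms by simp

section \<open>Laurent polynomials and the Weyl algebra\<close>

lemma pd_eq_lext: "pd i = lext (\<lambda>\<alpha>. single (\<alpha> - single i 1) (of_int (lookup \<alpha> i)))"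
  by (simp add: pd_def lext_def fun_eq_iff mult.commute)

lemma pd_add [simp]: "pd i (p + q) = pd i p + pd i q"
  and pd_cscale [simp]: "pd i (cscale c p) = cscale c (pd i p)"
  and pd_0 [simp]: "pd i 0 = 0"
  and pd_diff [simp]: "pd i (p - q) = pd i p - pd i q"
  and pd_single: "pd i (single \<alpha> c) =
    single (\<alpha> - single i 1) (c * of_int (lookup \<alpha> i))"
  by (simp_all add: pd_eq_lext lext_add lext_cscale lext_diff)

lemma pd_sum [simp]: "pd i (sum f A) = (\<Sum>a\<in>A. pd i (f a))"
  by (induction A rule: infinite_finite_induct) simp_all

lemma linear_pd: "Vector_Spaces.linear cscale cscale (pd i)"
  unfolding pd_eq_lext by (rule linear_lext)

lemma pd_mult: "pd i (p * q) = pd i p * q + p * pd i q"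
proof (induction p rule: mpoly_induct)
  case (single a c)
  show ?case
  proof (induction q rule: mpoly_induct)
    case (single b d)
    have "a + (b - single i 1) = a + b - single i 1"
      "a - single i 1 + b = a + b - single i 1" by simp_all
    then show ?case by (simp add: mult_single pd_single lookup_add single_add[symmetric] algebra_simps)
  qed (simp_all add: algebra_simps)
qed (simp_all add: algebra_simps)

lemma pd_commute: "pd i (pd j p) = pd j (pd i p)"
proof (induction p rule: mpoly_induct)
  case (single a c)
  show ?case by (cases "i = j") (simp_all add: pd_single lookup_minus lookup_single algebra_simps)
qed simp_all

lemma linear_mult: "Vector_Spaces.linear cscale cscale (\<lambda>p :: 'a::comm_monoid_add \<Rightarrow>\<^sub>0 complex. q * p)"
  by (simp add: Vector_Spaces.linear_iff cvs.vector_space_axioms distrib_left cscale_times_right)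

lemma linear_weyl: "X \<in> weyl_algebra \<Longrightarrow> Vector_Spaces.linear cscale cscale X"
proof (induction rule: weyl_algebra.induct)
  case (mult q)
  show ?case by (rule linear_mult)
next
  case (pd i)
  show ?case by (rule linear_pd)
next
  case (add X Y)
  show ?case by (rule cvs_pair.linear_compose_add[OF add.IH])
next
  case (comp X Y)
  show ?case by (rule Vector_Spaces.linear_compose[OF comp.IH(2,1)])
qed

lemma tpow_add: "tpow (\<alpha> + \<beta>) = tpow \<alpha> * tpow \<beta>"
  by (simp add: tpow_def mult_single)

lemma tpow_0 [simp]: "tpow 0 = 1"
  by (simp add: tpow_def)

lemma tvar_inv_tvar [simp]: "tvar_inv i * tvar i = 1" "tvar_inv i * (tvar i * p) = p"
proof -
  show "tvar_inv i * tvar i = 1"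
    unfolding tvar_inv_def tvar_def tpow_add[symmetric] single_add[symmetric] by simp
  then show "tvar_inv i * (tvar i * p) = p" by (simp only: mult.assoc[symmetric] mult_1_left)
qed

lemma weyl_theta: "(\<lambda>p. tvar i * pd i p) \<in> weyl_algebra"
  using weyl_algebra.comp[OF weyl_algebra.mult weyl_algebra.pd] by (simp add: o_def)

text \<open>Scalars, \<open>tvar i\<close>, \<open>tvar_inv i\<close> and
  \<open>tvar i * pd i\<close> generate the Weyl algebra, since \<open>pd i\<close> is
  \<open>tvar_inv i\<close> after the last of these. On them the action on \<open>Omega\<close> is
  prescribed.\<close>

lemma weyl_induct [consumes 1, case_names scalar tvar tvar_inv theta add comp]:
  assumes X: "X \<in> weyl_algebra"
    and scalar: "\<And>c. P (\<lambda>p. scalar c * p)" and tvar: "\<And>i. P (\<lambda>p. tvar i * p)"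
    and tvar_inv: "\<And>i. P (\<lambda>p. tvar_inv i * p)" and theta: "\<And>i. P (\<lambda>p. tvar i * pd i p)"
    and add: "\<And>X Y. \<lbrakk>X \<in> weyl_algebra; Y \<in> weyl_algebra; P X; P Y\<rbrakk> \<Longrightarrow> P (\<lambda>p. X p + Y p)"
    and comp: "\<And>X Y. \<lbrakk>X \<in> weyl_algebra; Y \<in> weyl_algebra; P X; P Y\<rbrakk> \<Longrightarrow> P (X \<circ> Y)"
  shows "P X"
  using X
proof (induction rule: weyl_algebra.induct)
  case (mult q)
  have mul: "P (\<lambda>p. (q * q') * p)" if "P (\<lambda>p. q * p)" "P (\<lambda>p. q' * p)" for q q'
    using comp[OF weyl_algebra.mult weyl_algebra.mult that] by (simp add: o_def mult.assoc)
  have one: "P (\<lambda>p. p)" using scalar[of 1] by simp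
  have "P (\<lambda>p. tpow \<alpha> * p)" for \<alpha>
  proof (induction \<alpha> rule: mpoly_induct)
    case zero
    then show ?case using one by simp
  next
    case (single k c)
    show ?case
    proof (induction c rule: int_induct[of _ 0])
      case base
      then show ?case using one by simp
    next
      case (step1 c)
      then show ?case using mul[OF step1(2) tvar[of k]] by (simp add: single_add tpow_add tvar_def)
    next
      case (step2 c)
      have "single k (c - 1) = single k c + single k (-1)"
        by (simp add: single_add[symmetric])
      then show ?case using mul[OF step2(2) tvar_inv[of k]] by (simp add: tpow_add tvar_inv_def)
    qed
  next
    case (add \<alpha> \<beta>)
    then show ?case using mul by (simp add: tpow_add)
  qed
  then have "P (\<lambda>p. (scalar c * tpow \<alpha>) * p)" for c \<alpha>
    using mul[OF scalar] by blast
  then have "P (\<lambda>p. single \<alpha> c * p)" for c \<alpha>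
    by (simp add: tpow_def mult_single)
  then show ?case
  proof (induction q rule: mpoly_induct)
    case zero
    then show ?case using scalar[of 0] by simp
  next
    case (add p q)
    then show ?case using assms(6)[OF weyl_algebra.mult weyl_algebra.mult, of p q]
      by (simp add: distrib_right)
  qed
next
  case (pd i)
  show ?case
    using comp[OF weyl_algebra.mult weyl_theta tvar_inv theta, of i i] by (simp add: o_def)
next
  case (add X Y)
  show ?case by (rule assms(6)[OF add.hyps add.IH])
next
  case (comp X Y)
  show ?case by (rule assms(7)[OF comp.hyps comp.IH])
qed

section \<open>Differential operators on formal Laurent series\<close>

definition lamp :: "('m::finite \<Rightarrow> complex) \<Rightarrow> ('m \<Rightarrow>\<^sub>0 int) \<Rightarrow> complex" where
  "lamp lam \<gamma> = (\<Prod>i\<in>UNIV. lam i powi lookup \<gamma> i)"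

lemma lamp_0 [simp]: "lamp lam 0 = 1"
  by (simp add: lamp_def)

lemma lamp_add: "(\<And>i. lam i \<noteq> 0) \<Longrightarrow> lamp lam (\<gamma> + \<delta>) = lamp lam \<gamma> * lamp lam \<delta>"
  by (simp add: lamp_def lookup_add power_int_add prod.distrib)

lemma lamp_single: "lamp lam (single i c) = lam i powi c"
proof -
  have "(\<Prod>j\<in>UNIV. lam j powi lookup (single i c) j) =
      (\<Prod>j\<in>UNIV. if j = i then lam j powi c else 1)"
    by (intro prod.cong) (auto simp: lookup_single when_def)
  then show ?thesis by (simp add: lamp_def)
qed

text \<open>The shifts of exponents that \<open>X\<close> can produce, over all monomials.
  Finiteness of this set lets \<open>X\<close> act on series infinite in all directions, since each
  coefficient of the result is then a finite sum.\<close>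

definition disp :: "('m laurent \<Rightarrow> 'm laurent) \<Rightarrow> ('m \<Rightarrow>\<^sub>0 int) set" where
  "disp X = {\<gamma>. \<exists>\<delta>. lookup (X (tpow \<delta>)) (\<delta> + \<gamma>) \<noteq> 0}"

text \<open>Sending \<open>f\<close> to the formal series \<open>\<Sum>\<^bsub>\<beta>\<^esub> f(\<beta>) \<lambda>\<^sup>-\<^sup>\<beta> t\<^sup>\<beta>\<close> embeds \<open>\<Omega>(\<lambda>)\<close> into the formal Laurent series
  that are infinite in all directions, on which differential operators act. This determines the operator \<open>Y\<close>
  on \<open>\<Omega>(\<lambda>)\<close> corresponding to a differential operator \<open>X\<close>.\<close>

definition represents ::
  "('m::finite \<Rightarrow> complex) \<Rightarrow> ('m laurent \<Rightarrow> 'm laurent) \<Rightarrow> ('m mpoly \<Rightarrow> 'm mpoly) \<Rightarrow> bool" where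
  "represents lam X Y \<longleftrightarrow> finite (disp X) \<and>
     (\<forall>f \<beta>. ev (Y f) (zpt \<beta>) =
       (\<Sum>\<gamma>\<in>disp X. lookup (X (tpow (\<beta> - \<gamma>))) \<beta> * lamp lam \<gamma> * ev f (zpt (\<beta> - \<gamma>))))"

lemma not_in_disp: "\<gamma> \<notin> disp X \<Longrightarrow> lookup (X (tpow (\<beta> - \<gamma>))) \<beta> = 0"
  unfolding disp_def by (auto dest: spec[of _ "\<beta> - \<gamma>"])

lemma disp_sum:
  assumes "finite \<Gamma>" "disp X \<subseteq> \<Gamma>"
  shows "(\<Sum>\<gamma>\<in>disp X. lookup (X (tpow (\<beta> - \<gamma>))) \<beta> * g \<gamma> * h \<gamma>) =
    (\<Sum>\<gamma>\<in>\<Gamma>. lookup (X (tpow (\<beta> - \<gamma>))) \<beta> * g \<gamma> * h \<gamma>)"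
  by (rule sum.mono_neutral_left) (use assms not_in_disp in auto)

lemma representsI:
  assumes "finite \<Gamma>" "\<And>\<gamma> \<delta>. lookup (X (tpow \<delta>)) (\<delta> + \<gamma>) \<noteq> 0 \<Longrightarrow> \<gamma> \<in> \<Gamma>"
    and "\<And>f \<beta>. ev (Y f) (zpt \<beta>) =
       (\<Sum>\<gamma>\<in>\<Gamma>. lookup (X (tpow (\<beta> - \<gamma>))) \<beta> * lamp lam \<gamma> * ev f (zpt (\<beta> - \<gamma>)))"
  shows "represents lam X Y"
proof -
  have "disp X \<subseteq> \<Gamma>" using assms(2) by (auto simp: disp_def)
  then show ?thesis
    unfolding represents_def using assms(1,3) disp_sum[OF assms(1), of X, where g="lamp lam"]
    by (auto intro: finite_subset)
qed

lemma represents_sum: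
  assumes "represents lam X Y" "finite \<Gamma>" "disp X \<subseteq> \<Gamma>"
  shows "ev (Y f) (zpt \<beta>) =
       (\<Sum>\<gamma>\<in>\<Gamma>. lookup (X (tpow (\<beta> - \<gamma>))) \<beta> * lamp lam \<gamma> * ev f (zpt (\<beta> - \<gamma>)))"
  using assms(1) disp_sum[OF assms(2,3), of \<beta> "lamp lam" "\<lambda>\<gamma>. ev f (zpt (\<beta> - \<gamma>))"]
  by (simp add: represents_def)

text \<open>Values at integer points determine a polynomial, so the formal series leave no choice
  for the operator.\<close>

lemma represents_unique:
  assumes "represents lam X Y" "represents lam X Y'" shows "Y = Y'"
  using assms by (intro ext mpoly_eqI) (simp add: represents_def)

lemma represents_add:
  assumes "represents lam X Y" "represents lam X' Y'"
  shows "represents lam (\<lambda>p. X p + X' p) (\<lambda>f. Y f + Y' f)"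
proof (rule representsI)
  let ?\<Gamma> = "disp X \<union> disp X'"
  show fin: "finite ?\<Gamma>" using assms by (simp add: represents_def)
  show "\<gamma> \<in> ?\<Gamma>" if "lookup (X (tpow \<delta>) + X' (tpow \<delta>)) (\<delta> + \<gamma>) \<noteq> 0" for \<gamma> \<delta>
  proof -
    have "lookup (X (tpow \<delta>)) (\<delta> + \<gamma>) \<noteq> 0 \<or> lookup (X' (tpow \<delta>)) (\<delta> + \<gamma>) \<noteq> 0"
      using that by (auto simp: lookup_add)
    then show ?thesis by (auto simp: disp_def)
  qed
  show "ev (Y f + Y' f) (zpt \<beta>) = (\<Sum>\<gamma>\<in>?\<Gamma>. lookup (X (tpow (\<beta> - \<gamma>)) + X' (tpow (\<beta> - \<gamma>))) \<beta> *
      lamp lam \<gamma> * ev f (zpt (\<beta> - \<gamma>)))" for f \<beta>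
    by (simp add: represents_sum[OF assms(1) fin] represents_sum[OF assms(2) fin] lookup_add distrib_right sum.distrib)
qed

text \<open>\<open>X\<close> as an infinite matrix: only columns at a displacement from
  \<open>disp X\<close> meet row \<open>\<beta>\<close>, so the sum over the support of
  \<open>q\<close> may be traded for a sum over displacements.\<close>

lemma lookup_linear_disp:
  assumes lin: "Vector_Spaces.linear cscale cscale X" and fin: "finite (disp X)"
  shows "lookup (X q) \<beta> =
    (\<Sum>\<gamma>\<in>disp X. lookup (X (tpow (\<beta> - \<gamma>))) \<beta> * lookup q (\<beta> - \<gamma>))"
proof -
  let ?g = "\<lambda>\<epsilon>. lookup q \<epsilon> * lookup (X (tpow \<epsilon>)) \<beta>"
  let ?D = "(\<lambda>\<gamma>. \<beta> - \<gamma>) ` disp X"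
  have "lookup (X q) \<beta> = (\<Sum>\<epsilon>\<in>keys q. ?g \<epsilon>)"
    by (subst linear_eq_lext[OF lin]) (simp add: lext_def lookup_sum tpow_def)
  also have "\<dots> = (\<Sum>\<epsilon>\<in>keys q \<union> ?D. ?g \<epsilon>)"
    by (rule sum.mono_neutral_left) (auto simp: fin in_keys_iff)
  also have "\<dots> = (\<Sum>\<epsilon>\<in>?D. ?g \<epsilon>)"
  proof (rule sum.mono_neutral_right)
    have "lookup (X (tpow \<epsilon>)) \<beta> = 0" if "\<epsilon> \<notin> ?D" for \<epsilon>
    proof -
      have "\<beta> - \<epsilon> \<notin> disp X" using that by (force intro: image_eqI[of _ _ "\<beta> - \<epsilon>"])
      from not_in_disp[OF this, of \<beta>] show ?thesis by simp
    qed
    then show "\<forall>\<epsilon>\<in>(keys q \<union> ?D) - ?D. ?g \<epsilon> = 0" by auto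
  qed (auto simp: fin)
  also have "\<dots> = (\<Sum>\<gamma>\<in>disp X. ?g (\<beta> - \<gamma>))"
    by (subst sum.reindex) (auto simp: inj_on_def)
  finally show ?thesis by (simp add: mult.commute)
qed

text \<open>Composition is multiplication of the two matrices. Displacements add, and
  \<open>lamp\<close> turns their sum into a product because the \<lambda>_i are nonzero.\<close>

lemma represents_comp:
  assumes lam: "\<And>i. lam i \<noteq> 0" and X: "represents lam X Y" and X': "represents lam X' Y'"
    and lin: "Vector_Spaces.linear cscale cscale X"
  shows "represents lam (X \<circ> X') (Y \<circ> Y')"
proof (rule representsI)
  let ?\<Gamma> = "(\<lambda>(\<gamma>, \<gamma>'). \<gamma> + \<gamma>') ` (disp X \<times> disp X')"
  have fin: "finite (disp X)" "finite (disp X')" using X X' by (simp_all add: represents_def)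
  show fin\<Gamma>: "finite ?\<Gamma>" using fin by simp
  \<comment> \<open>A nonzero entry of the product has a nonzero summand; its intermediate index
    splits \<open>\<gamma>\<close> into a displacement of \<open>X\<close> and one of
    \<open>X'\<close>.\<close>
  show "\<gamma> \<in> ?\<Gamma>" if nz: "lookup ((X \<circ> X') (tpow \<delta>)) (\<delta> + \<gamma>) \<noteq> 0" for \<gamma> \<delta>
  proof -
    have "(\<Sum>\<eta>\<in>disp X. lookup (X (tpow (\<delta> + \<gamma> - \<eta>))) (\<delta> + \<gamma>) *
        lookup (X' (tpow \<delta>)) (\<delta> + \<gamma> - \<eta>)) \<noteq> 0"
      using nz lookup_linear_disp[OF lin fin(1), of "X' (tpow \<delta>)" "\<delta> + \<gamma>"] by simp
    then have "\<exists>\<eta>\<in>disp X. lookup (X (tpow (\<delta> + \<gamma> - \<eta>))) (\<delta> + \<gamma>) *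
        lookup (X' (tpow \<delta>)) (\<delta> + \<gamma> - \<eta>) \<noteq> 0"
      by (rule contrapos_np) (simp add: sum.neutral)
    then have "\<exists>\<eta>\<in>disp X. lookup (X' (tpow \<delta>)) (\<delta> + \<gamma> - \<eta>) \<noteq> 0"
      by (metis mult_zero_right)
    then obtain \<eta> where \<eta>: "\<eta> \<in> disp X" "lookup (X' (tpow \<delta>)) (\<delta> + \<gamma> - \<eta>) \<noteq> 0" by blast
    have "\<gamma> - \<eta> \<in> disp X'" unfolding disp_def using \<eta>(2) by (auto simp: add_diff_eq intro!: exI[of _ \<delta>])
    then show ?thesis using \<eta>(1) by (intro image_eqI[of _ _ "(\<eta>, \<gamma> - \<eta>)"]) auto
  qed
  fix f \<beta>
  let ?x = "\<lambda>\<gamma>. lookup (X (tpow (\<beta> - \<gamma>))) \<beta>"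
  let ?y = "\<lambda>\<gamma> \<epsilon>. lookup (X' (tpow \<epsilon>)) (\<beta> - \<gamma>)"
  \<comment> \<open>The inner sum is indexed by the total displacement, so that it runs over the set
    \<open>?\<Gamma>\<close>, which is independent of \<open>\<gamma>\<close>, and the two sums can
    be exchanged.\<close>
  have inner: "lamp lam \<gamma> * ev (Y' f) (zpt (\<beta> - \<gamma>)) =
      (\<Sum>\<eta>\<in>?\<Gamma>. ?y \<gamma> (\<beta> - \<eta>) * lamp lam \<eta> * ev f (zpt (\<beta> - \<eta>)))" if \<gamma>: "\<gamma> \<in> disp X" for \<gamma>
  proof -
    have "lamp lam \<gamma> * ev (Y' f) (zpt (\<beta> - \<gamma>)) =
        (\<Sum>\<gamma>'\<in>disp X'. ?y \<gamma> (\<beta> - (\<gamma> + \<gamma>')) * lamp lam (\<gamma> + \<gamma>') * ev f (zpt (\<beta> - (\<gamma> + \<gamma>'))))"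
      unfolding represents_sum[OF X' fin(2) subset_refl] sum_distrib_left
      by (intro sum.cong refl) (simp only: diff_diff_add lamp_add[OF lam] mult_ac)
    also have "\<dots> = (\<Sum>\<eta>\<in>(+) \<gamma> ` disp X'. ?y \<gamma> (\<beta> - \<eta>) * lamp lam \<eta> * ev f (zpt (\<beta> - \<eta>)))"
      by (subst sum.reindex) auto
    also have "\<dots> = (\<Sum>\<eta>\<in>?\<Gamma>. ?y \<gamma> (\<beta> - \<eta>) * lamp lam \<eta> * ev f (zpt (\<beta> - \<eta>)))"
    proof (rule sum.mono_neutral_left[OF fin\<Gamma>])
      show "(+) \<gamma> ` disp X' \<subseteq> ?\<Gamma>" using \<gamma> by force
      have "?y \<gamma> (\<beta> - \<eta>) = 0" if "\<eta> \<notin> (+) \<gamma> ` disp X'" for \<eta>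
      proof -
        have "\<eta> - \<gamma> \<notin> disp X'" using that by (force intro: image_eqI[of _ _ "\<eta> - \<gamma>"])
        from not_in_disp[OF this, of "\<beta> - \<gamma>"] show ?thesis by simp
      qed
      then show "\<forall>\<eta>\<in>?\<Gamma> - (+) \<gamma> ` disp X'. ?y \<gamma> (\<beta> - \<eta>) * lamp lam \<eta> * ev f (zpt (\<beta> - \<eta>)) = 0" by simp
    qed
    finally show ?thesis .
  qed
  have "ev ((Y \<circ> Y') f) (zpt \<beta>) = (\<Sum>\<gamma>\<in>disp X. ?x \<gamma> * (lamp lam \<gamma> * ev (Y' f) (zpt (\<beta> - \<gamma>))))"
    by (simp add: represents_sum[OF X fin(1) subset_refl] mult.assoc)
  also have "\<dots> = (\<Sum>\<gamma>\<in>disp X. \<Sum>\<eta>\<in>?\<Gamma>. ?x \<gamma> * (?y \<gamma> (\<beta> - \<eta>) * lamp lam \<eta> * ev f (zpt (\<beta> - \<eta>))))"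
    by (intro sum.cong refl) (simp only: inner sum_distrib_left)
  also have "\<dots> = (\<Sum>\<eta>\<in>?\<Gamma>. \<Sum>\<gamma>\<in>disp X. ?x \<gamma> * (?y \<gamma> (\<beta> - \<eta>) * lamp lam \<eta> * ev f (zpt (\<beta> - \<eta>))))"
    by (rule sum.swap)
  also have "\<dots> = (\<Sum>\<eta>\<in>?\<Gamma>. lookup ((X \<circ> X') (tpow (\<beta> - \<eta>))) \<beta> * lamp lam \<eta> * ev f (zpt (\<beta> - \<eta>)))"
    by (intro sum.cong refl)
      (simp only: comp_apply lookup_linear_disp[OF lin fin(1), of "X' _" \<beta>] sum_distrib_right mult.assoc)
  finally show "ev ((Y \<circ> Y') f) (zpt \<beta>) =
    (\<Sum>\<eta>\<in>?\<Gamma>. lookup ((X \<circ> X') (tpow (\<beta> - \<eta>))) \<beta> * lamp lam \<eta> * ev f (zpt (\<beta> - \<eta>)))" .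
qed

lemma represents_scalar: "represents lam (\<lambda>p. scalar c * p) (\<lambda>f. scalar c * f)"
  by (rule representsI[of "{0}"]) (auto simp: tpow_def mult_single lookup_single when_def split: if_splits)

text \<open>On monomials the operator is diagonal with eigenvalue \<beta>_i, the value of
  \<open>xvar i\<close> at \<beta>.\<close>

lemma represents_theta: "represents lam (\<lambda>p. tvar i * pd i p) (\<lambda>f. xvar i * f)"
proof (rule representsI[of "{0}"])
  have *: "tvar i * pd i (tpow \<delta>) = single \<delta> (of_int (lookup \<delta> i))" for \<delta>
    by (simp add: tvar_def tpow_def pd_single mult_single)
  show "\<gamma> \<in> {0}" if "lookup (tvar i * pd i (tpow \<delta>)) (\<delta> + \<gamma>) \<noteq> 0" for \<gamma> \<delta>
    using that by (auto simp: * lookup_single when_def split: if_splits)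
  show "ev (xvar i * f) (zpt \<beta>) = (\<Sum>\<gamma>\<in>{0}. lookup (tvar i * pd i (tpow (\<beta> - \<gamma>))) \<beta> *
      lamp lam \<gamma> * ev f (zpt (\<beta> - \<gamma>)))" for f \<beta>
    by (simp add: *)
qed simp

text \<open>Multiplication by a monomial has one displacement. The weight \<lambda>^(-\<beta>) in
  the series produces the power of \<lambda>_i, and the translation of exponents produces the shift
  in \<open>f\<close>.\<close>

lemma represents_tpow_single:
  "represents lam (\<lambda>p. tpow (single i c) * p) (\<lambda>f. scalar (lam i powi c) * shift i (- of_int c) f)"
proof (rule representsI[of "{single i c}"])
  have *: "tpow (single i c) * tpow \<delta> = single (single i c + \<delta>) 1" for \<delta>
    by (simp add: tpow_def mult_single)
  show "\<gamma> \<in> {single i c}"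
    if "lookup (tpow (single i c) * tpow \<delta>) (\<delta> + \<gamma>) \<noteq> 0" for \<gamma> \<delta>
    using that by (auto simp: * lookup_single when_def add.commute split: if_splits)
  have "(zpt \<beta>)(i := zpt \<beta> i + - of_int c) = zpt (\<beta> - single i c)" for \<beta>
    by (auto simp: fun_eq_iff lookup_minus lookup_single when_def)
  then show "ev (scalar (lam i powi c) * shift i (- of_int c) f) (zpt \<beta>) =
      (\<Sum>\<gamma>\<in>{single i c}. lookup (tpow (single i c) * tpow (\<beta> - \<gamma>)) \<beta> *
      lamp lam \<gamma> * ev f (zpt (\<beta> - \<gamma>)))" for f \<beta>
    by (simp add: * lamp_single)
qed simp

lemma represents_tvar: "represents lam (\<lambda>p. tvar i * p) (\<lambda>f. scalar (lam i) * shift i (-1) f)"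
  using represents_tpow_single[of lam i 1] by (simp add: tvar_def)

lemma represents_tvar_inv:
  "represents lam (\<lambda>p. tvar_inv i * p) (\<lambda>f. scalar (inverse (lam i)) * shift i 1 f)"
  using represents_tpow_single[of lam i "-1"] by (simp add: tvar_inv_def power_int_minus)

lemma represents_exists:
  assumes lam: "\<And>i. lam i \<noteq> 0" and "X \<in> weyl_algebra"
  shows "\<exists>Y. represents lam X Y"
  using assms(2)
proof (induction rule: weyl_induct)
  case (comp X Y)
  then obtain Y1 Y2 where "represents lam X Y1" "represents lam Y Y2" by blast
  from represents_comp[OF lam this linear_weyl[OF comp(1)]] show ?case by blast
qed (use represents_scalar represents_tvar represents_tvar_inv represents_theta represents_add in blast)+

definition omega_op :: "('m::finite \<Rightarrow> complex) \<Rightarrow> ('m laurent \<Rightarrow> 'm laurent) \<Rightarrow> 'm mpoly \<Rightarrow> 'm mpoly" where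
  "omega_op lam = (\<lambda>X\<in>weyl_algebra. THE Y. represents lam X Y)"

lemma omega_op_eq: "\<lbrakk>X \<in> weyl_algebra; represents lam X Y\<rbrakk> \<Longrightarrow> omega_op lam X = Y"
  unfolding omega_op_def by (auto intro: represents_unique)

lemma represents_omega_op:
  assumes "\<And>i. lam i \<noteq> 0" "X \<in> weyl_algebra" shows "represents lam X (omega_op lam X)"
  using represents_exists[of lam X] omega_op_eq[of X lam] assms by metis

lemma free_space_UNIV_simps [simp]:
  "carrier (free_space UNIV) = UNIV" "add (free_space UNIV) = (+)" "smult (free_space UNIV) = cscale"
  "zero (free_space UNIV) = 0"
  by (simp_all add: free_space_def)

lemma linear_op_free_space:
  "linear_op (free_space UNIV) f \<longleftrightarrow> (\<forall>v w. f (v + w) = f v + f w) \<and> (\<forall>c v. f (cscale c v) = cscale c (f v))"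
  by (simp add: linear_op_def)

lemma weyl_module_omega_op:
  fixes lam :: "'m::finite \<Rightarrow> complex"
  assumes lam: "\<And>i. lam i \<noteq> 0"
  shows "weyl_module (make_rep (free_space UNIV) (omega_op lam))"
  unfolding weyl_module_def linear_op_make_rep make_rep_simps linear_op_free_space free_space_UNIV_simps
proof (intro conjI ballI allI)
  show "Module.module complex_field (make_rep (free_space (UNIV :: ('m \<Rightarrow>\<^sub>0 nat) set)) (omega_op lam))"
    by (rule cspace.module[OF cspace.make_rep[OF cspace_free_space]])
next
  fix X :: "'m laurent \<Rightarrow> 'm laurent" and f g c assume X: "X \<in> weyl_algebra"
  note R = represents_omega_op[OF lam X, unfolded represents_def, THEN conjunct2, rule_format]
  show "omega_op lam X (f + g) = omega_op lam X f + omega_op lam X g"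
    by (rule mpoly_eqI) (simp add: R distrib_left sum.distrib)
  show "omega_op lam X (cscale c f) = cscale c (omega_op lam X f)"
    by (rule mpoly_eqI) (simp add: R sum_distrib_left mult_ac)
next
  fix X Y :: "'m laurent \<Rightarrow> 'm laurent" and f assume X: "X \<in> weyl_algebra" and Y: "Y \<in> weyl_algebra"
  show "omega_op lam (\<lambda>p. X p + Y p) f = omega_op lam X f + omega_op lam Y f"
    using omega_op_eq[OF weyl_algebra.add[OF X Y] represents_add[OF represents_omega_op[OF lam X] represents_omega_op[OF lam Y]]]
    by simp
  show "omega_op lam (X \<circ> Y) f = omega_op lam X (omega_op lam Y f)"
    using omega_op_eq[OF weyl_algebra.comp[OF X Y] represents_comp[OF lam represents_omega_op[OF lam X]
          represents_omega_op[OF lam Y] linear_weyl[OF X]]]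
    by simp
next
  fix c and f :: "'m mpoly"
  show "omega_op lam (\<lambda>p. scalar c * p) f = cscale c f"
    using omega_op_eq[OF weyl_algebra.mult represents_scalar[of lam c]] by (simp add: scalar_times)
qed

text \<open>Any action as described represents, by induction over the generators, the same operators
  as \<open>omega_op\<close>; outside \<open>weyl_algebra\<close> extensionality fixes the
  values.\<close>

lemma Omega_act_eq:
  fixes lam :: "'m::finite \<Rightarrow> complex"
  assumes lam: "\<And>i. lam i \<noteq> 0"
  shows "Omega_act lam = omega_op lam"
  unfolding Omega_act_def
proof (rule the_equality)
  show "omega_op lam \<in> extensional weyl_algebra \<and> weyl_module (make_rep (free_space UNIV) (omega_op lam)) \<and>
     (\<forall>i f. omega_op lam (\<lambda>p. tvar i * p) f = scalar (lam i) * shift i (-1) f) \<and>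
     (\<forall>i f. omega_op lam (\<lambda>p. tvar_inv i * p) f = scalar (inverse (lam i)) * shift i 1 f) \<and>
     (\<forall>i f. omega_op lam (\<lambda>p. tvar i * pd i p) f = xvar i * f)"
    using weyl_module_omega_op[OF lam] omega_op_eq[OF weyl_algebra.mult represents_tvar[of lam]]
      omega_op_eq[OF weyl_algebra.mult represents_tvar_inv[of lam]] omega_op_eq[OF weyl_theta represents_theta[of lam]]
    by (simp add: omega_op_def)
next
  fix \<rho> assume \<rho>: "\<rho> \<in> extensional weyl_algebra \<and> weyl_module (make_rep (free_space UNIV) \<rho>) \<and>
     (\<forall>i f. \<rho> (\<lambda>p. tvar i * p) f = scalar (lam i) * shift i (-1) f) \<and>
     (\<forall>i f. \<rho> (\<lambda>p. tvar_inv i * p) f = scalar (inverse (lam i)) * shift i 1 f) \<and>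
     (\<forall>i f. \<rho> (\<lambda>p. tvar i * pd i p) f = xvar i * f)"
  have "represents lam X (\<rho> X)" if "X \<in> weyl_algebra" for X
    using that
  proof (induction rule: weyl_induct)
    case (scalar c)
    have "\<rho> (\<lambda>p. scalar c * p) = (\<lambda>f. scalar c * f)"
      using \<rho> by (simp add: weyl_module_def fun_eq_iff scalar_times)
    then show ?case using represents_scalar by metis
  next
    case (tvar i)
    then show ?case using \<rho> represents_tvar[of lam i] by (metis (no_types, lifting) ext)
  next
    case (tvar_inv i)
    then show ?case using \<rho> represents_tvar_inv[of lam i] by (metis (no_types, lifting) ext)
  next
    case (theta i)
    then show ?case using \<rho> represents_theta[of lam i] by (metis (no_types, lifting) ext)
  next
    case (add X Y)
    have "\<rho> (\<lambda>p. X p + Y p) = (\<lambda>f. \<rho> X f + \<rho> Y f)"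
      using \<rho> add by (simp add: weyl_module_def fun_eq_iff)
    then show ?case using represents_add[OF add(3,4)] by simp
  next
    case (comp X Y)
    have "\<rho> (X \<circ> Y) = \<rho> X \<circ> \<rho> Y"
      using \<rho> comp by (simp add: weyl_module_def fun_eq_iff)
    then show ?case using represents_comp[OF lam comp(3,4) linear_weyl[OF comp(1)]] by metis
  qed
  then have "\<rho> X = omega_op lam X" if "X \<in> weyl_algebra" for X
    using omega_op_eq[OF that] that by metis
  then show "\<rho> = omega_op lam"
    using \<rho> by (intro extensionalityI[of _ weyl_algebra]) (auto simp: omega_op_def)
qed

section \<open>The tensor modules\<close>

abbreviation sum_UNIV :: "('i \<Rightarrow> 'a::comm_monoid_add) \<Rightarrow> 'a" (binder "\<^bold>\<Sum>" 10) where
  "sum_UNIV f \<equiv> sum f UNIV"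

lemma pd_tvar: "pd s (tvar k) = (if s = k then 1 else 0)"
  by (simp add: tvar_def tpow_def pd_single lookup_single)

lemma pd_1 [simp]: "pd s 1 = 0"
  using pd_single[of s 0 1] by simp

lemma (in cspace) linear_op_add:
  "\<lbrakk>linear_op M f; linear_op M g\<rbrakk> \<Longrightarrow> linear_op M (\<lambda>z. f z \<oplus> g z)"
  unfolding linear_op_def by (auto intro!: j_inj simp: Pi_def algebra_simps cvs.scale_right_distrib)

lemma (in cspace) linear_op_smult: "linear_op M f \<Longrightarrow> linear_op M (\<lambda>z. c \<odot>\<^bsub>M\<^esub> f z)"
  unfolding linear_op_def by (auto intro!: j_inj simp: Pi_def cvs.scale_right_distrib mult.commute)

lemma (in cspace) linear_op_finsum:
  "(\<And>a. a \<in> A \<Longrightarrow> linear_op M (f a)) \<Longrightarrow> linear_op M (\<lambda>z. \<Oplus>a\<in>A. f a z)"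
  unfolding linear_op_def
  by (auto intro!: j_inj simp: Pi_def sum.distrib cvs.scale_sum_right)

lemma (in cspace) j_linear_op_finsum:
  assumes f: "linear_op M f" and g: "\<And>a. a \<in> A \<Longrightarrow> g a \<in> carrier M"
  shows "j (f (\<Oplus>a\<in>A. g a)) = (\<Sum>a\<in>A. j (f (g a)))"
proof -
  interpret abelian_group M by (rule abelian_group)
  have cl: "x \<in> carrier M \<Longrightarrow> f x \<in> carrier M" for x using f by (auto simp: linear_op_def)
  show ?thesis
  proof (cases "finite A")
    case True
    then show ?thesis using g
    proof (induction A)
      case (insert a A)
      then have "finsum M g A \<in> carrier M" "g a \<in> carrier M" by auto
      moreover have "finsum M g (insert a A) = g a \<oplus> finsum M g A"
        using insert by (intro finsum_insert) auto
      ultimately show ?case using insert f cl by (simp add: linear_op_def)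
    qed (simp add: linear_op_zero[OF f])
  qed (simp add: finsum_infinite linear_op_zero[OF f])
qed

lemma lie_ops_gl: "lie_ops gl"
  by unfold_locales (simp_all add: gl_def)

lemma Omega_simps [simp]:
  "carrier (Omega lam) = UNIV" "add (Omega lam) = (+)" "smult (Omega lam) = cscale"
  "zero (Omega lam) = 0" "act (Omega lam) = Omega_act lam"
  by (simp_all add: Omega_def)

lemma munit_mult: "munit a b ** munit c d = (if b = c then munit a d else (0 :: complex ^ 'n::finite ^ 'n))"
proof -
  have "(\<Sum>k\<in>UNIV. (if i = a \<and> k = b then 1 else 0) * (if k = c \<and> j = d then 1 else 0)) =
      (if b = c \<and> i = a \<and> j = d then 1 else (0::complex))" for i j
  proof -
    have "(\<Sum>k\<in>UNIV. (if i = a \<and> k = b then 1 else 0) * (if k = c \<and> j = d then 1 else 0)) =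
      (\<Sum>k\<in>UNIV. if k = b then (if b = c \<and> i = a \<and> j = d then 1 else (0::complex)) else 0)"
      by (intro sum.cong) auto
    then show ?thesis by simp
  qed
  then show ?thesis
    by (simp add: matrix_matrix_mult_def munit_def vec_eq_iff)
qed

section \<open>Vector fields on Omega and the Witt action on tensors\<close>

locale tensor_module_setup =
  fixes lam :: "'m::finite \<Rightarrow> complex" and W :: "(complex ^ 'm ^ 'm, 'w) rep"
    and jW :: "'w \<Rightarrow> ('k \<Rightarrow>\<^sub>0 complex)"
  assumes lam: "\<And>i. lam i \<noteq> 0" and cspace_W: "cspace W jW" and lie_module_W: "lie_module gl W"
begin

sublocale W: lie_rep gl W jW
  by (intro lie_rep.intro lie_ops_gl cspace_W lie_rep_axioms.intro lie_module_W)

sublocale tensor_product "UNIV :: complex set" "\<lambda>m c. cscale c m" "\<lambda>c n. c \<odot>\<^bsub>W\<^esub> n"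
  "Omega lam" W "\<lambda>p. p" jW
proof (intro tensor_product.intro cspace_W tensor_product_axioms.intro)
  show "cspace (Omega lam) (\<lambda>p. p)"
    unfolding Omega_def by (rule cspace.make_rep[OF cspace_free_space])
qed auto

abbreviation \<rho> where "\<rho> \<equiv> Omega_act lam"

lemma
  shows \<rho>_add: "\<lbrakk>D \<in> weyl_algebra; D' \<in> weyl_algebra\<rbrakk> \<Longrightarrow> \<rho> (\<lambda>p. D p + D' p) f = \<rho> D f + \<rho> D' f"
    and \<rho>_comp: "\<lbrakk>D \<in> weyl_algebra; D' \<in> weyl_algebra\<rbrakk> \<Longrightarrow> \<rho> (D \<circ> D') f = \<rho> D (\<rho> D' f)"
    and \<rho>_scalar: "\<rho> (\<lambda>p. scalar c * p) f = cscale c f"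
    and \<rho>_add_right: "D \<in> weyl_algebra \<Longrightarrow> \<rho> D (f + g) = \<rho> D f + \<rho> D g"
    and \<rho>_cscale_right: "D \<in> weyl_algebra \<Longrightarrow> \<rho> D (cscale c f) = cscale c (\<rho> D f)"
  using weyl_module_omega_op[of lam, OF lam]
  unfolding weyl_module_def linear_op_make_rep make_rep_simps linear_op_free_space free_space_UNIV_simps
    Omega_act_eq[of lam, OF lam] by auto

lemma \<rho>_tvar: "\<rho> (\<lambda>p. tvar i * p) f = cscale (lam i) (shift i (-1) f)"
  and \<rho>_tvar_inv: "\<rho> (\<lambda>p. tvar_inv i * p) f = cscale (inverse (lam i)) (shift i 1 f)"
  and \<rho>_theta: "\<rho> (\<lambda>p. tvar i * pd i p) f = xvar i * f"
  unfolding Omega_act_eq[of lam, OF lam] omega_op_eq[OF weyl_algebra.mult represents_tvar]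
    omega_op_eq[OF weyl_algebra.mult represents_tvar_inv] omega_op_eq[OF weyl_theta represents_theta]
  by (simp_all add: scalar_times)

definition mul :: "'m laurent \<Rightarrow> 'm mpoly \<Rightarrow> 'm mpoly" where
  "mul q = \<rho> (\<lambda>p. q * p)"

definition dd :: "'m \<Rightarrow> 'm mpoly \<Rightarrow> 'm mpoly" where
  "dd i = \<rho> (pd i)"

lemma mul_add_right [simp]: "mul q (f + g) = mul q f + mul q g"
  and mul_cscale_right [simp]: "mul q (cscale c f) = cscale c (mul q f)"
  and dd_add [simp]: "dd i (f + g) = dd i f + dd i g"
  and dd_cscale [simp]: "dd i (cscale c f) = cscale c (dd i f)"
  by (simp_all add: mul_def dd_def \<rho>_add_right \<rho>_cscale_right weyl_algebra.mult weyl_algebra.pd)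

lemma mul_scalar [simp]: "mul (scalar c) f = cscale c f"
  by (simp add: mul_def \<rho>_scalar)

lemma mul_one [simp]: "mul 1 f = f"
  using mul_scalar[of 1 f] by simp

lemma mul_zero_left [simp]: "mul 0 f = 0"
  using mul_scalar[of 0 f] by simp

lemma mul_add [simp]: "mul (p + q) f = mul p f + mul q f"
  using \<rho>_add[OF weyl_algebra.mult weyl_algebra.mult, of p q f] by (simp add: mul_def distrib_right)

lemma mul_mult: "mul (p * q) f = mul p (mul q f)"
  using \<rho>_comp[OF weyl_algebra.mult weyl_algebra.mult, of p q f] by (simp add: mul_def o_def mult.assoc)

lemma mul_commute: "mul p (mul q f) = mul q (mul p f)"
  by (simp add: mul_mult[symmetric] mult.commute)

lemma mul_cscale [simp]: "mul (cscale c p) f = cscale c (mul p f)"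
  by (simp add: scalar_times[symmetric] mul_mult)

lemma mul_diff [simp]: "mul (p - q) f = mul p f - mul q f"
  using mul_add[of "p - q" q f] by (simp add: algebra_simps)

lemma mul_0_right [simp]: "mul q 0 = 0"
  using mul_cscale_right[of q 0 0] by simp

lemma dd_0 [simp]: "dd i 0 = 0"
  using dd_cscale[of i 0 0] by simp

lemma mul_sum [simp]: "mul (sum q A) f = (\<Sum>a\<in>A. mul (q a) f)"
  by (induction A rule: infinite_finite_induct) simp_all

lemma mul_sum_right [simp]: "mul q (sum f A) = (\<Sum>a\<in>A. mul q (f a))"
  by (induction A rule: infinite_finite_induct) simp_all

lemma dd_sum [simp]: "dd i (sum f A) = (\<Sum>a\<in>A. dd i (f a))"
  by (induction A rule: infinite_finite_induct) simp_all

lemma dd_mul: "dd i (mul q f) = mul (pd i q) f + mul q (dd i f)"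
proof -
  have "dd i (mul q f) = \<rho> (pd i \<circ> (\<lambda>p. q * p)) f"
    by (simp add: dd_def mul_def \<rho>_comp weyl_algebra.intros)
  also have "pd i \<circ> (\<lambda>p. q * p) = (\<lambda>p. pd i q * p + ((\<lambda>p. q * p) \<circ> pd i) p)"
    by (simp add: fun_eq_iff pd_mult)
  also have "\<rho> \<dots> f = mul (pd i q) f + mul q (dd i f)"
    by (simp only: \<rho>_add \<rho>_comp weyl_algebra.intros mul_def dd_def)
  finally show ?thesis .
qed

lemma dd_commute: "dd i (dd k f) = dd k (dd i f)"
proof -
  have "pd i \<circ> pd k = pd k \<circ> (pd i :: 'm laurent \<Rightarrow> 'm laurent)"
    by (simp add: fun_eq_iff pd_commute[of i k])
  then show ?thesis
    by (simp add: dd_def \<rho>_comp[OF weyl_algebra.pd weyl_algebra.pd, symmetric])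
qed

lemma mul_tvar_1: "mul (tvar i) 1 = cscale (lam i) 1"
proof -
  have "shift i (-1) 1 = (1 :: 'm mpoly)" by (rule mpoly_eqI) simp
  then show ?thesis by (simp add: mul_def \<rho>_tvar)
qed

text \<open>The derivative is \<open>tvar_inv i\<close> after \<open>tvar i * pd i\<close>, so
  multiplication by x_i comes before the shift.\<close>

lemma dd_eq: "dd i f = cscale (inverse (lam i)) (shift i 1 (xvar i * f))"
proof -
  have "dd i f = \<rho> ((\<lambda>p. tvar_inv i * p) \<circ> (\<lambda>p. tvar i * pd i p)) f"
    by (simp add: dd_def o_def)
  then show ?thesis
    by (simp only: \<rho>_comp weyl_algebra.mult weyl_theta \<rho>_theta \<rho>_tvar_inv)
qed

text \<open>\<open>vf a\<close> and \<open>der a\<close> are one vector field, acting on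
  \<open>Omega\<close> and on Laurent polynomials; \<open>vf_mul\<close> is the Leibniz rule linking
  the two actions.\<close>

definition vf :: "('m \<Rightarrow> 'm laurent) \<Rightarrow> 'm mpoly \<Rightarrow> 'm mpoly" where
  "vf a f = (\<Sum>k\<in>UNIV. mul (a k) (dd k f))"

definition der :: "('m \<Rightarrow> 'm laurent) \<Rightarrow> 'm laurent \<Rightarrow> 'm laurent" where
  "der a q = (\<Sum>k\<in>UNIV. a k * pd k q)"

lemma vf_sum_right [simp]: "vf a (sum f A) = (\<Sum>x\<in>A. vf a (f x))"
  unfolding vf_def by (simp add: sum.swap[of _ A])

lemma vf_mul: "vf a (mul q f) = mul (der a q) f + mul q (vf a f)"
  by (simp add: vf_def der_def dd_mul mul_mult sum.distrib mul_commute[of q])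

text \<open>The second order terms are symmetric in \<open>a\<close> and \<open>b\<close>, because
  multiplications commute with each other and derivatives with each other; only the derivatives of
  the components survive.\<close>

lemma vf_commutator: "vf a (vf b f) - vf b (vf a f) = vf (\<lambda>k. der a (b k) - der b (a k)) f"
proof -
  have *: "vf a (vf b f) = (\<Sum>l\<in>UNIV. mul (der a (b l)) (dd l f)) +
      (\<^bold>\<Sum>l k. mul (b l) (mul (a k) (dd k (dd l f))))" for a b
    by (simp add: vf_def[of b] vf_mul sum.distrib) (simp add: vf_def)
  have "(\<^bold>\<Sum>l k. mul (b l) (mul (a k) (dd k (dd l f)))) =
      (\<^bold>\<Sum>l k. mul (a l) (mul (b k) (dd k (dd l f))))"
    by (subst sum.swap) (simp add: mul_commute[of "a _"] dd_commute)
  then show ?thesis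
    unfolding *[of a b] *[of b a] by (simp add: vf_def sum_subtractf)
qed

definition P :: "'m mpoly \<Rightarrow> 'w \<Rightarrow> ('m mpoly \<times> 'w \<Rightarrow>\<^sub>0 complex)" where
  "P f w = coset_emb K (pt f w)"

lemma
  assumes "w \<in> carrier W"
  shows P_add [simp]: "P (f + g) w = P f w + P g w"
    and P_cscale [simp]: "P (cscale c f) w = cscale c (P f w)"
    and P_add_right: "w' \<in> carrier W \<Longrightarrow> P f (w \<oplus>\<^bsub>W\<^esub> w') = P f w + P f w'"
    and P_smult_right: "P f (c \<odot>\<^bsub>W\<^esub> w) = cscale c (P f w)"
proof -
  show "P (f + g) w = P f w + P g w"
    using pt_add_left[of f g w] assms by (simp add: P_def)
  show "P (cscale c f) w = cscale c (P f w)"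
    using pt_smult_left[of f w c] assms by (simp add: P_def)
  show "P f (w \<oplus>\<^bsub>W\<^esub> w') = P f w + P f w'" if "w' \<in> carrier W"
    using pt_add_right[of f w w'] assms that by (simp add: P_def)
  show "P f (c \<odot>\<^bsub>W\<^esub> w) = cscale c (P f w)"
    using pt_smult_right[of f w c] assms by (simp add: P_def)
qed

lemma P_0 [simp]: "w \<in> carrier W \<Longrightarrow> P 0 w = 0"
  using P_cscale[of w 0 0] by simp

lemma P_diff [simp]: "w \<in> carrier W \<Longrightarrow> P (f - g) w = P f w - P g w"
  using P_add[of w "f - g" g] by (simp add: algebra_simps)

lemma P_sum [simp]: "w \<in> carrier W \<Longrightarrow> P (sum f A) w = (\<Sum>a\<in>A. P (f a) w)"
  by (induction A rule: infinite_finite_induct) simp_all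

lemma P_zero_right [simp]: "P f \<zero>\<^bsub>W\<^esub> = 0"
  using P_smult_right[of "\<zero>\<^bsub>W\<^esub>" f 0] by simp

lemma P_minus_right: "\<lbrakk>w \<in> carrier W; w' \<in> carrier W\<rbrakk> \<Longrightarrow> P f (w \<ominus>\<^bsub>W\<^esub> w') = P f w - P f w'"
proof -
  assume w: "w \<in> carrier W" "w' \<in> carrier W"
  have "w = w' \<oplus>\<^bsub>W\<^esub> (w \<ominus>\<^bsub>W\<^esub> w')" by (rule W.V.j_inj) (use w in auto)
  then have "P f w = P f w' + P f (w \<ominus>\<^bsub>W\<^esub> w')" using w P_add_right[of w' "w \<ominus>\<^bsub>W\<^esub> w'" f] by simp
  then show ?thesis by simp
qed

lemma P_finsum_right:
  assumes "\<And>a. a \<in> A \<Longrightarrow> g a \<in> carrier W"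
  shows "P f (finsum W g A) = (\<Sum>a\<in>A. P f (g a))"
proof -
  interpret abelian_group W by (rule W.V.abelian_group)
  show ?thesis
  proof (cases "finite A")
    case True
    then show ?thesis using assms
    proof (induction A)
      case (insert a A)
      have "finsum W g (insert a A) = g a \<oplus>\<^bsub>W\<^esub> finsum W g A"
        using insert by (intro finsum_insert) auto
      then show ?case using insert by (simp add: P_add_right)
    qed simp
  qed (simp add: finsum_infinite)
qed

abbreviation EE :: "'m \<Rightarrow> 'm \<Rightarrow> 'w \<Rightarrow> 'w" where
  "EE s i \<equiv> act W (munit s i)"

lemma gl_simps [simp]: "carrier gl = UNIV" "add gl = (+)" "bracket gl A B = A ** B - B ** A"
  "smult gl c = map_matrix ((*) c)"
  by (simp_all add: gl_def)

lemma EE_closed [simp, intro]: "w \<in> carrier W \<Longrightarrow> EE s i w \<in> carrier W"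
  by (rule W.act_closed) simp_all

text \<open>The relation [E_ab, E_cd] = \<delta>_bc E_ad - \<delta>_da E_cb of gl(m), put into
  coordinates so that it can be applied inside sums.\<close>

lemma P_EE_commutator:
  assumes w: "w \<in> carrier W"
  shows "P f (EE a b (EE c d w)) - P f (EE c d (EE a b w)) =
    (if b = c then P f (EE a d w) else 0) - (if d = a then P f (EE c b w) else 0)"
proof -
  have z: "act W 0 w = \<zero>\<^bsub>W\<^esub>"
    using W.act_smult_left[of 0 w 0] w by (simp add: map_matrix_def zero_vec_def vec_lambda_eta)
  have diff: "act W (A - B) w = act W A w \<ominus>\<^bsub>W\<^esub> act W B w" for A B
  proof -
    have "act W A w = act W (A - B) w \<oplus>\<^bsub>W\<^esub> act W B w"
      using W.act_add_left[of "A - B" B w] w by simp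
    then show ?thesis using w by (auto intro: W.V.j_inj)
  qed
  have "act W (bracket gl (munit a b) (munit c d)) w = EE a b (EE c d w) \<ominus>\<^bsub>W\<^esub> EE c d (EE a b w)"
    using w by (intro W.act_bracket) simp_all
  then have "P f (EE a b (EE c d w)) - P f (EE c d (EE a b w)) =
      P f (act W (munit a b ** munit c d) w) - P f (act W (munit c d ** munit a b) w)"
    using w P_minus_right[of "act W (munit a b ** munit c d) w" "act W (munit c d ** munit a b) w" f]
    by (simp add: diff P_minus_right)
  also have "\<dots> = (if b = c then P f (EE a d w) else 0) - (if d = a then P f (EE c b w) else 0)"
    by (simp add: munit_mult z)
  finally show ?thesis .
qed

abbreviation tact :: "('m laurent \<Rightarrow> 'm laurent) \<Rightarrow> ('m mpoly \<times> 'w \<Rightarrow>\<^sub>0 complex) set \<Rightarrow> ('m mpoly \<times> 'w \<Rightarrow>\<^sub>0 complex) set" where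
  "tact \<equiv> act (tensor_module (Omega lam) W)"

lemma ctensor_eq: "ctensor (Omega lam) W = T" "ctensor_op (Omega lam) W = top"
  by (simp_all add: ctensor_def ctensor_op_def)

lemma balanced:
  assumes "D \<in> weyl_algebra" "linear_op W g" shows "balanced_pair (\<rho> D) g"
  using assms by (simp add: balanced_pair_def linear_op_def \<rho>_add_right \<rho>_cscale_right)

lemma linear_op_id: "linear_op W id"
  by (simp add: linear_op_def)

lemma linear_op_EE: "linear_op W (EE s i)"
  by (simp add: linear_op_def)

lemma weyl_vf: "(\<lambda>p. q * pd i p) \<in> weyl_algebra"
  using weyl_algebra.comp[OF weyl_algebra.mult weyl_algebra.pd] by (simp add: o_def)

lemma \<rho>_vf: "\<rho> (\<lambda>p. q * pd i p) f = mul q (dd i f)"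
  using \<rho>_comp[OF weyl_algebra.mult[of q] weyl_algebra.pd[of i], of f] by (simp add: o_def mul_def dd_def)

lemma linear_basis: "linear_op T (tensor_module_basis (Omega lam) W \<alpha> i)"
  unfolding tensor_module_basis_def[abs_def] ctensor_eq Omega_simps
  by (intro T.linear_op_add T.linear_op_finsum linear_top balanced weyl_vf weyl_algebra.mult
      linear_op_id linear_op_EE)

lemma linear_tact: "linear_op T (tact D)"
  unfolding tensor_module_def make_rep_simps ctensor_eq
  by (intro T.linear_op_finsum T.linear_op_smult linear_basis)

lemma tact_closed [simp, intro]: "z \<in> carrier T \<Longrightarrow> tact D z \<in> carrier T"
  using linear_tact[of D] by (auto simp: linear_op_def)

lemma linear_P_mul: "w \<in> carrier W \<Longrightarrow> Vector_Spaces.linear cscale cscale (\<lambda>q. P (mul q f) w)"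
  "w \<in> carrier W \<Longrightarrow> Vector_Spaces.linear cscale cscale (\<lambda>q. P (mul (pd s q) f) w)"
  by (simp_all add: Vector_Spaces.linear_iff cvs.vector_space_axioms)

lemma tensor_module_basis_pt:
  assumes "w \<in> carrier W"
  shows "coset_emb K (tensor_module_basis (Omega lam) W \<alpha> i (pt f w)) =
    P (mul (tpow \<alpha>) (dd i f)) w + (\<Sum>s\<in>UNIV. P (mul (pd s (tpow \<alpha>)) f) (EE s i w))"
proof -
  have 1: "top (\<rho> (\<lambda>p. tpow \<alpha> * pd i p)) id (pt f w) = pt (mul (tpow \<alpha>) (dd i f)) w"
    by (simp add: top_pt balanced weyl_vf linear_op_id \<rho>_vf)
  have 2: "top (\<rho> (\<lambda>p. pd s (tpow \<alpha>) * p)) (EE s i) (pt f w) = pt (mul (pd s (tpow \<alpha>)) f) (EE s i w)" for s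
    by (simp add: top_pt balanced weyl_algebra.mult linear_op_EE mul_def)
  show ?thesis
    unfolding tensor_module_basis_def ctensor_eq Omega_simps 1 2 using assms by (simp add: P_def)
qed

lemma sum_keys_linear:
  assumes "Vector_Spaces.linear cscale cscale L"
  shows "(\<Sum>\<alpha>\<in>keys q. cscale (lookup q \<alpha>) (L (tpow \<alpha>))) = L q"
  using linear_eq_lext[OF assms, of q] by (simp add: lext_def tpow_def)

text \<open>The definition expands \<open>D (tvar i)\<close> into monomials. Every summand is linear
  in that Laurent polynomial, so the expansion can be undone.\<close>

lemma tact_pt:
  assumes w: "w \<in> carrier W"
  shows "coset_emb K (tact D (pt f w)) = P (vf (\<lambda>i. D (tvar i)) f) w +
    (\<^bold>\<Sum>i s. P (mul (pd s (D (tvar i))) f) (EE s i w))"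
proof -
  let ?b = "\<lambda>\<alpha> i. tensor_module_basis (Omega lam) W \<alpha> i (pt f w)"
  have b: "?b \<alpha> i \<in> carrier T" for \<alpha> i
    using linear_basis[of \<alpha> i] w by (simp add: linear_op_def Pi_iff)
  have "coset_emb K (tact D (pt f w)) =
      (\<Sum>i\<in>UNIV. \<Sum>\<alpha>\<in>keys (D (tvar i)). cscale (lookup (D (tvar i)) \<alpha>) (coset_emb K (?b \<alpha> i)))"
    unfolding tensor_module_def make_rep_simps ctensor_eq by (simp add: b)
  also have "\<dots> = (\<Sum>i\<in>UNIV. P (mul (D (tvar i)) (dd i f)) w + (\<Sum>s\<in>UNIV. P (mul (pd s (D (tvar i))) f) (EE s i w)))"
  proof (rule sum.cong[OF refl])
    fix i
    let ?q = "D (tvar i)"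
    have "(\<Sum>\<alpha>\<in>keys ?q. cscale (lookup ?q \<alpha>) (coset_emb K (?b \<alpha> i))) =
        (\<Sum>\<alpha>\<in>keys ?q. cscale (lookup ?q \<alpha>) (P (mul (tpow \<alpha>) (dd i f)) w)) +
        (\<Sum>s\<in>UNIV. \<Sum>\<alpha>\<in>keys ?q. cscale (lookup ?q \<alpha>) (P (mul (pd s (tpow \<alpha>)) f) (EE s i w)))"
      by (subst sum.swap) (simp add: tensor_module_basis_pt w cvs.scale_right_distrib cvs.scale_sum_right sum.distrib)
    then show "(\<Sum>\<alpha>\<in>keys ?q. cscale (lookup ?q \<alpha>) (coset_emb K (?b \<alpha> i))) =
        P (mul ?q (dd i f)) w + (\<Sum>s\<in>UNIV. P (mul (pd s ?q) f) (EE s i w))"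
      unfolding sum_keys_linear[OF linear_P_mul(1)[OF w]] sum_keys_linear[OF linear_P_mul(2)[OF EE_closed[OF w]]] .
  qed
  finally show ?thesis by (simp add: sum.distrib vf_def w)
qed

lemma tact_pt_eq:
  assumes w: "w \<in> carrier W"
  shows "tact D (pt f w) = pt (vf (\<lambda>i. D (tvar i)) f) w \<oplus>\<^bsub>T\<^esub>
    (\<Oplus>\<^bsub>T\<^esub>i\<in>UNIV. \<Oplus>\<^bsub>T\<^esub>s\<in>UNIV. pt (mul (pd s (D (tvar i))) f) (EE s i w))"
  by (rule T.j_inj) (use w in \<open>simp_all add: tact_pt P_def\<close>)

lemma tact_tact_pt:
  assumes w: "w \<in> carrier W" and a: "\<And>i. D (tvar i) = a i" and b: "\<And>i. D' (tvar i) = b i"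
  shows "coset_emb K (tact D (tact D' (pt f w))) = P (vf a (vf b f)) w +
    (\<^bold>\<Sum>i s. P (mul (pd s (a i)) (vf b f) + vf a (mul (pd s (b i)) f)) (EE s i w)) +
    (\<^bold>\<Sum>i s k l. P (mul (pd l (a k) * pd s (b i)) f) (EE l k (EE s i w)))"
proof -
  have split: "tact D (x \<oplus>\<^bsub>T\<^esub> y) = tact D x \<oplus>\<^bsub>T\<^esub> tact D y" if "x \<in> carrier T" "y \<in> carrier T" for x y
    using linear_tact[of D] that by (simp add: linear_op_def)
  have "coset_emb K (tact D (tact D' (pt f w))) = coset_emb K (tact D (pt (vf b f) w)) +
      (\<^bold>\<Sum>i s. coset_emb K (tact D (pt (mul (pd s (b i)) f) (EE s i w))))"
    unfolding tact_pt_eq[OF w, of D'] b using w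
    by (simp add: split T.j_linear_op_finsum[OF linear_tact])
  then show ?thesis
    using w by (simp add: tact_pt a sum.distrib mul_mult)
qed

text \<open>The action depends on an operator only through its values on the variables, so the
  bracket enters only there. Terms are matched by their degree in gl(m): fields alone, one matrix
  unit, and products of two matrix units.\<close>

lemma tact_commutator:
  assumes w: "w \<in> carrier W"
    and D3: "\<And>i. D3 (tvar i) = der (\<lambda>i. D1 (tvar i)) (D2 (tvar i)) - der (\<lambda>i. D2 (tvar i)) (D1 (tvar i))"
  shows "tact D3 (pt f w) = tact D1 (tact D2 (pt f w)) \<ominus>\<^bsub>T\<^esub> tact D2 (tact D1 (pt f w))"
proof (rule T.j_inj)
  define a b c where "a = (\<lambda>i. D1 (tvar i))" and "b = (\<lambda>i. D2 (tvar i))" and "c = (\<lambda>i. D3 (tvar i))"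
  define Q where "Q q s i = P (mul q f) (EE s i w)" for q s i
  have c: "c = (\<lambda>k. der a (b k) - der b (a k))" by (simp add: a_def b_def c_def D3 fun_eq_iff)
  have Q [simp]: "Q (p + q) s i = Q p s i + Q q s i" "Q (p - q) s i = Q p s i - Q q s i"
    "Q (sum g A) s i = (\<Sum>x\<in>A. Q (g x) s i)" for p q s i g and A :: "'m set"
    using w by (simp_all add: Q_def)
  \<comment> \<open>By the Leibniz rule the terms with \<open>vf a f\<close> and
    \<open>vf b f\<close> cancel; the derivatives of the entries of the Jacobian matrices
    remain.\<close>
  have mixed: "P (mul (pd s (a i)) (vf b f) + vf a (mul (pd s (b i)) f)) (EE s i w) -
      P (mul (pd s (b i)) (vf a f) + vf b (mul (pd s (a i)) f)) (EE s i w) =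
      Q (der a (pd s (b i)) - der b (pd s (a i))) s i" for s i
    using w by (simp add: Q_def vf_mul algebra_simps)
  let ?A = "\<lambda>i s k l. P (mul (pd l (a k) * pd s (b i)) f) (EE l k (EE s i w))"
  let ?B = "\<lambda>i s k l. P (mul (pd l (b k) * pd s (a i)) f) (EE l k (EE s i w))"
  \<comment> \<open>Exchanging the index pairs reverses the order of the two matrix units, so that
    the summands pair up to commutators in gl(m).\<close>
  have swap: "(\<^bold>\<Sum>i s k l. ?B i s k l) =
      (\<^bold>\<Sum>i s k l. ?B k l i s)"
  proof -
    have "(\<^bold>\<Sum>i s k l. g i s k l) =
      (\<^bold>\<Sum>i s k l. g k l i s)" for g :: "'m \<Rightarrow> 'm \<Rightarrow> 'm \<Rightarrow> 'm \<Rightarrow> 'm mpoly \<times> 'w \<Rightarrow>\<^sub>0 complex"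
    proof -
      have "(\<Sum>x\<in>UNIV \<times> UNIV. \<Sum>y\<in>UNIV \<times> UNIV. g (fst x) (snd x) (fst y) (snd y)) =
        (\<Sum>y\<in>UNIV \<times> UNIV. \<Sum>x\<in>UNIV \<times> UNIV. g (fst x) (snd x) (fst y) (snd y))"
        by (rule sum.swap)
      then show ?thesis
        by (simp add: sum.cartesian_product' del: UNIV_Times_UNIV)
    qed
    then show ?thesis .
  qed
  \<comment> \<open>The commutators collapse the fourfold sum to the commutator of the Jacobian
    matrices of \<open>a\<close> and \<open>b\<close>.\<close>
  have quad: "(\<^bold>\<Sum>i s k l. ?A i s k l) - (\<^bold>\<Sum>i s k l. ?B i s k l) =
      (\<^bold>\<Sum>i s. Q (\<Sum>k\<in>UNIV. pd s (a k) * pd k (b i) - pd s (b k) * pd k (a i)) s i)"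
  proof -
    have "(\<^bold>\<Sum>i s k l. ?A i s k l) - (\<^bold>\<Sum>i s k l. ?B i s k l) =
        (\<^bold>\<Sum>i s k l. ?A i s k l - ?B k l i s)"
      unfolding swap by (simp add: sum_subtractf)
    also have "\<dots> = (\<^bold>\<Sum>i s k. \<Sum>l\<in>UNIV.
        (if k = s then Q (pd l (a k) * pd s (b i)) l i else 0) - (if i = l then Q (pd l (a k) * pd s (b i)) s k else 0))"
    proof (intro sum.cong refl)
      fix i s k l
      have "?B k l i s = P (mul (pd l (a k) * pd s (b i)) f) (EE s i (EE l k w))" by (simp add: mult.commute)
      then show "?A i s k l - ?B k l i s = (if k = s then Q (pd l (a k) * pd s (b i)) l i else 0) -
          (if i = l then Q (pd l (a k) * pd s (b i)) s k else 0)"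
        by (simp add: P_EE_commutator[OF w] Q_def)
    qed
    also have "\<dots> = (\<^bold>\<Sum>i s l. Q (pd l (a s) * pd s (b i)) l i) -
        (\<^bold>\<Sum>i s k. Q (pd i (a k) * pd s (b i)) s k)"
    proof -
      have 1: "(\<^bold>\<Sum>k l. if k = s then Q (pd l (a k) * pd s (b i)) l i else 0) =
          (\<Sum>l\<in>UNIV. Q (pd l (a s) * pd s (b i)) l i)" for i s
        by (subst sum.swap) simp
      have 2: "(\<^bold>\<Sum>k l. if i = l then Q (pd l (a k) * pd s (b i)) s k else 0) =
          (\<Sum>k\<in>UNIV. Q (pd i (a k) * pd s (b i)) s k)" for i s
        by simp
      show ?thesis unfolding sum_subtractf 1 2 ..
    qed
    also have "(\<^bold>\<Sum>i s l. Q (pd l (a s) * pd s (b i)) l i) =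
        (\<^bold>\<Sum>i s k. Q (pd s (a k) * pd k (b i)) s i)"
      by (rule sum.cong[OF refl], rule sum.swap)
    also have "(\<^bold>\<Sum>i s k. Q (pd i (a k) * pd s (b i)) s k) =
        (\<^bold>\<Sum>i s k. Q (pd s (b k) * pd k (a i)) s i)"
    proof -
      have "(\<^bold>\<Sum>i s k. g i s k) = (\<^bold>\<Sum>i s k. g k s i)"
        for g :: "'m \<Rightarrow> 'm \<Rightarrow> 'm \<Rightarrow> 'm mpoly \<times> 'w \<Rightarrow>\<^sub>0 complex"
      proof -
        have "(\<^bold>\<Sum>i s k. g i s k) = (\<^bold>\<Sum>i k s. g i s k)"
          by (rule sum.cong[OF refl], rule sum.swap)
        also have "\<dots> = (\<^bold>\<Sum>k i s. g i s k)"
          by (rule sum.swap)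
        also have "\<dots> = (\<^bold>\<Sum>k s i. g i s k)"
          by (rule sum.cong[OF refl], rule sum.swap)
        finally show ?thesis .
      qed
      from this[of "\<lambda>i s k. Q (pd i (a k) * pd s (b i)) s k"] show ?thesis
        by (simp only: mult.commute)
    qed
    finally show ?thesis by (simp add: sum_subtractf)
  qed
  \<comment> \<open>Differentiating the components of the bracket yields exactly the two
    contributions found above, because partial derivatives commute.\<close>
  have pdc: "pd s (c i) = der a (pd s (b i)) - der b (pd s (a i)) +
      (\<Sum>k\<in>UNIV. pd s (a k) * pd k (b i) - pd s (b k) * pd k (a i))" for s i
    by (simp add: c der_def pd_mult sum.distrib sum_subtractf pd_commute[of s])
  have "coset_emb K (tact D1 (tact D2 (pt f w)) \<ominus>\<^bsub>T\<^esub> tact D2 (tact D1 (pt f w))) =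
      P (vf a (vf b f) - vf b (vf a f)) w +
      (\<^bold>\<Sum>i s. (P (mul (pd s (a i)) (vf b f) + vf a (mul (pd s (b i)) f)) (EE s i w) -
          P (mul (pd s (b i)) (vf a f) + vf b (mul (pd s (a i)) f)) (EE s i w))) +
      ((\<^bold>\<Sum>i s k l. ?A i s k l) - (\<^bold>\<Sum>i s k l. ?B i s k l))"
    using w tact_tact_pt[OF w, of D1 a D2 b f] tact_tact_pt[OF w, of D2 b D1 a f]
    by (simp add: a_def b_def sum_subtractf)
  also have "\<dots> = P (vf c f) w + (\<^bold>\<Sum>i s. Q (pd s (c i)) s i)"
    unfolding mixed quad vf_commutator c[symmetric] pdc by (simp add: sum.distrib)
  also have "\<dots> = coset_emb K (tact D3 (pt f w))"
    using w by (simp add: tact_pt c_def Q_def)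
  finally show "coset_emb K (tact D3 (pt f w)) = coset_emb K (tact D1 (tact D2 (pt f w)) \<ominus>\<^bsub>T\<^esub> tact D2 (tact D1 (pt f w)))" ..
qed (use w in auto)

end

section \<open>The parabolic subalgebra and the map \<open>\<sigma>\<^sub>\<lambda>\<close>\<close>

lemma sum_option: "(\<Sum>i\<in>UNIV. f i) = f None + (\<Sum>i\<in>(UNIV :: 'a::finite set). f (Some i))"
  by (simp add: UNIV_option_conv sum.reindex)

lemma scalar_eq: "scalar c = cscale c (1 :: 'a::monoid_add \<Rightarrow>\<^sub>0 complex)"
  using scalar_times[of c 1] by simp

lemma sl_simps [simp]: "carrier sl = {A. trace A = 0}" "add sl = (+)" "smult sl c = map_matrix ((*) c)"
  "bracket sl A B = A ** B - B ** A" "zero sl = 0"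
  by (simp_all add: sl_def gl_def)

lemma map_matrix_nth [simp]: "map_matrix f A $ i $ k = f (A $ i $ k)"
  by (simp add: map_matrix_def)

lemma trace_simps:
  "trace (A + B) = trace A + trace B" "trace (map_matrix ((*) c) A) = c * trace A"
  "trace (A ** B - B ** A) = 0" "trace (0 :: complex ^ 'k ^ 'k) = 0" for A B :: "complex ^ 'k::finite ^ 'k"
  by (simp_all add: trace_add trace_sub trace_mul_sym[of A B]) (simp_all add: trace_def sum_distrib_left)

lemma lie_ops_sl: "lie_ops sl"
  by unfold_locales (simp_all add: trace_simps)

text \<open>Matrices over a finite index type are finitely supported functions of the index pair, so
  the general criterion for submodules applies to \<open>sl\<close>.\<close>

lemma cspace_sl: "cspace (sl :: (complex ^ 'k::finite ^ 'k) lie_algebra)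
  (\<lambda>A. Abs_poly_mapping (\<lambda>(i, k). A $ i $ k))"
proof
  fix x y :: "complex ^ 'k ^ 'k"
  assume "Abs_poly_mapping (\<lambda>(i, k). x $ i $ k) = Abs_poly_mapping (\<lambda>(i, k). y $ i $ k)"
  then have "lookup (Abs_poly_mapping (\<lambda>(i, k). x $ i $ k)) p =
      lookup (Abs_poly_mapping (\<lambda>(i, k). y $ i $ k)) p" for p by simp
  then show "x = y" by (auto simp: vec_eq_iff)
qed (auto simp: trace_simps intro!: poly_mapping_eqI simp: lookup_add split: prod.splits)

lemmas submodule_sl = cspace.submodule_iff[OF cspace_sl]

lemma lin_span_sl:
  assumes sub: "submodule H complex_field sl" and S: "S \<subseteq> H"
    and comb: "\<And>A. A \<in> H \<Longrightarrow> \<exists>I :: 'i set. \<exists>c g. finite I \<and> g ` I \<subseteq> S \<and> A = (\<Sum>i\<in>I. map_matrix ((*) (c i)) (g i))"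
  shows "lin_span sl S = H"
proof
  show "lin_span sl S \<subseteq> H"
    unfolding lin_span_def using S sub by (rule hull_minimal)
  show "H \<subseteq> lin_span sl S"
  proof
    fix A assume "A \<in> H"
    then obtain I :: "'i set" and c g where A: "finite I" "g ` I \<subseteq> S" "A = (\<Sum>i\<in>I. map_matrix ((*) (c i)) (g i))"
      using comb by blast
    have "A \<in> H'" if "submodule H' complex_field sl" "S \<subseteq> H'" for H'
      using A(1,2) unfolding A(3)
    proof (induction I)
      case (insert i I)
      then show ?case using that by (auto simp: submodule_sl)
    qed (use that in \<open>simp add: submodule_sl\<close>)
    then show "A \<in> lin_span sl S" unfolding lin_span_def hull_def by blast
  qed
qed

lemma munit_nth: "munit a b $ i $ k = (if i = a \<and> k = b then 1 else 0)"
  by (simp add: munit_def)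

lemma trace_munit: "trace (munit a b) = (if a = b then 1 else 0)"
proof -
  have "trace (munit a b) = (\<Sum>i\<in>UNIV. if i = a then (if a = b then 1 else 0) else 0)"
    unfolding trace_def by (intro sum.cong) (auto simp: munit_nth)
  then show ?thesis by simp
qed

lemma levi_eq: "levi = {A. trace A = 0 \<and> (\<forall>i. A $ Some i $ None = 0 \<and> A $ None $ Some i = 0)}"
  unfolding levi_def
proof (rule lin_span_sl)
  let ?H = "{A :: complex ^ 'a option ^ 'a option. trace A = 0 \<and> (\<forall>i. A $ Some i $ None = 0 \<and> A $ None $ Some i = 0)}"
  let ?g = "\<lambda>(i, k). if i = k then munit (Some i) (Some i) - munit None None else munit (Some i) (Some k :: 'a option)"
  show "submodule ?H complex_field sl" by (auto simp: submodule_sl trace_simps)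
  show "{munit (Some i) (Some k) | i k. i \<noteq> k} \<union> {munit (Some i) (Some i) - munit None None | i. True} \<subseteq> ?H"
    by (auto simp: munit_nth trace_munit trace_sub)
  fix A assume A: "A \<in> ?H"
  have "trace A = A $ None $ None + (\<Sum>i\<in>UNIV. A $ Some i $ Some i)"
    by (simp add: trace_def sum_option)
  \<comment> \<open>Trace zero fixes the corner entry, so the entries of the upper left block are
    the only coefficients.\<close>
  then have NN: "A $ None $ None = - (\<Sum>i\<in>UNIV. A $ Some i $ Some i)"
    using A by (simp add: eq_neg_iff_add_eq_0)
  have "A = (\<Sum>i\<in>UNIV. map_matrix ((*) (A $ Some (fst i) $ Some (snd i))) (?g i))"
  proof -
    have entry: "A $ a $ b = (\<^bold>\<Sum>i k. A $ Some i $ Some k * ?g (i, k) $ a $ b)" for a b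
    proof (cases a; cases b)
      fix a' b' assume ab: "a = Some a'" "b = Some b'"
      have "(\<^bold>\<Sum>i k. A $ Some i $ Some k * ?g (i, k) $ a $ b) =
          (\<^bold>\<Sum>i k. if k = b' then if i = a' then A $ a $ b else 0 else 0)"
        by (intro sum.cong refl) (auto simp: munit_nth ab)
      then show ?thesis by simp
    next
      assume ab: "a = None" "b = None"
      have "(\<^bold>\<Sum>i k. A $ Some i $ Some k * ?g (i, k) $ a $ b) =
          (\<^bold>\<Sum>i k. if k = i then - A $ Some i $ Some i else 0)"
        by (intro sum.cong refl) (auto simp: munit_nth ab)
      then show ?thesis using NN by (simp add: ab sum_negf)
    next
      fix b' assume ab: "a = None" "b = Some b'"
      have "?g (i, k) $ a $ b = 0" for i k by (auto simp: munit_nth ab)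
      then show ?thesis using A ab by (simp only: mult_zero_right sum.neutral_const) simp
    next
      fix a' assume ab: "a = Some a'" "b = None"
      have "?g (i, k) $ a $ b = 0" for i k by (auto simp: munit_nth ab)
      then show ?thesis using A ab by (simp only: mult_zero_right sum.neutral_const) simp
    qed
    have pairs: "(\<Sum>p\<in>UNIV. h p) = (\<^bold>\<Sum>i k. h (i, k))" for h :: "'a \<times> 'a \<Rightarrow> complex"
      using sum.cartesian_product'[of h UNIV UNIV] by simp
    show ?thesis unfolding vec_eq_iff
    proof (intro allI)
      fix a b show "A $ a $ b = (\<Sum>i\<in>UNIV. map_matrix ((*) (A $ Some (fst i) $ Some (snd i))) (?g i)) $ a $ b"
        by (subst entry) (simp only: sum_component map_matrix_nth pairs fst_conv snd_conv)
    qed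
  qed
  note eq = this
  have image: "?g ` UNIV \<subseteq> {munit (Some i) (Some k) | i k. i \<noteq> k} \<union> {munit (Some i) (Some i) - munit None None | i. True}"
  proof (rule image_subsetI)
    fix p :: "'a \<times> 'a"
    obtain i k where p: "p = (i, k)" by (cases p)
    show "?g p \<in> {munit (Some i) (Some k) | i k. i \<noteq> k} \<union> {munit (Some i) (Some i) - munit None None | i. True}"
      unfolding p by (cases "i = k") (simp_all, blast+)
  qed
  show "\<exists>I :: ('a \<times> 'a) set. \<exists>c g. finite I \<and>
      g ` I \<subseteq> {munit (Some i) (Some k) | i k. i \<noteq> k} \<union> {munit (Some i) (Some i) - munit None None | i. True} \<and>
      A = (\<Sum>i\<in>I. map_matrix ((*) (c i)) (g i))"
    by (rule exI[of _ UNIV], rule exI[of _ "\<lambda>i. A $ Some (fst i) $ Some (snd i)"], rule exI[of _ ?g],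
        intro conjI finite_class.finite_UNIV image eq)
qed

lemma nilradical_eq: "nilradical = {A. (\<forall>i k. A $ i $ Some k = 0) \<and> A $ None $ None = 0}"
  unfolding nilradical_def
proof (rule lin_span_sl)
  let ?H = "{A :: complex ^ 'a option ^ 'a option. (\<forall>i k. A $ i $ Some k = 0) \<and> A $ None $ None = 0}"
  show "submodule ?H complex_field sl" by (auto simp: submodule_sl trace_def sum_option)
  show "{munit (Some s) None | s. True} \<subseteq> ?H" by (auto simp: munit_nth)
  fix A assume A: "A \<in> ?H"
  have entry: "A $ a $ b = (\<Sum>i\<in>UNIV. A $ Some i $ None * munit (Some i) None $ a $ b)" for a b
  proof (cases a; cases b)
    fix a' assume ab: "a = Some a'" "b = None"
    have "(\<Sum>i\<in>UNIV. A $ Some i $ None * munit (Some i) None $ a $ b) =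
        (\<Sum>i\<in>UNIV. if i = a' then A $ a $ b else 0)"
      by (intro sum.cong refl) (auto simp: munit_nth ab)
    then show ?thesis by simp
  qed (use A in \<open>simp_all add: munit_nth\<close>)
  have "A = (\<Sum>i\<in>UNIV. map_matrix ((*) (A $ Some i $ None)) (munit (Some i) None))"
    unfolding vec_eq_iff
  proof (intro allI)
    fix a b show "A $ a $ b = (\<Sum>i\<in>UNIV. map_matrix ((*) (A $ Some i $ None)) (munit (Some i) None)) $ a $ b"
      by (subst entry) (simp only: sum_component map_matrix_nth)
  qed
  note eq = this
  have image: "(\<lambda>i. munit (Some i) None) ` UNIV \<subseteq> {munit (Some s) (None :: 'a option) | s. True}"
    by auto
  show "\<exists>I :: 'a set. \<exists>c g. finite I \<and> g ` I \<subseteq> {munit (Some s) None | s. True} \<and>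
      A = (\<Sum>i\<in>I. map_matrix ((*) (c i)) (g i))"
    by (rule exI[of _ UNIV], rule exI[of _ "\<lambda>i. A $ Some i $ None"], rule exI[of _ "\<lambda>i. munit (Some i) None"],
        intro conjI finite_class.finite_UNIV image eq)
qed

definition levi_part :: "complex ^ 'm::finite option ^ 'm option \<Rightarrow> complex ^ 'm option ^ 'm option" where
  "levi_part A = (\<chi> i k. if i \<noteq> None \<and> k = None then 0 else A $ i $ k)"

lemma trace_levi_part: "trace (levi_part A) = trace A"
  unfolding trace_def levi_part_def by (intro sum.cong) auto

lemma parabolic_carrier [simp]: "carrier parabolic = {A. trace A = 0 \<and> (\<forall>i. A $ None $ Some i = 0)}"
proof (rule subset_antisym; rule subsetI)
  fix A :: "complex ^ 'a option ^ 'a option"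
  assume "A \<in> carrier parabolic"
  then obtain B C where "B \<in> levi" "C \<in> nilradical" "A = B + C"
    by (auto simp: parabolic_def set_add_def')
  then show "A \<in> {A. trace A = 0 \<and> (\<forall>i. A $ None $ Some i = 0)}"
    by (auto simp: levi_eq nilradical_eq trace_add) (simp add: trace_def sum_option)
next
  fix A :: "complex ^ 'a option ^ 'a option"
  assume A: "A \<in> {A. trace A = 0 \<and> (\<forall>i. A $ None $ Some i = 0)}"
  then have "levi_part A \<in> levi" "A - levi_part A \<in> nilradical"
    by (auto simp: levi_eq nilradical_eq trace_levi_part) (auto simp: levi_part_def)
  then show "A \<in> carrier parabolic"
    by (simp add: parabolic_def set_add_def')
      (rule bexI[of _ "levi_part A"], rule bexI[of _ "A - levi_part A"], simp_all)
qed

lemma parabolic_simps [simp]: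
  "add parabolic = (+)" "smult parabolic c = map_matrix ((*) c)" "bracket parabolic A B = A ** B - B ** A"
  by (simp_all add: parabolic_def sl_def gl_def)

lemma lie_ops_parabolic: "lie_ops (parabolic :: (complex ^ 'm::finite option ^ 'm option) lie_algebra)"
proof
  fix A B :: "complex ^ 'm option ^ 'm option"
  assume "A \<in> carrier parabolic" "B \<in> carrier parabolic"
  then show "bracket parabolic A B \<in> carrier parabolic"
    by (simp add: trace_simps) (simp add: matrix_matrix_mult_def sum_option)
qed (simp_all add: trace_simps)

text \<open>The description picks \<open>levi_part A\<close>, and \<open>W_tilde\<close> reads only
  the upper left block, which \<open>levi_part\<close> leaves unchanged.\<close>

lemma act_inflate_W_tilde:
  assumes "A \<in> carrier parabolic"
  shows "act (inflate (W_tilde lam W)) A v = act (W_tilde lam W) A v"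
proof -
  have "(THE a. a \<in> levi \<and> A - a \<in> nilradical) = levi_part A"
  proof (rule the_equality)
    show "levi_part A \<in> levi \<and> A - levi_part A \<in> nilradical"
      using assms by (auto simp: levi_eq nilradical_eq trace_levi_part) (auto simp: levi_part_def)
    fix a assume a: "a \<in> levi \<and> A - a \<in> nilradical"
    show "a = levi_part A" unfolding vec_eq_iff
    proof (intro allI)
      fix i k show "a $ i $ k = levi_part A $ i $ k"
        using a by (cases i; cases k) (auto simp: levi_eq nilradical_eq levi_part_def)
    qed
  qed
  then show ?thesis by (simp add: inflate_def W_tilde_def levi_part_def)
qed

context tensor_module_setup
begin

definition y :: "'m \<Rightarrow> 'm laurent" where
  "y i = cscale (inverse (lam i)) (tvar i) - 1"

text \<open>In the coordinates \<open>y\<^sub>i = \<lambda>\<^sub>i\<^sup>-\<^sup>1 t\<^sub>i - 1\<close>, completed by \<open>y\<^sub>m\<^sub>+\<^sub>1 = -1\<close>, the derivation \<open>\<sigma>\<^sub>\<lambda>(A)\<close> sends the row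
  vector \<open>y\<close> to \<open>y A + (y A)\<^sub>m\<^sub>+\<^sub>1 y\<close>, which makes \<open>\<sigma>\<^sub>\<lambda>\<close> a homomorphism by a short computation.\<close>

definition yy :: "'m option \<Rightarrow> 'm laurent" where
  "yy i = (case i of None \<Rightarrow> -1 | Some k \<Rightarrow> y k)"

definition yA :: "complex ^ 'm option ^ 'm option \<Rightarrow> 'm option \<Rightarrow> 'm laurent" where
  "yA A k = (\<Sum>i\<in>UNIV. cscale (A $ i $ k) (yy i))"

text \<open>The value of the field on \<open>tvar k\<close>: since \<open>tvar k\<close> is
  \<lambda>_k (y_k + 1), it is \<lambda>_k times the value on \<open>y k\<close>.\<close>

definition comp :: "complex ^ 'm option ^ 'm option \<Rightarrow> 'm \<Rightarrow> 'm laurent" where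
  "comp A k = cscale (lam k) (yA A (Some k) + yA A None * y k)"

lemma tvar_eq: "tvar i = cscale (lam i) (y i) + cscale (lam i) 1"
  by (simp add: y_def cvs.scale_right_diff_distrib lam)

lemmas cscale_algebra = cvs.scale_right_distrib cvs.scale_left_distrib cvs.scale_right_diff_distrib
  cvs.scale_left_diff_distrib cscale_times_left cscale_times_right

lemma sigma_levi_tvar: "sigma_levi lam i l (tvar k) =
  (if l = k then cscale (lam k) (y i) else 0) + (if i = l then cscale (lam k) (y k) else 0)"
proof -
  have "(\<Sum>s\<in>UNIV. tvar s * pd s (tvar k) - scalar (lam s) * pd s (tvar k)) =
      (\<Sum>s\<in>UNIV. if s = k then tvar k - cscale (lam k) 1 else 0)"
    by (intro sum.cong) (auto simp: pd_tvar scalar_eq)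
  then show ?thesis
    by (simp add: sigma_levi_def pd_tvar scalar_times) (auto simp: scalar_eq y_def cscale_algebra lam mult.commute)
qed

lemma sigma_lower_tvar: "sigma_lower lam i (tvar k) = (if i = k then - cscale (lam k) 1 else 0)"
  by (simp add: sigma_lower_def pd_tvar scalar_times)

text \<open>In the coordinates y this is the quadratic field y_i times the Euler field of y; the
  lower order terms in the definition cancel those coming from \<open>tvar k\<close> = \<lambda>_k
  (y_k + 1).\<close>

lemma sigma_upper_tvar: "sigma_upper lam i (tvar k) = cscale (lam k) (y i * y k)"
proof -
  have euler: "euler (tvar k) = tvar k"
  proof -
    have "(\<Sum>s\<in>UNIV. tvar s * pd s (tvar k)) = (\<Sum>s\<in>UNIV. if s = k then tvar k else 0)"
      by (intro sum.cong) (auto simp: pd_tvar)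
    then show ?thesis by (simp add: euler_def)
  qed
  have "(\<Sum>s\<in>UNIV. scalar (lam s * inverse (lam i)) * (tvar i * pd s (tvar k)) - scalar (lam s) * pd s (tvar k)) =
      (\<Sum>s\<in>UNIV. if s = k then cscale (lam k * inverse (lam i)) (tvar i) - cscale (lam k) 1 else 0)"
    by (intro sum.cong) (auto simp: pd_tvar scalar_times)
  then have S: "(\<Sum>s\<in>UNIV. scalar (lam s * inverse (lam i)) * (tvar i * pd s (tvar k)) - scalar (lam s) * pd s (tvar k)) =
      cscale (lam k * inverse (lam i)) (tvar i) - cscale (lam k) 1" by simp
  have [simp]: "lam i * (lam k * inverse (lam i)) = lam k" "lam k * (inverse (lam i) * lam i) = lam k"
    by (simp_all add: lam)
  have "sigma_upper lam i (tvar k) = cscale (inverse (lam i)) (tvar i * tvar k) - tvar k -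
      (cscale (lam k * inverse (lam i)) (tvar i) - cscale (lam k) 1)"
    unfolding sigma_upper_def S euler by (simp add: scalar_times)
  also have "\<dots> = cscale (lam k) (y i * y k)"
    by (simp add: tvar_eq cscale_algebra algebra_simps lam)
  finally show ?thesis .
qed

lemma sigma_tvar:
  assumes "trace A = 0"
  shows "sigma lam A (tvar k) = comp A k"
proof -
  let ?tr = "\<Sum>i\<in>UNIV. A $ Some i $ Some i"
  have "trace A = A $ None $ None + ?tr" by (simp add: trace_def sum_option)
  then have NN: "A $ None $ None = - ?tr" using assms by (simp add: eq_neg_iff_add_eq_0)
  let ?X = "\<Sum>i\<in>UNIV. cscale (A $ Some i $ Some k) (y i)"
    and ?Y = "\<Sum>i\<in>UNIV. cscale (A $ Some i $ None) (y i)"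
  have 1: "(\<^bold>\<Sum>i l. scalar (A $ Some i $ Some l) * sigma_levi lam i l (tvar k)) =
      cscale (lam k) ?X + cscale (lam k) (cscale ?tr (y k))"
  proof -
    have "(\<Sum>l\<in>UNIV. scalar (A $ Some i $ Some l) * sigma_levi lam i l (tvar k)) =
        (\<Sum>l\<in>UNIV. if l = k then cscale (A $ Some i $ Some k) (cscale (lam k) (y i)) else 0) +
        (\<Sum>l\<in>UNIV. if l = i then cscale (A $ Some i $ Some i) (cscale (lam k) (y k)) else 0)" for i
      unfolding sum.distrib[symmetric]
      by (intro sum.cong) (auto simp: sigma_levi_tvar scalar_times cvs.scale_right_distrib)
    then show ?thesis
      by (simp add: sum.distrib cvs.scale_sum_left cvs.scale_sum_right sum_distrib_left mult.commute)
  qed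
  have 2: "(\<Sum>i\<in>UNIV. scalar (A $ None $ Some i) * sigma_lower lam i (tvar k)) =
      - cscale (lam k) (cscale (A $ None $ Some k) 1)"
  proof -
    have "(\<Sum>i\<in>UNIV. scalar (A $ None $ Some i) * sigma_lower lam i (tvar k)) =
        (\<Sum>i\<in>UNIV. if i = k then - cscale (lam k) (cscale (A $ None $ Some k) 1) else 0)"
      by (intro sum.cong) (auto simp: sigma_lower_tvar scalar_times mult.commute)
    then show ?thesis by simp
  qed
  have 3: "(\<Sum>i\<in>UNIV. scalar (A $ Some i $ None) * sigma_upper lam i (tvar k)) = cscale (lam k) (?Y * y k)"
    unfolding sum_distrib_right cvs.scale_sum_right
    by (intro sum.cong refl) (simp add: sigma_upper_tvar scalar_times cscale_times_left mult.commute[of "lam k"])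
  \<comment> \<open>As \<open>yy None\<close> is -1, the corner entry contributes its negative, the
    trace of the block, to \<open>yA A None\<close>; this matches the multiple of y_k produced by
    the diagonal part.\<close>
  have "yA A (Some k) = ?X - cscale (A $ None $ Some k) 1" "yA A None = ?Y + cscale ?tr 1"
    by (simp_all add: yA_def sum_option yy_def NN)
  then show ?thesis
    unfolding sigma_def 1 2 3 comp_def by (simp only:) (simp add: cscale_algebra distrib_right)
qed

lemma yA_add: "yA (A + B) k = yA A k + yA B k"
  and yA_diff: "yA (A - B) k = yA A k - yA B k"
  and yA_scale: "yA (map_matrix ((*) c) A) k = cscale c (yA A k)"
  by (simp_all add: yA_def cvs.scale_left_distrib cvs.scale_left_diff_distrib sum.distrib sum_subtractf cvs.scale_sum_right)

lemma comp_add: "comp (A + B) k = comp A k + comp B k"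
  and comp_diff: "comp (A - B) k = comp A k - comp B k"
  and comp_scale: "comp (map_matrix ((*) c) A) k = cscale c (comp A k)"
  by (simp_all add: comp_def yA_add yA_diff yA_scale cscale_algebra algebra_simps)

lemma yA_mult: "yA (A ** B) k = (\<Sum>i\<in>UNIV. cscale (B $ i $ k) (yA A i))"
proof -
  have "yA (A ** B) k = (\<^bold>\<Sum>l i. cscale (B $ i $ k) (cscale (A $ l $ i) (yy l)))"
    by (simp add: yA_def matrix_matrix_mult_def cvs.scale_sum_left mult.commute)
  then show ?thesis by (subst (asm) sum.swap) (simp add: yA_def cvs.scale_sum_right)
qed

lemma der_add: "der a (p + q) = der a p + der a q"
  and der_cscale: "der a (cscale c p) = cscale c (der a p)"
  and der_mult: "der a (p * q) = der a p * q + p * der a q"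
  by (simp_all add: der_def pd_mult sum.distrib cvs.scale_sum_right sum_distrib_left sum_distrib_right
      cscale_times_right algebra_simps)

lemma der_sum: "finite S \<Longrightarrow> der a (sum g S) = (\<Sum>x\<in>S. der a (g x))"
  by (induction S rule: finite_induct) (simp_all add: der_add, simp add: der_def)

lemma der_yy: "der (comp A) (yy k) = yA A k + yA A None * yy k"
proof (cases k)
  \<comment> \<open>This is the normalisation of the last coordinate: with \<open>yy None\<close>
    equal to -1 the two terms on the right cancel, as the derivative of a constant requires.\<close>
  case None
  have "pd s (- 1 :: 'm laurent) = 0" for s using pd_diff[of s 0 1] by simp
  then show ?thesis using None by (simp add: yy_def der_def)
next
  case (Some l)
  have "der (comp A) (y l) = (\<Sum>s\<in>UNIV. if s = l then cscale (inverse (lam l)) (comp A l) else 0)"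
    unfolding der_def by (intro sum.cong) (auto simp: y_def pd_tvar cscale_times_right)
  then show ?thesis using Some by (simp add: yy_def comp_def lam)
qed

lemma der_yA: "der (comp A) (yA B k) = yA (A ** B) k + yA A None * yA B k"
  unfolding yA_mult
  by (simp add: yA_def[of B] der_sum der_cscale der_yy cvs.scale_right_distrib sum.distrib sum_distrib_left cscale_times_right)

text \<open>Up to \<open>comp (A ** B) k\<close> the iterated derivative is symmetric in
  \<open>A\<close> and \<open>B\<close>, so only the commutator of the matrices survives in the
  difference.\<close>

lemma comp_bracket: "comp (A ** B - B ** A) k = der (comp A) (comp B k) - der (comp B) (comp A k)"
proof -
  have *: "der (comp A) (comp B k) = cscale (lam k) (yA (A ** B) (Some k) + yA A None * yA B (Some k) +
     (yA (A ** B) None + yA A None * yA B None) * y k + yA B None * (yA A (Some k) + yA A None * y k))" for A B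
    using der_yy[of A "Some k"] by (simp add: comp_def[of B] der_cscale der_add der_mult der_yA yy_def)
  show ?thesis
    unfolding * comp_diff unfolding comp_def cvs.scale_right_diff_distrib[symmetric] by (simp add: algebra_simps)
qed

abbreviation sact where "sact A \<equiv> tact (sigma lam A)"

lemma sact_pt:
  assumes "trace A = 0" "w \<in> carrier W"
  shows "coset_emb K (sact A (pt f w)) = P (vf (comp A) f) w +
    (\<^bold>\<Sum>i s. P (mul (pd s (comp A i)) f) (EE s i w))"
  using tact_pt[OF assms(2), of "sigma lam A"] by (simp add: sigma_tvar[OF assms(1)])

lemma vf_comp: "vf (comp (A + B)) f = vf (comp A) f + vf (comp B) f"
  "vf (comp (map_matrix ((*) c) A)) f = cscale c (vf (comp A) f)"
  by (simp_all add: vf_def comp_add comp_scale sum.distrib cvs.scale_sum_right)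

lemma twist_eq: "twist (sigma lam) (tensor_module (Omega lam) W) = make_rep T sact"
  by (simp add: twist_def make_rep_def tensor_module_def ctensor_eq)

lemma lie_module_F: "lie_module sl (twist (sigma lam) (tensor_module (Omega lam) W))"
  unfolding twist_eq
proof (rule lie_moduleI)
  fix A B :: "complex ^ 'm option ^ 'm option" and f w c
  assume AB: "A \<in> carrier sl" "B \<in> carrier sl" and w: "w \<in> carrier W"
  show "sact (A \<oplus>\<^bsub>sl\<^esub> B) (pt f w) = sact A (pt f w) \<oplus>\<^bsub>T\<^esub> sact B (pt f w)"
    by (rule T.j_inj) (use AB w in \<open>simp_all add: sact_pt trace_simps vf_comp comp_add sum.distrib\<close>)
  show "sact (bracket sl A B) (pt f w) = sact A (sact B (pt f w)) \<ominus>\<^bsub>T\<^esub> sact B (sact A (pt f w))"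
    by (rule tact_commutator[OF w]) (use AB in \<open>simp add: sigma_tvar trace_simps comp_bracket\<close>)
next
  fix A :: "complex ^ 'm option ^ 'm option" and f w c
  assume A: "A \<in> carrier sl" and w: "w \<in> carrier W"
  show "sact (c \<odot>\<^bsub>sl\<^esub> A) (pt f w) = c \<odot>\<^bsub>T\<^esub> sact A (pt f w)"
    by (rule T.j_inj) (use A w in \<open>simp_all add: sact_pt trace_simps vf_comp comp_scale cvs.scale_right_distrib cvs.scale_sum_right\<close>)
qed (simp_all add: linear_tact trace_simps)

section \<open>The parabolic action on the vectors 1 \<otimes> w\<close>

lemma mul_y_1: "mul (y i) 1 = 0"
  by (simp add: y_def mul_tvar_1 lam)

lemma mul_yA_1: "mul (yA A k) 1 = cscale (- A $ None $ k) 1"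
proof -
  have "mul (- 1) 1 = (- 1 :: 'm mpoly)" using mul_diff[of 0 1 1] by simp
  then show ?thesis by (simp add: yA_def sum_option yy_def mul_y_1)
qed

lemma pd_y: "pd s (y i) = (if s = i then cscale (inverse (lam i)) 1 else 0)"
  by (simp add: y_def pd_tvar)

lemma pd_yA: "pd s (yA A k) = cscale (A $ Some s $ k * inverse (lam s)) 1"
proof -
  have "pd s (- 1 :: 'm laurent) = 0" using pd_diff[of s 0 1] by simp
  moreover have "(\<Sum>i\<in>UNIV. cscale (A $ Some i $ k) (pd s (y i))) =
     (\<Sum>i\<in>UNIV. if i = s then cscale (A $ Some s $ k * inverse (lam s)) 1 else 0)"
    by (intro sum.cong) (auto simp: pd_y)
  ultimately show ?thesis by (simp add: yA_def sum_option yy_def)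
qed

lemma mul_comp_1: "A $ None $ Some k = 0 \<Longrightarrow> mul (comp A k) 1 = 0"
  by (simp add: comp_def mul_yA_1 mul_mult mul_y_1)

text \<open>In the product rule the term with the factor \<open>y i\<close> vanishes on 1, and
  \<open>yA A None\<close> acts on 1 as minus the corner entry.\<close>

lemma mul_pd_comp_1: "mul (pd s (comp A i)) 1 =
  cscale (inverse (lam s) * lam i * A $ Some s $ Some i - (if s = i then A $ None $ None else 0)) 1"
proof -
  have "pd s (comp A i) = cscale (lam i) (pd s (yA A (Some i)) + pd s (yA A None) * y i + yA A None * pd s (y i))"
    by (simp add: comp_def pd_mult add.assoc)
  then show ?thesis
    by (simp add: pd_yA pd_y mul_mult mul_y_1 mul_yA_1 cscale_algebra lam mult_ac)
qed

text \<open>The field contributes the scalar and the Jacobian the rest: its entries act on 1 as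
  \<lambda>_s^(-1) \<lambda>_i A_si plus, for s = i, the trace of the block, which accounts for the
  sum of all E_ss in the twist.\<close>

lemma sact_unit:
  assumes A: "A \<in> carrier parabolic" and w: "w \<in> carrier W"
  shows "sact A (pt 1 w) = pt 1 (act (W_tilde lam W) A w)"
    and "act (W_tilde lam W) A w \<in> carrier W"
proof -
  have tr: "trace A = 0" and low: "A $ None $ Some i = 0" for i using A by auto
  let ?tr = "\<Sum>i\<in>UNIV. A $ Some i $ Some i"
  have "trace A = A $ None $ None + ?tr" by (simp add: trace_def sum_option)
  then have NN: "A $ None $ None = - ?tr" using tr by (simp add: eq_neg_iff_add_eq_0)
  let ?b = "\<lambda>i k. W_tilde_basis lam W i k w"
  have b: "?b i k \<in> carrier W" for i k using w by (auto simp: W_tilde_basis_def)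
  then show cl: "act (W_tilde lam W) A w \<in> carrier W" by (simp add: W_tilde_def)
  let ?S = "\<Sum>s\<in>UNIV. P 1 (EE s s w)"
  have Pb: "P 1 (?b i k) = cscale (inverse (lam i) * lam k) (P 1 (EE i k w)) +
      (if i = k then ?S - cscale (of_nat CARD('m) + 1) (P 1 w) else 0)" for i k
    using w by (simp add: W_tilde_basis_def P_smult_right P_minus_right P_add_right P_finsum_right lam)
  have "P 1 (act (W_tilde lam W) A w) = (\<^bold>\<Sum>i k. cscale (A $ Some i $ Some k) (P 1 (?b i k)))"
    unfolding W_tilde_def make_rep_simps by (simp add: P_finsum_right b P_smult_right)
  also have "\<dots> = (\<^bold>\<Sum>i k. cscale (A $ Some i $ Some k * (inverse (lam i) * lam k)) (P 1 (EE i k w))) +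
      (\<^bold>\<Sum>i k. if k = i then cscale (A $ Some i $ Some i) (?S - cscale (of_nat CARD('m) + 1) (P 1 w)) else 0)"
    unfolding sum.distrib[symmetric] by (intro sum.cong refl) (auto simp: Pb cvs.scale_right_distrib)
  also have "\<dots> = (\<^bold>\<Sum>i k. cscale (A $ Some i $ Some k * (inverse (lam i) * lam k)) (P 1 (EE i k w))) +
      cscale ?tr (?S - cscale (of_nat CARD('m) + 1) (P 1 w))"
    by (simp add: cvs.scale_sum_left)
  finally have R: "P 1 (act (W_tilde lam W) A w) = \<dots>" .
  \<comment> \<open>The components kill 1, so by the Leibniz rule the field acts on 1 by minus its
    divergence.\<close>
  have "vf (comp A) 1 = (\<Sum>k\<in>UNIV. dd k (mul (comp A k) 1) - mul (pd k (comp A k)) 1)"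
    unfolding vf_def dd_mul by simp
  also have "\<dots> = - cscale (?tr - of_nat CARD('m) * A $ None $ None) 1"
    by (simp add: mul_comp_1 low mul_pd_comp_1 lam sum_negf sum_subtractf flip: cvs.scale_sum_left)
  \<comment> \<open>Besides the diagonal entries, each of the m derivatives contributes minus the
    corner entry, which is the trace of the block again: m + 1 traces in all.\<close>
  finally have vf: "vf (comp A) 1 = - cscale ((of_nat CARD('m) + 1) * ?tr) 1"
    by (simp add: NN algebra_simps)
  have "(\<^bold>\<Sum>i s. P (mul (pd s (comp A i)) 1) (EE s i w)) =
      (\<^bold>\<Sum>i s. cscale (A $ Some s $ Some i * (inverse (lam s) * lam i)) (P 1 (EE s i w))) +
      (\<^bold>\<Sum>i s. if s = i then cscale ?tr (P 1 (EE i i w)) else 0)"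
    unfolding sum.distrib[symmetric]
    by (intro sum.cong refl) (use w in \<open>auto simp: mul_pd_comp_1 NN cvs.scale_left_distrib mult_ac\<close>)
  also have "\<dots> = (\<^bold>\<Sum>i k. cscale (A $ Some i $ Some k * (inverse (lam i) * lam k)) (P 1 (EE i k w))) +
      cscale ?tr ?S"
    by (subst sum.swap) (simp add: cvs.scale_sum_right)
  finally have E: "(\<^bold>\<Sum>i s. P (mul (pd s (comp A i)) 1) (EE s i w)) = \<dots>" .
  have neg: "P (- cscale c 1) w = - cscale c (P 1 w)" for c using P_diff[OF w, of 0 "cscale c 1"] w by simp
  show "sact A (pt 1 w) = pt 1 (act (W_tilde lam W) A w)"
  proof (rule T.j_inj)
    show "coset_emb K (sact A (pt 1 w)) = coset_emb K (pt 1 (act (W_tilde lam W) A w))"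
      unfolding P_def[symmetric] R sact_pt[OF tr w] E vf neg
      by (simp add: cvs.scale_right_diff_distrib mult.commute)
  qed (use w cl in auto)
qed

abbreviation low :: "'m \<Rightarrow> complex ^ 'm option ^ 'm option" where
  "low i \<equiv> munit None (Some i)"

lemma trace_low [simp]: "trace (low i) = 0"
  by (simp add: trace_munit)

lemma comp_low: "comp (low i) k = (if k = i then - cscale (lam i) 1 else 0)"
proof -
  have "yA (low i) k = (if k = Some i then - 1 else 0)" for k
    by (simp add: yA_def sum_option munit_nth yy_def)
  then show ?thesis by (simp add: comp_def)
qed

text \<open>The components of this field are constant, so the terms with matrix units vanish and
  only -\<lambda>_i times the derivative remains.\<close>

lemma sact_low:
  assumes w: "w \<in> carrier W"
  shows "sact (low i) (pt f w) = pt (- shift i 1 (xvar i * f)) w"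
proof (rule T.j_inj)
  have neg: "mul (- cscale c 1) g = - cscale c g" for c g
    using mul_diff[of 0 "cscale c 1" g] by simp
  have "vf (comp (low i)) f = (\<Sum>k\<in>UNIV. if k = i then - cscale (lam i) (dd i f) else 0)"
    unfolding vf_def by (intro sum.cong) (auto simp: comp_low neg)
  then have vf: "vf (comp (low i)) f = - shift i 1 (xvar i * f)"
    by (simp add: dd_eq lam)
  have "pd s (- cscale c 1 :: 'm laurent) = 0" for s c using pd_diff[of s 0 "cscale c 1"] by simp
  then show "coset_emb K (sact (low i) (pt f w)) = coset_emb K (pt (- shift i 1 (xvar i * f)) w)"
    using w by (simp add: sact_pt vf comp_low P_def[symmetric] if_distrib[of "pd _"] if_distrib[of "\<lambda>q. mul q f"] cong: if_cong)
qed (use w in auto)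

end

section \<open>The isomorphism\<close>

text \<open>The operators \<open>f \<mapsto> (x\<^sub>i + 1) f(x + e\<^sub>i)\<close> are, up to sign, the action of the \<open>E\<^sub>m\<^sub>+\<^sub>1\<^sub>,\<^sub>i\<close>.\<close>

abbreviation raise :: "'m::finite \<Rightarrow> 'm mpoly \<Rightarrow> 'm mpoly" where
  "raise i f \<equiv> shift i 1 (xvar i * f)"

inductive_set raised :: "'m::finite mpoly set" where
  one: "1 \<in> raised"
| add: "f \<in> raised \<Longrightarrow> g \<in> raised \<Longrightarrow> f + g \<in> raised"
| scale: "f \<in> raised \<Longrightarrow> cscale c f \<in> raised"
| raise: "f \<in> raised \<Longrightarrow> raise i f \<in> raised"

text \<open>The variable x_i is moved inward to 1: it passes \<open>raise k\<close> unchanged for k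
  distinct from i and becomes x_i - 1 behind \<open>raise i\<close>. On 1 it equals
  \<open>raise i 1 - 1\<close>.\<close>

lemma xvar_raised: "f \<in> raised \<Longrightarrow> xvar i * f \<in> raised"
proof (induction rule: raised.induct)
  case one
  have "xvar i * 1 = raise i 1 + cscale (-1) 1" by (rule mpoly_eqI) simp
  then show ?case using raised.intros by metis
next
  case (add f g)
  then show ?case by (simp add: distrib_left raised.add)
next
  case (scale f c)
  then show ?case by (simp add: cscale_times_right raised.scale)
next
  case (raise f k)
  show ?case
  proof (cases "i = k")
    case True
    have "xvar i * raise i f = raise i (xvar i * f) + cscale (-1) (raise i f)"
      by (rule mpoly_eqI) (simp add: algebra_simps)
    then show ?thesis using raise True by (metis raised.intros)
  next
    case False
    have "xvar i * raise k f = raise k (xvar i * f)"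
      by (rule mpoly_eqI) (use False in simp)
    then show ?thesis using raise by (metis raised.intros)
  qed
qed

lemma raised_UNIV: "f \<in> raised"
proof (induction f rule: mpoly_induct)
  case zero
  show ?case using raised.scale[OF raised.one, of 0] by simp
next
  case (single \<alpha> c)
  have "single \<alpha> 1 * g \<in> raised" if "g \<in> raised" for g
    using that
  proof (induction \<alpha> arbitrary: g rule: mpoly_induct)
    case zero
    then show ?case by simp
  next
    case (single k n)
    then show ?case
    proof (induction n)
      case (Suc n)
      have "single (single k (Suc n)) 1 * g =
          xvar k * (single (single k n) 1 * g)"
        unfolding xvar_def mult.assoc[symmetric] mult_single single_add[symmetric] by simp
      then show ?case using Suc xvar_raised by metis
    qed simp
  next
    case (add \<alpha> \<beta>)
    have "single (\<alpha> + \<beta>) 1 * g = single \<alpha> 1 * (single \<beta> 1 * g)"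
      by (simp add: mult.assoc[symmetric] mult_single)
    then show ?case using add by metis
  qed
  from raised.scale[OF this[OF raised.one], of c] show ?case by simp
qed (rule raised.add)

lemma multi_index_induct [case_names zero step]:
  fixes \<alpha> :: "'m::finite \<Rightarrow> nat"
  assumes "P (\<lambda>_. 0)" and "\<And>\<alpha> k. P \<alpha> \<Longrightarrow> P (\<alpha>(k := Suc (\<alpha> k)))"
  shows "P \<alpha>"
proof (induction "\<Sum>i\<in>UNIV. \<alpha> i" arbitrary: \<alpha>)
  case 0
  then have "\<alpha> = (\<lambda>_. 0)" by (auto simp: fun_eq_iff)
  then show ?case using assms(1) by simp
next
  case (Suc n)
  then obtain k where k: "\<alpha> k \<noteq> 0" by (metis nat.distinct(1) sum.neutral)
  let ?\<beta> = "\<alpha>(k := \<alpha> k - 1)"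
  have "(\<Sum>i\<in>UNIV. \<alpha> i) = \<alpha> k + (\<Sum>i\<in>UNIV - {k}. \<alpha> i)" by (simp add: sum.remove)
  moreover have "(\<Sum>i\<in>UNIV. ?\<beta> i) = ?\<beta> k + (\<Sum>i\<in>UNIV - {k}. ?\<beta> i)" by (rule sum.remove) auto
  moreover have "(\<Sum>i\<in>UNIV - {k}. ?\<beta> i) = (\<Sum>i\<in>UNIV - {k}. \<alpha> i)" by (rule sum.cong) auto
  ultimately have "n = (\<Sum>i\<in>UNIV. ?\<beta> i)" using Suc(2) k by simp
  then have "P ?\<beta>" by (rule Suc(1))
  from assms(2)[OF this, of k] k show ?case by simp
qed

lemma comp_fun_commute_fold_insert:
  assumes "comp_fun_commute f" "finite A" "x \<notin> A"
  shows "Finite_Set.fold f z (insert x A) = f x (Finite_Set.fold f z A)"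
proof -
  interpret comp_fun_commute f by fact
  show ?thesis by (rule fold_insert[OF assms(2,3)])
qed

context tensor_module_setup
begin

definition Ev :: "('m \<Rightarrow> complex) \<Rightarrow> ('m mpoly \<times> 'w \<Rightarrow>\<^sub>0 complex) set \<Rightarrow> ('k \<Rightarrow>\<^sub>0 complex)" where
  "Ev x = tlift (\<lambda>f w. cscale (ev f x) (jW w))"

lemma balanced_Ev: "balanced_bilinear (\<lambda>f w. cscale (ev f x) (jW w))"
  unfolding balanced_bilinear_def by (simp add: cvs.scale_left_distrib cvs.scale_right_distrib mult_ac)

lemma Ev_simps [simp]:
  "Ev x (pt f w) = cscale (ev f x) (jW w)"
  "\<lbrakk>z \<in> carrier T; z' \<in> carrier T\<rbrakk> \<Longrightarrow> Ev x (z \<oplus>\<^bsub>T\<^esub> z') = Ev x z + Ev x z'"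
  "z \<in> carrier T \<Longrightarrow> Ev x (c \<odot>\<^bsub>T\<^esub> z) = cscale c (Ev x z)"
  "Ev x \<zero>\<^bsub>T\<^esub> = 0"
  using balanced_Ev[of x] by (simp_all add: Ev_def)

text \<open>Evaluating the constant 1 at any point returns the vector. Identities in
  \<open>W\<close> can therefore be tested in the tensor module.\<close>

lemma unit_inj: "\<lbrakk>w \<in> carrier W; w' \<in> carrier W; pt 1 w = pt 1 w'\<rbrakk> \<Longrightarrow> w = w'"
  using Ev_simps(1)[of "\<lambda>_. 0" 1 w] Ev_simps(1)[of "\<lambda>_. 0" 1 w'] by (auto intro: W.V.j_inj)

abbreviation F where "F \<equiv> make_rep T sact"

sublocale F: lie_rep sl F "coset_emb K"
  using lie_module_F unfolding twist_eq
  by (intro lie_rep.intro lie_ops_sl T.make_rep lie_rep_axioms.intro)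

abbreviation V where "V \<equiv> inflate (W_tilde lam W)"

lemma V_simps [simp]: "carrier V = carrier W" "add V = add W" "smult V = smult W" "zero V = zero W"
  by (simp_all add: inflate_def W_tilde_def)

lemma cspace_V: "cspace V jW"
  unfolding inflate_def W_tilde_def by (intro cspace.make_rep cspace_W)

lemma
  assumes "A \<in> carrier parabolic" "w \<in> carrier W"
  shows V_act_closed [simp]: "act V A w \<in> carrier W"
    and pt_V_act: "pt 1 (act V A w) = sact A (pt 1 w)"
  using sact_unit[OF assms] assms(1) by (simp_all add: act_inflate_W_tilde del: parabolic_carrier)

lemma parabolic_subset: "carrier parabolic \<subseteq> carrier sl"
  by auto

text \<open>Each identity is pulled back along the injective map \<open>pt 1\<close>, which turns it
  into the same identity in \<open>F\<close>; the operations of the parabolic are those of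
  \<open>sl\<close>.\<close>

lemma lie_module_V: "lie_module parabolic V"
proof -
  note closed = lie_ops.lie_add_closed[OF lie_ops_parabolic] lie_ops.lie_smult_closed[OF lie_ops_parabolic]
    lie_ops.bracket_closed[OF lie_ops_parabolic]
  have ptW: "pt 1 (v \<oplus>\<^bsub>W\<^esub> w) = pt 1 v \<oplus>\<^bsub>T\<^esub> pt 1 w" "pt 1 (c \<odot>\<^bsub>W\<^esub> v) = c \<odot>\<^bsub>T\<^esub> pt 1 v"
    if "v \<in> carrier W" "w \<in> carrier W" for v w c
    using that by (simp_all add: pt_add_right pt_smult_right)
  show ?thesis
    unfolding lie_module_def linear_op_def V_simps
  proof (intro conjI ballI allI Pi_I)
    show "Module.module complex_field V" by (rule cspace.module[OF cspace_V])
  next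
    fix A :: "complex ^ 'm option ^ 'm option" and v assume "A \<in> carrier parabolic" "v \<in> carrier W"
    then show "act V A v \<in> carrier W" by (rule V_act_closed)
  next
    fix A :: "complex ^ 'm option ^ 'm option" and v w assume h: "A \<in> carrier parabolic" "v \<in> carrier W" "w \<in> carrier W"
    then have A: "A \<in> carrier sl" using parabolic_subset by blast
    show "act V A (v \<oplus>\<^bsub>W\<^esub> w) = act V A v \<oplus>\<^bsub>W\<^esub> act V A w"
      by (rule unit_inj)
        (use h F.act_add[OF A, of "pt 1 v" "pt 1 w"] in \<open>simp_all add: pt_V_act ptW del: parabolic_carrier sl_simps\<close>)
  next
    fix A :: "complex ^ 'm option ^ 'm option" and c v assume h: "A \<in> carrier parabolic" "v \<in> carrier W"
    then have A: "A \<in> carrier sl" using parabolic_subset by blast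
    show "act V A (c \<odot>\<^bsub>W\<^esub> v) = c \<odot>\<^bsub>W\<^esub> act V A v"
      by (rule unit_inj)
        (use h F.act_smult[OF A, of "pt 1 v" c] in \<open>simp_all add: pt_V_act ptW del: parabolic_carrier sl_simps\<close>)
    have c: "c \<odot>\<^bsub>parabolic\<^esub> A = c \<odot>\<^bsub>sl\<^esub> A" by simp
    show "act V (c \<odot>\<^bsub>parabolic\<^esub> A) v = c \<odot>\<^bsub>W\<^esub> act V A v"
      by (rule unit_inj)
        (use h F.act_smult_left[OF A, of "pt 1 v" c] closed(2)[OF h(1), of c] in
          \<open>simp_all add: pt_V_act ptW c del: parabolic_carrier parabolic_simps sl_simps\<close>)
  next
    fix A B :: "complex ^ 'm option ^ 'm option" and v assume h: "A \<in> carrier parabolic" "B \<in> carrier parabolic" "v \<in> carrier W"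
    then have AB: "A \<in> carrier sl" "B \<in> carrier sl" using parabolic_subset by blast+
    have a: "A \<oplus>\<^bsub>parabolic\<^esub> B = A \<oplus>\<^bsub>sl\<^esub> B" and b: "bracket parabolic A B = bracket sl A B" by simp_all
    show "act V (A \<oplus>\<^bsub>parabolic\<^esub> B) v = act V A v \<oplus>\<^bsub>W\<^esub> act V B v"
      by (rule unit_inj)
        (use h F.act_add_left[OF AB, of "pt 1 v"] closed(1)[OF h(1,2)] in
          \<open>simp_all add: pt_V_act ptW a del: parabolic_carrier parabolic_simps sl_simps\<close>)
    have minus: "pt 1 (u \<ominus>\<^bsub>V\<^esub> w) = pt 1 u \<ominus>\<^bsub>T\<^esub> pt 1 w" if "u \<in> carrier W" "w \<in> carrier W" for u w
    proof -
      have V: "u \<ominus>\<^bsub>V\<^esub> w \<in> carrier W" using cspace.minus_closed[OF cspace_V, of u w] that by simp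
      have "u \<ominus>\<^bsub>V\<^esub> w = u \<ominus>\<^bsub>W\<^esub> w"
        by (rule W.V.j_inj) (use that V cspace.j_minus[OF cspace_V, of u w] in simp_all)
      moreover have "pt 1 (u \<ominus>\<^bsub>W\<^esub> w) = pt 1 u \<ominus>\<^bsub>T\<^esub> pt 1 w"
        by (rule T.j_inj) (use that P_minus_right[of u w 1] in \<open>simp_all add: P_def\<close>)
      ultimately show ?thesis by simp
    qed
    have Vm: "u \<ominus>\<^bsub>V\<^esub> w \<in> carrier W" if "u \<in> carrier W" "w \<in> carrier W" for u w
      using cspace.minus_closed[OF cspace_V, of u w] that by simp
    show "act V (bracket parabolic A B) v = act V A (act V B v) \<ominus>\<^bsub>V\<^esub> act V B (act V A v)"
      by (rule unit_inj)
        (use h F.act_bracket[OF AB, of "pt 1 v"] closed(3)[OF h(1,2)] in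
          \<open>simp_all add: pt_V_act minus Vm b a_minus_make_rep[OF T.cspace_axioms] del: parabolic_carrier parabolic_simps sl_simps\<close>)
  qed
qed

sublocale ind: induced sl parabolic V jW
  by (intro induced.intro lie_ops_sl lie_rep.intro lie_ops_parabolic cspace_V lie_rep_axioms.intro
      lie_module_V induced_axioms.intro parabolic_subset) simp_all

section \<open>Monomials in the elements \<open>low i\<close> span the Verma module\<close>

abbreviation M where "M \<equiv> ind.T"

lemma low_in_sl: "low i \<in> carrier sl"
  by simp

lemma ind_act_closed [simp, intro]: "\<lbrakk>A \<in> carrier sl; z \<in> carrier M\<rbrakk> \<Longrightarrow> ind.ind_act A z \<in> carrier M"
  using ind.linear_ind_act[of A] by (auto simp: linear_op_def)

sublocale M: lie_rep sl "make_rep M ind.ind_act" "coset_emb ind.K"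
  using ind.lie_module_induced unfolding ind.induced_module_eq
  by (intro lie_rep.intro lie_ops_sl ind.T.make_rep lie_rep_axioms.intro)

lemma ind_act_bracket:
  assumes "A \<in> carrier sl" "B \<in> carrier sl" "z \<in> carrier M"
  shows "ind.ind_act (bracket sl A B) z =
    ind.ind_act A (ind.ind_act B z) \<ominus>\<^bsub>M\<^esub> ind.ind_act B (ind.ind_act A z)"
  using M.act_bracket[OF assms(1,2), of z] assms(3)
    a_minus_make_rep[OF ind.T.cspace_axioms ind_act_closed[OF assms(1) ind_act_closed[OF assms(2,3)]]
      ind_act_closed[OF assms(2) ind_act_closed[OF assms(1,3)]], of ind.ind_act]
  by (simp del: sl_simps)

lemma low_commute:
  assumes "z \<in> carrier M"
  shows "ind.ind_act (low i) (ind.ind_act (low k) z) = ind.ind_act (low k) (ind.ind_act (low i) z)"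
proof -
  have "bracket sl (low i) (low k) = 0" by (simp add: munit_mult)
  moreover have "ind.ind_act 0 z = \<zero>\<^bsub>M\<^esub>"
    using M.act_smult_left[of 0 z 0] assms by (simp add: trace_simps map_matrix_def zero_vec_def[symmetric] vec_lambda_eta)
  ultimately have "\<zero>\<^bsub>M\<^esub> = ind.ind_act (low i) (ind.ind_act (low k) z) \<ominus>\<^bsub>M\<^esub> ind.ind_act (low k) (ind.ind_act (low i) z)"
    using ind_act_bracket[OF low_in_sl low_in_sl assms, of i k] by (simp del: sl_simps)
  then have "coset_emb ind.K \<zero>\<^bsub>M\<^esub> = coset_emb ind.K (ind.ind_act (low i) (ind.ind_act (low k) z)) -
      coset_emb ind.K (ind.ind_act (low k) (ind.ind_act (low i) z))"
    using assms low_in_sl by (simp del: sl_simps ind.T.j_zero)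
  then show ?thesis
    using assms low_in_sl by (intro ind.T.j_inj) (simp_all del: sl_simps)
qed

text \<open>The identity outside the carrier, because the commutation required for folding is an
  equation between functions on the whole type.\<close>

definition lop where
  "lop i z = (if z \<in> carrier M then ind.ind_act (low i) z else z)"

lemma lop_closed [simp, intro]: "z \<in> carrier M \<Longrightarrow> lop i z \<in> carrier M"
  by (simp add: lop_def low_in_sl del: sl_simps)

lemma comp_fun_commute_lop: "comp_fun_commute lop"
  by unfold_locales (auto simp: fun_eq_iff lop_def low_commute low_in_sl simp del: sl_simps)

text \<open>The monomial E^\<alpha> applied to 1 \<otimes> w. The factors commute, so a fold over
  the unordered index type expresses the product.\<close>

definition emon where
  "emon \<alpha> w = Finite_Set.fold (\<lambda>i. lop i ^^ \<alpha> i) (ind.unit_pt w) (UNIV :: 'm set)"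

lemma emon_0: "emon (\<lambda>_. 0) w = ind.unit_pt w"
proof -
  have "Finite_Set.fold (\<lambda>i. lop i ^^ 0) z A = z" if "finite A" for z and A :: "'m set"
    using that
  proof (induction A)
    case (insert x A)
    have "comp_fun_commute (\<lambda>i. lop i ^^ 0)" by unfold_locales (simp add: fun_eq_iff)
    note eq = comp_fun_commute_fold_insert[OF this insert.hyps, of z]
    show ?case unfolding eq insert.IH by (rule funpow_0)
  qed simp
  then show ?thesis by (simp add: emon_def)
qed

lemma emon_Suc: "emon (\<alpha>(k := Suc (\<alpha> k))) w = lop k (emon \<alpha> w)"
proof -
  let ?f = "\<lambda>\<alpha> i. lop i ^^ \<alpha> i"
  let ?\<beta> = "\<alpha>(k := Suc (\<alpha> k))"
  have cfc: "comp_fun_commute (?f \<alpha>)" for \<alpha> :: "'m \<Rightarrow> nat"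
    by (rule comp_fun_commute.comp_fun_commute_funpow[OF comp_fun_commute_lop])
  have U: "UNIV = insert k (UNIV - {k})" by auto
  have ins: "Finite_Set.fold (?f \<alpha>) z UNIV = ?f \<alpha> k (Finite_Set.fold (?f \<alpha>) z (UNIV - {k}))" for z and \<alpha> :: "'m \<Rightarrow> nat"
    by (subst U, rule comp_fun_commute_fold_insert[OF cfc]) auto
  have "Finite_Set.fold (?f ?\<beta>) z A = Finite_Set.fold (?f \<alpha>) z A" if "finite A" "k \<notin> A" for z and A :: "'m set"
    using that
  proof (induction A)
    case (insert a A)
    then show ?case
      by (simp only: comp_fun_commute_fold_insert[OF cfc insert.hyps]) auto
  qed simp
  then show ?thesis unfolding emon_def by (simp only: ins) (simp)
qed

lemma emon_closed [simp, intro]: "w \<in> carrier W \<Longrightarrow> emon \<alpha> w \<in> carrier M"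
  by (induction \<alpha> rule: multi_index_induct) (simp_all add: emon_0 emon_Suc)

lemma lop_add: "\<lbrakk>x \<in> carrier M; z \<in> carrier M\<rbrakk> \<Longrightarrow> lop i (x \<oplus>\<^bsub>M\<^esub> z) = lop i x \<oplus>\<^bsub>M\<^esub> lop i z"
  using M.act_add[OF low_in_sl] by (simp add: lop_def)

lemma emon_add: "\<lbrakk>w \<in> carrier W; w' \<in> carrier W\<rbrakk> \<Longrightarrow> emon \<alpha> (w \<oplus>\<^bsub>W\<^esub> w') = emon \<alpha> w \<oplus>\<^bsub>M\<^esub> emon \<alpha> w'"
proof (induction \<alpha> rule: multi_index_induct)
  case zero
  then show ?case using ind.unit_pt_add[of w w'] by (simp add: emon_0)
qed (simp add: emon_Suc lop_add)

lemma lop_smult: "z \<in> carrier M \<Longrightarrow> lop i (c \<odot>\<^bsub>M\<^esub> z) = c \<odot>\<^bsub>M\<^esub> lop i z"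
  using M.act_smult[OF low_in_sl] by (simp add: lop_def)

lemma emon_smult: "w \<in> carrier W \<Longrightarrow> emon \<alpha> (c \<odot>\<^bsub>W\<^esub> w) = c \<odot>\<^bsub>M\<^esub> emon \<alpha> w"
proof (induction \<alpha> rule: multi_index_induct)
  case zero
  then show ?case using ind.unit_pt_smult[of w c] by (simp add: emon_0)
qed (simp add: emon_Suc lop_smult)

lemma emon_zero: "emon \<alpha> \<zero>\<^bsub>W\<^esub> = \<zero>\<^bsub>M\<^esub>"
  using emon_smult[of "\<zero>\<^bsub>W\<^esub>" \<alpha> 0] by simp

text \<open>Scalars are absorbed into \<open>w\<close>, so sums of monomial terms already form a
  subspace.\<close>

inductive_set emon_span where
  emon: "w \<in> carrier W \<Longrightarrow> emon \<alpha> w \<in> emon_span"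
| add: "\<lbrakk>x \<in> emon_span; z \<in> emon_span\<rbrakk> \<Longrightarrow> x \<oplus>\<^bsub>M\<^esub> z \<in> emon_span"

lemma emon_span_closed: "z \<in> emon_span \<Longrightarrow> z \<in> carrier M"
  by (induction rule: emon_span.induct) auto

lemma zero_emon_span: "\<zero>\<^bsub>M\<^esub> \<in> emon_span"
  using emon_span.emon[of "\<zero>\<^bsub>W\<^esub>" "\<lambda>_. 0"] by (simp add: emon_zero)

lemma smult_emon_span: "z \<in> emon_span \<Longrightarrow> c \<odot>\<^bsub>M\<^esub> z \<in> emon_span"
proof (induction rule: emon_span.induct)
  case (emon w \<alpha>)
  then show ?case using emon_span.emon[of "c \<odot>\<^bsub>W\<^esub> w" \<alpha>] by (simp add: emon_smult)
next
  case (add x z)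
  have "c \<odot>\<^bsub>M\<^esub> (x \<oplus>\<^bsub>M\<^esub> z) = c \<odot>\<^bsub>M\<^esub> x \<oplus>\<^bsub>M\<^esub> c \<odot>\<^bsub>M\<^esub> z"
    by (rule ind.T.j_inj) (use add emon_span_closed in \<open>auto simp: cvs.scale_right_distrib\<close>)
  then show ?case using emon_span.add[OF add.IH] by simp
qed

lemma lop_emon_span: "z \<in> emon_span \<Longrightarrow> lop i z \<in> emon_span"
proof (induction rule: emon_span.induct)
  case (emon w \<alpha>)
  then show ?case using emon_span.emon[of w "\<alpha>(i := Suc (\<alpha> i))"] by (simp add: emon_Suc)
next
  case (add x z)
  then show ?case by (simp add: lop_add emon_span_closed emon_span.add)
qed

lemma sl_decomposition:
  assumes "A \<in> carrier sl"
  obtains B where "B \<in> carrier parabolic" "A = B + (\<Sum>i\<in>UNIV. map_matrix ((*) (A $ None $ Some i)) (low i))"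
proof -
  let ?C = "\<Sum>i\<in>UNIV. map_matrix ((*) (A $ None $ Some i)) (low i)"
  have "?C $ None $ Some k = A $ None $ Some k" for k
  proof -
    have "?C $ None $ Some k = (\<Sum>i\<in>UNIV. if i = k then A $ None $ Some k else 0)"
      unfolding sum_component by (intro sum.cong) (auto simp: munit_nth)
    then show ?thesis by simp
  qed
  moreover have "trace ?C = 0"
  proof -
    have "?C $ i $ i = 0" for i by (cases i) (simp_all add: munit_nth)
    then show ?thesis by (simp add: trace_def)
  qed
  ultimately have "A - ?C \<in> carrier parabolic" using assms by (simp add: trace_sub)
  then show ?thesis by (rule that) simp
qed

text \<open>Stability of the span of the monomials \<open>E\<^sup>\<alpha>\<close> applied to \<open>1 \<otimes> W\<close> is the spanning half of the
  Poincare-Birkhoff-Witt theorem; by induction it reduces to \<open>X E n = E X n + [X, E] n\<close>.\<close>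

lemma ind_act_emon:
  assumes "A \<in> carrier sl" "w \<in> carrier W"
  shows "ind.ind_act A (emon \<alpha> w) \<in> emon_span"
  using assms(1)
proof (induction \<alpha> arbitrary: A rule: multi_index_induct)
  case zero
  obtain B where B: "B \<in> carrier parabolic"
    and A: "A = B + (\<Sum>i\<in>UNIV. map_matrix ((*) (A $ None $ Some i)) (low i))"
    using zero by (rule sl_decomposition)
  have u: "ind.unit_pt w \<in> carrier M" using assms(2) ind.unit_pt_closed[of w] by simp
  have low: "ind.ind_act (low i) (ind.unit_pt w) \<in> emon_span" for i
    using lop_emon_span[OF emon_span.emon[OF assms(2), of "\<lambda>_. 0"], of i] u by (simp add: emon_0 lop_def)
  have B': "ind.ind_act B (ind.unit_pt w) \<in> emon_span"
    using ind.ind_act_unit_pt[OF B, of w] emon_span.emon[of "act V B w" "\<lambda>_. 0"] B assms(2)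
    by (simp add: emon_0 del: parabolic_carrier)
  \<comment> \<open>Additivity of the action holds for two summands within \<open>sl\<close>, so the
    entries of the last row are added one at a time.\<close>
  have "B + (\<Sum>i\<in>I. map_matrix ((*) (A $ None $ Some i)) (low i)) \<in> carrier sl \<and>
    ind.ind_act (B + (\<Sum>i\<in>I. map_matrix ((*) (A $ None $ Some i)) (low i))) (ind.unit_pt w) \<in> emon_span"
    if "finite I" for I :: "'m set"
    using that
  proof (induction I)
    case empty
    then show ?case using B B' by simp
  next
    case (insert i I)
    let ?S = "B + (\<Sum>i\<in>I. map_matrix ((*) (A $ None $ Some i)) (low i))"
    let ?L = "map_matrix ((*) (A $ None $ Some i)) (low i)"
    have L: "?L \<in> carrier sl" by (simp add: trace_simps)
    have e: "B + (\<Sum>i\<in>insert i I. map_matrix ((*) (A $ None $ Some i)) (low i)) = ?S + ?L"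
      using insert.hyps by (simp add: algebra_simps)
    have "ind.ind_act (?S + ?L) (ind.unit_pt w) = ind.ind_act ?S (ind.unit_pt w) \<oplus>\<^bsub>M\<^esub> ind.ind_act ?L (ind.unit_pt w)"
      using M.act_add_left[OF conjunct1[OF insert.IH] L, of "ind.unit_pt w"] u by simp
    moreover have "ind.ind_act ?L (ind.unit_pt w) = (A $ None $ Some i) \<odot>\<^bsub>M\<^esub> ind.ind_act (low i) (ind.unit_pt w)"
      using M.act_smult_left[OF low_in_sl, of "ind.unit_pt w" "A $ None $ Some i" i] u by simp
    ultimately have "ind.ind_act (?S + ?L) (ind.unit_pt w) \<in> emon_span"
      using insert.IH low smult_emon_span emon_span.add by simp
    moreover have "?S + ?L \<in> carrier sl" using insert.IH L by (simp add: trace_simps)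
    ultimately show ?case unfolding e by blast
  qed
  from this[OF finite_class.finite_UNIV] show ?case using A by (simp add: emon_0)
next
  case (step \<alpha> k)
  let ?z = "emon \<alpha> w"
  have z: "?z \<in> carrier M" using assms(2) by simp
  have br: "bracket sl A (low k) \<in> carrier sl"
    by (rule lie_ops.bracket_closed[OF lie_ops_sl step.prems low_in_sl])
  have "ind.ind_act A (ind.ind_act (low k) ?z) =
      ind.ind_act (low k) (ind.ind_act A ?z) \<oplus>\<^bsub>M\<^esub> ind.ind_act (bracket sl A (low k)) ?z"
  proof (rule ind.T.j_inj)
    have "ind.ind_act (bracket sl A (low k)) ?z = ind.ind_act A (ind.ind_act (low k) ?z) \<ominus>\<^bsub>M\<^esub> ind.ind_act (low k) (ind.ind_act A ?z)"
      by (rule ind_act_bracket[OF step.prems low_in_sl z])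
    then show "coset_emb ind.K (ind.ind_act A (ind.ind_act (low k) ?z)) =
      coset_emb ind.K (ind.ind_act (low k) (ind.ind_act A ?z) \<oplus>\<^bsub>M\<^esub> ind.ind_act (bracket sl A (low k)) ?z)"
      using z step.prems low_in_sl by (simp del: sl_simps)
  qed (use z br step.prems low_in_sl in \<open>simp_all del: sl_simps\<close>)
  moreover have "ind.ind_act (low k) (ind.ind_act A ?z) \<in> emon_span"
    using lop_emon_span[OF step.IH[OF step.prems], of k] z step.prems by (simp add: lop_def del: sl_simps)
  ultimately have "ind.ind_act A (ind.ind_act (low k) ?z) \<in> emon_span"
    using step.IH[OF br] emon_span.add by simp
  then show ?case unfolding emon_Suc using z by (simp add: lop_def)
qed

lemma ind_act_emon_span: "z \<in> emon_span \<Longrightarrow> A \<in> carrier sl \<Longrightarrow> ind.ind_act A z \<in> emon_span"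
proof (induction rule: emon_span.induct)
  case (emon w \<alpha>)
  then show ?case by (intro ind_act_emon)
next
  case (add x z)
  then have "ind.ind_act A (x \<oplus>\<^bsub>M\<^esub> z) = ind.ind_act A x \<oplus>\<^bsub>M\<^esub> ind.ind_act A z"
    using M.act_add[of A x z] emon_span_closed by simp
  then show ?case using add emon_span.add by simp
qed

lemma emon_span_eq: "z \<in> carrier M \<Longrightarrow> z \<in> emon_span"
proof (induction rule: ind.induced_induct)
  case (unit v)
  then show ?case using emon_span.emon[of v "\<lambda>_. 0"] by (simp add: emon_0)
qed (auto intro: zero_emon_span emon_span.add smult_emon_span ind_act_emon_span simp del: sl_simps)

lemma emon_expansion:
  assumes "z \<in> carrier M"
  obtains S a where "finite S" "\<And>\<alpha>. a \<alpha> \<in> carrier W" "z = (\<Oplus>\<^bsub>M\<^esub>\<alpha>\<in>S. emon \<alpha> (a \<alpha>))"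
proof -
  have "z \<in> emon_span" using assms by (rule emon_span_eq)
  \<comment> \<open>Coefficients are zero outside the support, so that two expansions can be added
    over the union of their supports.\<close>
  then have "\<exists>S a. finite S \<and> (\<forall>\<alpha>. a \<alpha> \<in> carrier W) \<and> (\<forall>\<alpha>. \<alpha> \<notin> S \<longrightarrow> a \<alpha> = \<zero>\<^bsub>W\<^esub>) \<and> z = (\<Oplus>\<^bsub>M\<^esub>\<alpha>\<in>S. emon \<alpha> (a \<alpha>))"
  proof (induction rule: emon_span.induct)
    case (emon w \<alpha>)
    have "emon \<alpha> w = (\<Oplus>\<^bsub>M\<^esub>\<beta>\<in>{\<alpha>}. emon \<beta> (if \<beta> = \<alpha> then w else \<zero>\<^bsub>W\<^esub>))"
      by (rule ind.T.j_inj) (use emon in simp_all)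
    then show ?case using emon by (intro exI[of _ "{\<alpha>}"] exI[of _ "\<lambda>\<beta>. if \<beta> = \<alpha> then w else \<zero>\<^bsub>W\<^esub>"]) auto
  next
    case (add x z)
    obtain S a where x: "finite S" "\<forall>\<alpha>. a \<alpha> \<in> carrier W" "\<forall>\<alpha>. \<alpha> \<notin> S \<longrightarrow> a \<alpha> = \<zero>\<^bsub>W\<^esub>"
      "x = (\<Oplus>\<^bsub>M\<^esub>\<alpha>\<in>S. emon \<alpha> (a \<alpha>))" using add.IH(1) by blast
    obtain S' a' where z: "finite S'" "\<forall>\<alpha>. a' \<alpha> \<in> carrier W" "\<forall>\<alpha>. \<alpha> \<notin> S' \<longrightarrow> a' \<alpha> = \<zero>\<^bsub>W\<^esub>"
      "z = (\<Oplus>\<^bsub>M\<^esub>\<alpha>\<in>S'. emon \<alpha> (a' \<alpha>))" using add.IH(2) by blast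
    have "(\<Sum>\<alpha>\<in>S. coset_emb ind.K (emon \<alpha> (a \<alpha>))) = (\<Sum>\<alpha>\<in>S \<union> S'. coset_emb ind.K (emon \<alpha> (a \<alpha>)))"
      by (rule sum.mono_neutral_left) (use x z in \<open>simp_all add: emon_zero\<close>)
    moreover have "(\<Sum>\<alpha>\<in>S'. coset_emb ind.K (emon \<alpha> (a' \<alpha>))) = (\<Sum>\<alpha>\<in>S \<union> S'. coset_emb ind.K (emon \<alpha> (a' \<alpha>)))"
      by (rule sum.mono_neutral_left) (use x z in \<open>simp_all add: emon_zero\<close>)
    ultimately have "x \<oplus>\<^bsub>M\<^esub> z = (\<Oplus>\<^bsub>M\<^esub>\<alpha>\<in>S \<union> S'. emon \<alpha> (a \<alpha> \<oplus>\<^bsub>W\<^esub> a' \<alpha>))"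
      by (intro ind.T.j_inj) (use x z in \<open>simp_all add: emon_add sum.distrib\<close>)
    then show ?case using x z
      by (intro exI[of _ "S \<union> S'"] exI[of _ "\<lambda>\<alpha>. a \<alpha> \<oplus>\<^bsub>W\<^esub> a' \<alpha>"]) (auto intro!: W.V.j_inj)
  qed
  then show ?thesis using that by blast
qed

section \<open>Evaluation at the points -1 - \<beta> and bijectivity\<close>

abbreviation npt :: "('m \<Rightarrow> nat) \<Rightarrow> 'm \<Rightarrow> complex" where
  "npt \<beta> \<equiv> \<lambda>i. - 1 - of_nat (\<beta> i)"

text \<open>At -1 - \<beta> the factor -(x_i + 1) of the operator is \<beta>_i, and the shift by e_i
  leads to -1 - (\<beta> - e_i).\<close>

lemma Ev_low_pt:
  assumes "w \<in> carrier W"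
  shows "Ev (npt \<beta>) (sact (low i) (pt f w)) = cscale (of_nat (\<beta> i)) (Ev (npt (\<beta>(i := \<beta> i - 1))) (pt f w))"
proof -
  have "ev (- g) x = - ev g x" for g :: "'m mpoly" and x using ev_diff[of 0 g x] by simp
  then have 1: "Ev (npt \<beta>) (sact (low i) (pt f w)) =
      cscale (of_nat (\<beta> i) * ev f ((npt \<beta>)(i := npt \<beta> i + 1))) (jW w)"
    by (simp add: sact_low[OF assms])
  show ?thesis
  proof (cases "\<beta> i = 0")
    \<comment> \<open>Truncated subtraction leaves \<open>\<beta> i - 1\<close> at 0, which is
      harmless as both sides carry the factor 0.\<close>
    case True
    then have 0: "of_nat (\<beta> i) = (0 :: complex)" by simp
    show ?thesis unfolding 1 0 by (simp only: mult_zero_left cvs.scale_zero_left)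
  next
    case False
    then have "(npt \<beta>)(i := npt \<beta> i + 1) = npt (\<beta>(i := \<beta> i - 1))"
      by (auto simp: fun_eq_iff of_nat_diff)
    then show ?thesis unfolding 1 by (simp only: Ev_simps(1) cvs.scale_scale)
  qed
qed

lemma Ev_low:
  assumes "z \<in> carrier T"
  shows "Ev (npt \<beta>) (sact (low i) z) = cscale (of_nat (\<beta> i)) (Ev (npt (\<beta>(i := \<beta> i - 1))) z)"
proof -
  have lin: "sact (low i) (x \<oplus>\<^bsub>T\<^esub> z) = sact (low i) x \<oplus>\<^bsub>T\<^esub> sact (low i) z"
    "sact (low i) (c \<odot>\<^bsub>T\<^esub> x) = c \<odot>\<^bsub>T\<^esub> sact (low i) x" if "x \<in> carrier T" "z \<in> carrier T" for x z c
    using linear_tact[of "sigma lam (low i)"] that by (simp_all add: linear_op_def)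
  note [simp del] = fun_upd_apply
  show ?thesis using assms
  proof (rule linear_eq_on_pt[where s=cscale])
    show "Ev (npt \<beta>) (sact (low i) \<zero>\<^bsub>T\<^esub>) = 0"
      by (simp add: T.linear_op_zero[OF linear_tact])
    fix x z c assume x: "x \<in> carrier T" and z: "z \<in> carrier T"
    show "Ev (npt \<beta>) (sact (low i) (x \<oplus>\<^bsub>T\<^esub> z)) = Ev (npt \<beta>) (sact (low i) x) + Ev (npt \<beta>) (sact (low i) z)"
      using x z by (simp add: lin)
    show "cscale (of_nat (\<beta> i)) (Ev (npt (\<beta>(i := \<beta> i - 1))) (x \<oplus>\<^bsub>T\<^esub> z)) =
      cscale (of_nat (\<beta> i)) (Ev (npt (\<beta>(i := \<beta> i - 1))) x) + cscale (of_nat (\<beta> i)) (Ev (npt (\<beta>(i := \<beta> i - 1))) z)"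
      using x z by (simp only: Ev_simps cvs.scale_right_distrib)
  next
    fix x c assume x: "x \<in> carrier T"
    show "Ev (npt \<beta>) (sact (low i) (c \<odot>\<^bsub>T\<^esub> x)) = cscale c (Ev (npt \<beta>) (sact (low i) x))"
      using x by (simp add: lin(2)[OF x x])
    show "cscale (of_nat (\<beta> i)) (Ev (npt (\<beta>(i := \<beta> i - 1))) (c \<odot>\<^bsub>T\<^esub> x)) =
        cscale c (cscale (of_nat (\<beta> i)) (Ev (npt (\<beta>(i := \<beta> i - 1))) x))"
      using x by (simp only: Ev_simps cvs.scale_scale mult.commute)
  next
    show "cscale (of_nat (\<beta> i)) (Ev (npt (\<beta>(i := \<beta> i - 1))) \<zero>\<^bsub>T\<^esub>) = 0"
      by (simp only: Ev_simps cvs.scale_zero_right)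
  qed (rule Ev_low_pt)
qed

lemma gen_verma_iso:
  "lie_module_iso sl (gen_verma (W_tilde lam W)) (twist (sigma lam) (tensor_module (Omega lam) W))"
proof -
  obtain \<phi> where \<phi>_closed: "\<And>z. z \<in> carrier M \<Longrightarrow> \<phi> z \<in> carrier F"
    and \<phi>_add: "\<And>x y. \<lbrakk>x \<in> carrier M; y \<in> carrier M\<rbrakk> \<Longrightarrow> \<phi> (x \<oplus>\<^bsub>M\<^esub> y) = \<phi> x \<oplus>\<^bsub>F\<^esub> \<phi> y"
    and \<phi>_smult: "\<And>c x. x \<in> carrier M \<Longrightarrow> \<phi> (c \<odot>\<^bsub>M\<^esub> x) = c \<odot>\<^bsub>F\<^esub> \<phi> x"
    and \<phi>_act: "\<And>A z. \<lbrakk>A \<in> carrier sl; z \<in> carrier M\<rbrakk> \<Longrightarrow> \<phi> (ind.ind_act A z) = act F A (\<phi> z)"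
    and \<phi>_unit: "\<And>w. w \<in> carrier V \<Longrightarrow> \<phi> (ind.unit_pt w) = pt 1 w"
  proof (rule ind.frobenius_reciprocity[OF F.lie_rep_axioms, of "pt 1"])
    show "pt 1 v \<in> carrier F" if "v \<in> carrier V" for v using that by simp
    show "pt 1 (v \<oplus>\<^bsub>V\<^esub> w) = pt 1 v \<oplus>\<^bsub>F\<^esub> pt 1 w" if "v \<in> carrier V" "w \<in> carrier V" for v w
      using that by (simp add: pt_add_right)
    show "pt 1 (c \<odot>\<^bsub>V\<^esub> v) = c \<odot>\<^bsub>F\<^esub> pt 1 v" if "v \<in> carrier V" for v c
      using that by (simp add: pt_smult_right)
    show "pt 1 (act V A v) = act F A (pt 1 v)" if "A \<in> carrier parabolic" "v \<in> carrier V" for A v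
      using pt_V_act[OF that(1), of v] that(2) by simp
  qed blast
  note \<phi> [simp] = \<phi>_closed[simplified] \<phi>_add[simplified] \<phi>_smult[simplified] \<phi>_unit[simplified]
  have \<phi>_low: "\<phi> (lop i z) = sact (low i) (\<phi> z)" if "z \<in> carrier M" for i z
    using \<phi>_act[OF low_in_sl that] that by (simp add: lop_def)
  have \<phi>_zero [simp]: "\<phi> \<zero>\<^bsub>M\<^esub> = \<zero>\<^bsub>T\<^esub>"
    using \<phi>(3)[of "\<zero>\<^bsub>M\<^esub>" 0] by simp
  \<comment> \<open>The constant is the product over i of the falling factorials \<beta>_i
    (\<beta>_i - 1) ... (\<beta>_i - \<alpha>_i + 1). Only a bound on its support and its being
    nonzero at \<alpha> are recorded.\<close>
  have triangular: "\<exists>c. c \<alpha> \<noteq> 0 \<and> (\<forall>\<beta>. (c \<beta> \<noteq> 0 \<longrightarrow> (\<forall>i. \<alpha> i \<le> \<beta> i)) \<and>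
      (\<forall>w\<in>carrier W. Ev (npt \<beta>) (\<phi> (emon \<alpha> w)) = cscale (c \<beta>) (jW w)))" for \<alpha> :: "'m \<Rightarrow> nat"
  proof (induction \<alpha> rule: multi_index_induct)
    case zero
    have "Ev x (\<phi> (emon (\<lambda>_. 0) w)) = cscale 1 (jW w)" if "w \<in> carrier W" for x w
      using that by (simp add: emon_0)
    then show ?case by (intro exI[of _ "\<lambda>_. 1"] conjI allI ballI impI) (simp, simp, blast)
  next
    case (step \<alpha> k)
    then obtain c where c: "c \<alpha> \<noteq> (0 :: complex)" "\<And>\<beta> i. c \<beta> \<noteq> 0 \<Longrightarrow> \<alpha> i \<le> \<beta> i"
      "\<And>\<beta> w. w \<in> carrier W \<Longrightarrow> Ev (npt \<beta>) (\<phi> (emon \<alpha> w)) = cscale (c \<beta>) (jW w)" by blast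
    let ?c = "\<lambda>\<beta>. of_nat (\<beta> k) * c (\<beta>(k := \<beta> k - 1))"
    show ?case
    proof (intro exI[of _ ?c] conjI allI impI ballI)
      show "?c (\<alpha>(k := Suc (\<alpha> k))) \<noteq> 0" using c(1) by (simp del: of_nat_Suc)
      \<comment> \<open>At \<open>k\<close> the nonzero factor \<open>of_nat (\<beta> k)\<close>
        excludes truncation, so \<alpha>_k \<le> \<beta>_k - 1 gives the bound for the
        successor.\<close>
      show "(\<alpha>(k := Suc (\<alpha> k))) i \<le> \<beta> i" if "?c \<beta> \<noteq> 0" for \<beta> i
        using that c(2)[of "\<beta>(k := \<beta> k - 1)" i] by (cases "i = k") auto
      show "Ev (npt \<beta>) (\<phi> (emon (\<alpha>(k := Suc (\<alpha> k))) w)) = cscale (?c \<beta>) (jW w)" if "w \<in> carrier W" for \<beta> w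
        unfolding emon_Suc using that by (simp only: \<phi>_low emon_closed Ev_low \<phi>(1) c(3) cvs.scale_scale)
    qed
  qed
  have inj0: "z = \<zero>\<^bsub>M\<^esub>" if z: "z \<in> carrier M" "\<phi> z = \<zero>\<^bsub>T\<^esub>" for z
  proof -
    obtain S a where S: "finite S" and a: "\<And>\<alpha>. a \<alpha> \<in> carrier W" and z_eq: "z = (\<Oplus>\<^bsub>M\<^esub>\<alpha>\<in>S. emon \<alpha> (a \<alpha>))"
      using emon_expansion[OF z(1)] by blast
    have Ev_sum: "Ev x (\<phi> (\<Oplus>\<^bsub>M\<^esub>\<alpha>\<in>S'. emon \<alpha> (a \<alpha>))) = (\<Sum>\<alpha>\<in>S'. Ev x (\<phi> (emon \<alpha> (a \<alpha>))))"
      if "finite S'" for S' x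
    proof -
      interpret abelian_group M by (rule ind.T.abelian_group)
      show ?thesis using that
      proof (induction S')
        case (insert \<alpha> S')
        have "(\<Oplus>\<^bsub>M\<^esub>\<beta>\<in>insert \<alpha> S'. emon \<beta> (a \<beta>)) = emon \<alpha> (a \<alpha>) \<oplus>\<^bsub>M\<^esub> (\<Oplus>\<^bsub>M\<^esub>\<beta>\<in>S'. emon \<beta> (a \<beta>))"
          using insert a by (intro finsum_insert) auto
        then show ?case using insert a by simp
      qed simp
    qed
    \<comment> \<open>Induction on the total degree of \<alpha>. At the point -1 - \<alpha> the
      terms with \<beta> below \<alpha> vanish by the induction hypothesis and those with \<beta>
      not below \<alpha> by triangularity, which isolates the coefficient of \<alpha>.\<close>
    have "a \<alpha> = \<zero>\<^bsub>W\<^esub>" if "\<alpha> \<in> S" for \<alpha>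
      using that
    proof (induction "\<Sum>i\<in>UNIV. \<alpha> i" arbitrary: \<alpha> rule: less_induct)
      case less
      obtain c where c: "c \<noteq> 0" "\<And>w. w \<in> carrier W \<Longrightarrow> Ev (npt \<alpha>) (\<phi> (emon \<alpha> w)) = cscale c (jW w)"
        using triangular[of \<alpha>] by blast
      have "Ev (npt \<alpha>) (\<phi> (emon \<beta> (a \<beta>))) = 0" if \<beta>: "\<beta> \<in> S" "\<beta> \<noteq> \<alpha>" for \<beta>
      proof (cases "\<forall>i. \<beta> i \<le> \<alpha> i")
        case True
        obtain k where "\<beta> k < \<alpha> k" using True \<beta>(2) by (metis ext order_le_less)
        then have "(\<Sum>i\<in>UNIV. \<beta> i) < (\<Sum>i\<in>UNIV. \<alpha> i)"
          using True by (intro sum_strict_mono_ex1) auto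
        then have "a \<beta> = \<zero>\<^bsub>W\<^esub>" using less.hyps \<beta>(1) by blast
        then show ?thesis by (simp add: emon_zero)
      next
        case False
        obtain d where d: "\<And>\<gamma> i. d \<gamma> \<noteq> (0 :: complex) \<Longrightarrow> \<beta> i \<le> \<gamma> i"
          "\<And>\<gamma> w. w \<in> carrier W \<Longrightarrow> Ev (npt \<gamma>) (\<phi> (emon \<beta> w)) = cscale (d \<gamma>) (jW w)"
          using triangular[of \<beta>] by blast
        have "d \<alpha> = 0" using d(1) False by blast
        then show ?thesis unfolding d(2)[OF a] by (simp only: cvs.scale_zero_left)
      qed
      then have "(\<Sum>\<beta>\<in>S. Ev (npt \<alpha>) (\<phi> (emon \<beta> (a \<beta>)))) = Ev (npt \<alpha>) (\<phi> (emon \<alpha> (a \<alpha>)))"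
        using S less.prems by (simp add: sum.remove[of S \<alpha>])
      then have "cscale c (jW (a \<alpha>)) = 0"
        using Ev_sum[OF S, of "npt \<alpha>"] z z_eq c(2)[OF a, of \<alpha>] by simp
      then have "jW (a \<alpha>) = jW \<zero>\<^bsub>W\<^esub>" using c(1) by (simp add: cvs.scale_eq_0_iff)
      then show ?case using a by (intro W.V.j_inj) auto
    qed
    then show ?thesis unfolding z_eq using a by (intro ind.T.j_inj) (simp_all add: emon_zero)
  qed
  have inj: "inj_on \<phi> (carrier M)"
  proof (rule inj_onI)
    fix x z assume x: "x \<in> carrier M" and z: "z \<in> carrier M" and eq: "\<phi> x = \<phi> z"
    have "\<phi> (x \<oplus>\<^bsub>M\<^esub> (-1) \<odot>\<^bsub>M\<^esub> z) = \<zero>\<^bsub>T\<^esub>"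
      by (rule T.j_inj) (use x z eq in simp_all)
    then have "coset_emb ind.K (x \<oplus>\<^bsub>M\<^esub> (-1) \<odot>\<^bsub>M\<^esub> z) = 0"
      using inj0[of "x \<oplus>\<^bsub>M\<^esub> (-1) \<odot>\<^bsub>M\<^esub> z"] x z by simp
    then show "x = z" using x z by (intro ind.T.j_inj) simp_all
  qed
  have image_add: "x \<oplus>\<^bsub>T\<^esub> z \<in> \<phi> ` carrier M" if x: "x \<in> \<phi> ` carrier M" and z: "z \<in> \<phi> ` carrier M" for x z
  proof -
    obtain a b where "a \<in> carrier M" "b \<in> carrier M" "x = \<phi> a" "z = \<phi> b" using x z by blast
    then show ?thesis by (intro image_eqI[of _ _ "a \<oplus>\<^bsub>M\<^esub> b"]) simp_all
  qed
  have image_smult: "c \<odot>\<^bsub>T\<^esub> x \<in> \<phi> ` carrier M" if x: "x \<in> \<phi> ` carrier M" for x c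
  proof -
    obtain a where "a \<in> carrier M" "x = \<phi> a" using x by blast
    then show ?thesis by (intro image_eqI[of _ _ "c \<odot>\<^bsub>M\<^esub> a"]) simp_all
  qed
  have pt_image: "pt f w \<in> \<phi> ` carrier M" if w: "w \<in> carrier W" for f w
    using raised_UNIV[of f]
  proof (induction f rule: raised.induct)
    case one
    have "ind.unit_pt w \<in> carrier M" using w ind.unit_pt_closed[of w] by simp
    then show ?case using w by (intro image_eqI[of _ _ "ind.unit_pt w"]) simp_all
  next
    case (add f g)
    then show ?case using image_add pt_add_left[of f g w] w by simp
  next
    case (scale f c)
    then show ?case using image_smult pt_smult_left[of f w c] w by simp
  next
    case (raise f i)
    obtain z where z: "z \<in> carrier M" "pt f w = \<phi> z" using raise.IH by blast
    \<comment> \<open>Raising is minus the action of \<open>low i\<close>, hence the factor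
      -1.\<close>
    have "pt (raise i f) w = (-1) \<odot>\<^bsub>T\<^esub> pt (- raise i f) w"
      using pt_smult_left[of "- raise i f" w "-1"] w by simp
    also have "pt (- raise i f) w = \<phi> (lop i z)"
      using z w by (simp add: \<phi>_low sact_low[symmetric])
    finally show ?case using image_smult[of "\<phi> (lop i z)" "-1"] z by simp
  qed
  have surj: "z \<in> \<phi> ` carrier M" if "z \<in> carrier T" for z
    using that
  proof (induction rule: pt_induct)
    case zero
    show ?case by (rule image_eqI[of _ _ "\<zero>\<^bsub>M\<^esub>"]) simp_all
  qed (use pt_image image_add image_smult in auto)
  have bij: "bij_betw \<phi> (carrier M) (carrier T)"
    using inj surj \<phi>(1) unfolding bij_betw_def by blast
  have verma: "gen_verma (W_tilde lam W) = make_rep M ind.ind_act"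
    by (simp only: gen_verma_def ind.induced_module_eq)
  show ?thesis
    unfolding lie_module_iso_def verma twist_eq
  proof (intro conjI exI[of _ \<phi>])
    show "lie_module sl (make_rep M ind.ind_act)" by (rule M.lie_module)
    show "lie_module sl F" by (rule F.lie_module)
  qed (use bij \<phi>_act in \<open>simp_all del: sl_simps\<close>)
qed

end

theorem theorem5p3:
  fixes lam :: "'m::finite \<Rightarrow> complex"
    and W :: "(complex ^ 'm ^ 'm, 'w) rep"
  assumes "\<And>i. lam i \<noteq> 0"
    and "lie_module gl W"
  shows "lie_module_iso sl
           (gen_verma (W_tilde lam W))
           (twist (sigma lam) (tensor_module (Omega lam) W))"
proof -
  have "Module.module complex_field W"
    using assms(2) by (simp add: lie_module_def)
  then obtain jW :: "'w \<Rightarrow> ('w \<Rightarrow>\<^sub>0 complex)" where "cspace W jW"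
    using cspace_exists by blast
  then interpret tensor_module_setup lam W jW
    using assms by (intro tensor_module_setup.intro)
  show ?thesis by (rule gen_verma_iso)
qed

end
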